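(* Let $p\in\{2,3,5,7,13\}$ and let $\ell\ne p$ be a prime with $\ell>3$. Let $s>0$ and $r<0$ be integers of opposite parity with $$0<r+sp<24\qquad\text{and}\qquad -24<s+rp<0.$$ Define $c(n)$ and $c^*(n)$ by $$\sum_{n\ge0}c(n)q^n=\prod_{n\ge1}(1-q^n)^r(1-q^{pn})^s,\qquad \phi^*(q)=\sum_{n\ge0}c^*(n)q^n=\prod_{n\ge1}(1-q^n)^s(1-q^{pn})^r,$$ with $c(x)=0$ unless $x$ is a nonnegative integer. Put $\varepsilon=\frac12(r+s)$, $\theta=(-1)^{\frac12-\frac12(r+s)}2p^s$, $\theta^*=(-1)^{\frac12-\frac12(r+s)}2p^r$, $\Delta=(r+sp)\frac{\ell^2-1}{24}$, $\Delta^*=(s+rp)\frac{\ell^2-1}{24}$. Let $E_2(q)=1-24\sum_{n\ge1}\sigma(n)q^n$, $E_p^*(q)=\frac{pE_2(q^p)-E_2(q)}{p-1}$, and define $\mu(n)$ by $$\frac{E_p^*(q)}{\phi^*(q)}=\sum_{n=0}^\infty\mu(n)q^n.$$ Then $$\ell^{2-2\varepsilon}c(\Delta)+\left(\frac{\theta}{\ell}\right)\ell^{\frac12-\varepsilon}\left(\frac{-\Delta}{\ell}\right)+c\!\left(\frac{-\Delta}{\ell^2}\right)=\mu(-\Delta^* )+\left(\frac{\theta^*}{\ell}\right)\ell^{\frac12-\varepsilon}\left(\frac{-\Delta^*}{\ell}\right).$$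
   Context: $\sigma(n)$ is the sum of divisors of $n$. $\left(\frac{\cdot}{\ell}\right)$ is the Legendre symbol; for a rational number $a/b$ with $\ell\nmid ab$ one sets $\left(\frac{a/b}{\ell}\right)=\left(\frac{ab}{\ell}\right)$. Since $r+s$ is odd, $2-2\varepsilon$ and $\frac12-\varepsilon$ are integers; $\Delta\ge0$ and $\Delta^*<0$ are integers. *)

theory Defs
  imports
    "HOL-Analysis.Analysis"
    "HOL-Computational_Algebra.Formal_Power_Series"
    "HOL-Number_Theory.Number_Theory"
begin

(* The product converges in the X-adic topology on formal power series; powi with a
   negative exponent inverts series of constant term 1. *)
definition eta_prod :: "nat \<Rightarrow> int \<Rightarrow> int \<Rightarrow> rat fps" where
  "eta_prod p a b =
     (\<Prod>n. (1 - fps_X ^ Suc n) powi a * (1 - fps_X ^ (p * Suc n)) powi b)"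

definition coeff_at :: "rat fps \<Rightarrow> rat \<Rightarrow> rat" where
  "coeff_at f x = (if x \<in> \<nat> then fps_nth f (nat \<lfloor>x\<rfloor>) else 0)"

definition divisor_sigma :: "nat \<Rightarrow> nat" where
  "divisor_sigma n = (\<Sum>d | d dvd n. d)"

definition E2 :: "rat fps" where
  "E2 = 1 - 24 * Abs_fps (\<lambda>n. if n \<ge> 1 then of_nat (divisor_sigma n) else 0)"

definition Ep_star :: "nat \<Rightarrow> rat fps" where
  "Ep_star p = (of_nat p * (E2 oo fps_X ^ p) - E2) / (of_nat p - 1)"

(* quotient_of gives the fraction a/b in lowest terms with b > 0. *)
definition Legendre_rat :: "rat \<Rightarrow> nat \<Rightarrow> rat" where
  "Legendre_rat x l = (case quotient_of x of (a, b) \<Rightarrow> of_int (Legendre (a * b) (int l)))"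

lemma Legendre_rat_of_int: "Legendre_rat (of_int a) l = of_int (Legendre a (int l))"
  by (simp add: Legendre_rat_def)

lemma coeff_at_of_nat: "coeff_at f (of_nat n) = fps_nth f n"
  by (simp add: coeff_at_def)

lemma fps_cong_one_mult:
  fixes f g :: "rat fps"
  assumes "\<And>i. i \<le> n \<Longrightarrow> fps_nth f i = fps_nth 1 i" "\<And>i. i \<le> n \<Longrightarrow> fps_nth g i = fps_nth 1 i"
  shows "i \<le> n \<Longrightarrow> fps_nth (f * g) i = fps_nth 1 i"
proof -
  assume i: "i \<le> n"
  have "fps_nth (f * g) i = (\<Sum>j=0..i. fps_nth f j * fps_nth g (i - j))"
    by (simp add: fps_mult_nth)
  also have "\<dots> = (\<Sum>j=0..i. fps_nth 1 j * fps_nth 1 (i - j))"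
    using assms i by (intro sum.cong) auto
  also have "\<dots> = fps_nth (1 * 1) i"
    by (simp only: fps_mult_nth)
  finally show ?thesis by simp
qed

lemma fps_cong_one_power:
  fixes f :: "rat fps"
  assumes "\<And>i. i \<le> n \<Longrightarrow> fps_nth f i = fps_nth 1 i"
  shows "i \<le> n \<Longrightarrow> fps_nth (f ^ k) i = fps_nth 1 i"
proof (induction k arbitrary: i)
  case (Suc k)
  show ?case
    unfolding power_Suc by (rule fps_cong_one_mult[OF assms Suc.IH Suc.prems])
qed simp

lemma fps_cong_one_inverse:
  fixes f :: "rat fps"
  assumes "\<And>i. i \<le> n \<Longrightarrow> fps_nth f i = fps_nth 1 i"
  shows "i \<le> n \<Longrightarrow> fps_nth (inverse f) i = fps_nth 1 i"
proof -
  assume i: "i \<le> n"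
  have f0: "fps_nth f 0 = 1" using assms[of 0] by simp
  have "1 - inverse f = inverse f * (f - 1)"
    using f0 by (simp add: algebra_simps inverse_mult_eq_1')
  moreover have "fps_nth (inverse f * (f - 1)) i = 0"
    unfolding fps_mult_nth using assms i by (intro sum.neutral) auto
  ultimately have "fps_nth (1 - inverse f) i = 0" by simp
  thus ?thesis by simp
qed

lemma fps_cong_one_powi:
  fixes f :: "rat fps"
  assumes "\<And>i. i \<le> n \<Longrightarrow> fps_nth f i = fps_nth 1 i"
  shows "i \<le> n \<Longrightarrow> fps_nth (f powi k) i = fps_nth 1 i"
  unfolding power_int_def
  by (cases "k \<ge> 0")
    (simp_all only: if_True if_False fps_cong_one_power[OF assms]
       fps_cong_one_power[OF fps_cong_one_inverse[OF assms]])

lemma eta_factor_nth: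
  assumes "p > 0" "i \<le> n"
  shows "fps_nth ((1 - fps_X ^ Suc n) powi a * (1 - fps_X ^ (p * Suc n)) powi b) i
           = fps_nth (1 :: rat fps) i"
proof (rule fps_cong_one_mult[of n])
  have *: "fps_nth (1 - fps_X ^ m :: rat fps) j = fps_nth 1 j" if "j \<le> n" "m > n" for j m
    using that by (simp add: fps_X_power_nth)
  have "p * Suc n > n" using assms(1)
    by (cases p) auto
  thus "fps_nth ((1 - fps_X ^ (p * Suc n) :: rat fps) powi b) j = fps_nth 1 j" if "j \<le> n" for j
    using that by (intro fps_cong_one_powi[of n] *) auto
  show "fps_nth ((1 - fps_X ^ Suc n :: rat fps) powi a) j = fps_nth 1 j" if "j \<le> n" for j
    using that by (intro fps_cong_one_powi[of n] *) auto
qed fact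

lemma eta_prod_has_prod:
  assumes "p > 0"
  shows "(\<lambda>n. (1 - fps_X ^ Suc n) powi a * (1 - fps_X ^ (p * Suc n)) powi b) has_prod eta_prod p a b"
    and "fps_nth (eta_prod p a b) 0 = 1"
proof -
  define F :: "nat \<Rightarrow> rat fps"
    where "F = (\<lambda>n. (1 - fps_X ^ Suc n) powi a * (1 - fps_X ^ (p * Suc n)) powi b)"
  define Q where "Q = (\<lambda>n. \<Prod>k\<le>n. F k)"
  have F: "fps_nth (F n) i = fps_nth 1 i" if "i \<le> n" for i n
    unfolding F_def using eta_factor_nth[OF assms that] .
  have step: "fps_nth (Q (Suc n)) i = fps_nth (Q n) i" if "i \<le> n" for i n
  proof -
    have "fps_nth (Q (Suc n)) i = (\<Sum>j=0..i. fps_nth (Q n) j * fps_nth (F (Suc n)) (i - j))"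
      by (simp add: Q_def fps_mult_nth)
    also have "\<dots> = (\<Sum>j=0..i. fps_nth (Q n) j * fps_nth 1 (i - j))"
      using that by (intro sum.cong) (auto simp: F)
    also have "\<dots> = fps_nth (Q n * 1) i" by (simp only: fps_mult_nth)
    finally show ?thesis by simp
  qed
  have stab: "fps_nth (Q n) i = fps_nth (Q i) i" if "i \<le> n" for i n
    using that by (induction n rule: dec_induct) (auto simp: step)
  define P where "P = Abs_fps (\<lambda>i. fps_nth (Q i) i)"
  have lim: "Q \<longlonglongrightarrow> P"
  proof (rule tendsto_fpsI)
    fix i
    show "\<forall>\<^sub>F n in sequentially. fps_nth (Q n) i = fps_nth P i"
      using eventually_ge_at_top[of i] by eventually_elim (unfold P_def fps_nth_Abs_fps, rule stab)
  qed
  have P0: "fps_nth P 0 = 1" using F[of 0 0] by (simp add: P_def Q_def)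
  hence "P \<noteq> 0" by auto
  with lim have hp: "F has_prod P"
    by (simp add: has_prod_def raw_has_prod_def Q_def)
  hence "eta_prod p a b = P"
    unfolding eta_prod_def F_def by (rule has_prod_unique[symmetric])
  with hp P0 show "(\<lambda>n. (1 - fps_X ^ Suc n) powi a * (1 - fps_X ^ (p * Suc n)) powi b) has_prod eta_prod p a b"
    and "fps_nth (eta_prod p a b) 0 = 1"
    by (simp_all add: F_def)
qed

end

theory Submission
  imports Defs "HOL-Complex_Analysis.Complex_Analysis" "HOL-Probability.Probability"
begin

text \<open>
  Write $u(z) = \eta(\ell^2 z)/\eta(z)$. The conjugates of $u$ under the modular group are, up to
  constants, quotients by $\eta$ of the theta functions
  $\frac12\sum_m \chi_{12}(m)\psi(m) e(m^2 z/24\ell^2)$ with $\psi$ periodic modulo $\ell^2$, and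
  are indexed by pairs $(c,d)$ modulo $\ell^2$ on which the modular group acts from the right. With
  the right normalization of $\psi$ this action has no multiplier.

  Hence $E_p^*(z)\, u(z)^r u(pz)^s$ has a well defined trace to level one, which is weakly
  holomorphic of weight two, so its constant term vanishes. The cosets at the cusp $\infty$
  contribute $E_p^*/f$ times the Hecke operator $T(\ell^2)$ applied to
  $f = \eta(z)^r\eta(pz)^s$, and the cosets at the cusp $0$ contribute the same with $r$ and $s$
  exchanged. The bounds on $r + sp$ and $s + rp$ leave only the terms of the theorem in the two
  constant terms.
\<close>

text \<open>For odd \<open>r + s\<close> the eta quotients have half-integral weight, and their
  multipliers would have to be tracked through every coset. The quotient u has weight zero: eta(l^2
  z) and eta(z) are theta series with the same character modulo 12, so the square root in the law
  for S and the root of unity in the law for T cancel. What remains is, for T, multiplication by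
  e(-k m^2 / l^2) with k = (l^2 - 1) / 24, and for S a Fourier transform modulo l^2. The only defect
  is a Gauss sum; dividing it out gives a true action.

  Pairs (c,d) replace cosets because the group acts on them linearly; each coset is then counted l
  (l - 1) times, once for every unit modulo l^2. The Gauss sums return in the cosets where l divides
  c exactly once. They contribute Legendre symbols to a total exponent that is odd, and the sum over
  these cosets yields the terms with theta and theta*.

  Few terms survive because Delta = k (r + sp) and Delta* = k (s + rp) with 24 k = l^2 - 1: the
  bounds make both smaller than l^2 in absolute value.\<close>

definition ee :: "complex \<Rightarrow> complex" where "ee z = exp (2 * of_real pi * \<i> * z)"

lemma ee_0 [simp]: "ee 0 = 1" by (simp add: ee_def)
lemma ee_nonzero [simp]: "ee z \<noteq> 0" by (simp add: ee_def)
lemma ee_add: "ee (x + y) = ee x * ee y" by (simp add: ee_def ring_distribs exp_add)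
lemma ee_minus: "ee (- x) = inverse (ee x)" by (simp add: ee_def exp_minus)

lemma ee_eq_1_iff: "ee z = 1 \<longleftrightarrow> (\<exists>n. z = of_int n)"
proof
  assume "ee z = 1"
  then obtain n :: int where n: "Re (2 * of_real pi * \<i> * z) = 0" "Im (2 * of_real pi * \<i> * z) = of_int (2 * n) * pi"
    unfolding ee_def exp_eq_1 by blast
  from n have "Im z = 0" "Re z = of_int n" by auto
  hence "z = of_int n" by (simp add: complex_eq_iff)
  thus "\<exists>n. z = of_int n" ..
next
  assume "\<exists>n. z = of_int n"
  then obtain n where "z = of_int n" ..
  thus "ee z = 1" unfolding ee_def exp_eq_1 by (intro conjI exI[of _ n]) auto
qed

lemma ee_of_int [simp]: "ee (of_int n) = 1" using ee_eq_1_iff by blast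
lemma ee_of_nat [simp]: "ee (of_nat n) = 1" using ee_of_int[of "int n"] by simp
lemma ee_add_int [simp]: "ee (z + of_int n) = ee z" by (simp add: ee_add)
lemma norm_ee: "norm (ee z) = exp (- (2 * pi * Im z))" by (simp add: ee_def)
lemma ee_of_nat_mult: "ee (of_nat n * z) = ee z ^ n"
  by (simp add: ee_def exp_of_nat_mult[symmetric] mult_ac)
lemma ee_of_int_mult: "ee (of_int n * z) = ee z powi n"
proof (cases "n \<ge> 0")
  case True
  thus ?thesis using ee_of_nat_mult[of "nat n" z] by (simp add: power_int_def)
next
  case False
  thus ?thesis using ee_of_nat_mult[of "nat (-n)" z]
    by (simp add: power_int_def ee_minus power_inverse) (metis inverse_inverse_eq)
qed

lemma holomorphic_ee [holomorphic_intros]: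
  "f holomorphic_on A \<Longrightarrow> (\<lambda>z. ee (f z)) holomorphic_on A"
  unfolding ee_def by (intro holomorphic_intros)

lemma ee_has_field_derivative [derivative_intros]:
  "(f has_field_derivative f') (at z within A) \<Longrightarrow>
   ((\<lambda>z. ee (f z)) has_field_derivative (2 * of_real pi * \<i> * f' * ee (f z))) (at z within A)"
  unfolding ee_def by (auto intro!: derivative_eq_intros)

section \<open>Series over the integers: majorants and holomorphy\<close>

lemma summable_on_int_exp_abs: "(\<lambda>n::int. exp (- real_of_int \<bar>n\<bar>)) summable_on UNIV"
proof -
  have s: "(\<lambda>n::nat. exp (- real n)) summable_on UNIV"
  proof -
    have "summable (\<lambda>n::nat. exp (-1::real) ^ n)" by (intro summable_geometric) auto
    hence "summable (\<lambda>n::nat. exp (- real n))" by (simp add: exp_of_nat_mult[symmetric])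
    thus ?thesis by (intro norm_summable_imp_summable_on) auto
  qed
  have "(\<lambda>n::int. exp (- real_of_int \<bar>n\<bar>)) summable_on (range int)"
    using s by (subst summable_on_reindex) (auto simp: o_def)
  moreover have "(\<lambda>n::int. exp (- real_of_int \<bar>n\<bar>)) summable_on (range (\<lambda>n. - int n))"
    using s by (subst summable_on_reindex) (auto simp: o_def inj_on_def)
  ultimately have "(\<lambda>n::int. exp (- real_of_int \<bar>n\<bar>)) summable_on (range int \<union> range (\<lambda>n. - int n))"
    by (rule summable_on_union)
  also have "range int \<union> range (\<lambda>n. - int n) = UNIV"
  proof -
    have "n \<in> range int \<union> range (\<lambda>n. - int n)" for n
      by (cases n rule: int_cases2) auto
    thus ?thesis by blast
  qed
  finally show ?thesis .
qed

lemma summable_on_int_gauss: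
  assumes "A > 0"
  shows "(\<lambda>n::int. exp (- A * real_of_int (n^2) + B * real_of_int \<bar>n\<bar>)) summable_on UNIV"
proof -
  \<comment> \<open>Completing the square: \<open>(B + 1) * x - A * x^2\<close> is at most
    \<open>C\<close>. Raising \<open>B\<close> by 1 leaves the factor \<open>exp (- x)\<close> that
    gives convergence.\<close>
  define C where "C = (B + 1)^2 / (4 * A)"
  have "(\<lambda>n::int. exp C * exp (- real_of_int \<bar>n\<bar>)) summable_on UNIV"
    by (intro summable_on_cmult_right summable_on_int_exp_abs)
  hence "(\<lambda>n::int. norm (exp (- A * real_of_int (n^2) + B * real_of_int \<bar>n\<bar>))) summable_on UNIV"
  proof (rule Infinite_Sum.abs_summable_on_comparison_test')
    fix n :: int
    define x where "x = real_of_int \<bar>n\<bar>"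
    have "0 \<le> (2 * A * x - (B + 1))^2" by simp
    moreover have "4 * A * C = (B + 1)^2" using assms by (simp add: C_def)
    ultimately have "4 * A * ((B + 1) * x) \<le> 4 * A * (A * x^2 + C)"
      by (simp add: power2_eq_square algebra_simps)
    hence "(B + 1) * x \<le> A * x^2 + C" using assms by simp
    hence "- A * x^2 + B * x \<le> C - x" by (simp add: algebra_simps)
    moreover have "real_of_int (n^2) = x^2" by (simp add: x_def)
    ultimately show "norm (exp (- A * real_of_int (n^2) + B * real_of_int \<bar>n\<bar>)) \<le> exp C * exp (- real_of_int \<bar>n\<bar>)"
      by (simp add: x_def exp_add[symmetric])
  qed
  thus ?thesis by simp
qed

text \<open>Locally uniform convergence is enough for holomorphy. A majorant is required only on a
  disc around each point, because the majorants of the theta series below degenerate towards the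
  real axis.\<close>

lemma holomorphic_on_infsum:
  fixes f :: "'a \<Rightarrow> complex \<Rightarrow> complex"
  assumes "open S" and hol: "\<And>n. f n holomorphic_on S"
    and bd: "\<And>x. x \<in> S \<Longrightarrow> \<exists>d>0. cball x d \<subseteq> S \<and> (\<exists>M. M summable_on UNIV \<and> (\<forall>n. \<forall>y\<in>cball x d. norm (f n y) \<le> M n))"
  shows "(\<lambda>z. \<Sum>\<^sub>\<infinity>n. f n z) holomorphic_on S"
proof -
  have "(\<lambda>z. \<Sum>\<^sub>\<infinity>n. f n z) field_differentiable at x" if x: "x \<in> S" for x
  proof -
    obtain d M where d: "d > 0" "cball x d \<subseteq> S" and M: "M summable_on UNIV"
        "\<And>n y. y \<in> cball x d \<Longrightarrow> norm (f n y) \<le> M n" using bd[OF x] by blast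
    have ul: "uniform_limit (cball x d) (\<lambda>X y. \<Sum>n\<in>X. f n y) (\<lambda>y. \<Sum>\<^sub>\<infinity>n. f n y) (finite_subsets_at_top UNIV)"
      by (rule Weierstrass_m_test_general[OF M(2) M(1)])
    have "(\<lambda>z. \<Sum>\<^sub>\<infinity>n. f n z) holomorphic_on ball x d"
    proof (rule holomorphic_uniform_limit[OF _ ul])
      show "\<forall>\<^sub>F X in finite_subsets_at_top UNIV. continuous_on (cball x d) (\<lambda>y. \<Sum>n\<in>X. f n y) \<and> (\<lambda>y. \<Sum>n\<in>X. f n y) holomorphic_on ball x d"
      proof (intro always_eventually allI conjI)
        fix X
        have "(\<lambda>y. \<Sum>n\<in>X. f n y) holomorphic_on S" by (intro holomorphic_intros hol)
        thus "continuous_on (cball x d) (\<lambda>y. \<Sum>n\<in>X. f n y)" "(\<lambda>y. \<Sum>n\<in>X. f n y) holomorphic_on ball x d"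
          using d(2) ball_subset_cball[of x d]
          by (blast intro: holomorphic_on_subset holomorphic_on_imp_continuous_on continuous_on_subset)+
      qed
    qed (use d in auto)
    thus ?thesis using d by (auto intro: holomorphic_on_imp_differentiable_at)
  qed
  thus ?thesis by (auto simp: holomorphic_on_def field_differentiable_at_within)
qed

text \<open>Passes from unordered sums over the integers to limits of symmetric partial sums, the
  form in which the Fourier expansion and the pentagonal number theorem are obtained.\<close>

lemma filterlim_int_interval:
  "filterlim (\<lambda>N::nat. {- int N..int N}) (finite_subsets_at_top UNIV) sequentially"
  unfolding filterlim_finite_subsets_at_top
proof (intro allI impI)
  fix X :: "int set" assume X: "finite X \<and> X \<subseteq> UNIV"
  obtain B where B: "\<forall>x\<in>X. \<bar>x\<bar> \<le> B" using X
    by (metis finite_imageI bdd_above_finite bdd_above.unfold image_eqI)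
  show "\<forall>\<^sub>F N in sequentially. finite {- int N..int N} \<and> X \<subseteq> {- int N..int N} \<and> {- int N..int N} \<subseteq> UNIV"
    using eventually_ge_at_top[of "nat B"]
  proof eventually_elim
    case (elim N)
    have "x \<in> {- int N..int N}" if "x \<in> X" for x using B that elim by fastforce
    thus ?case by auto
  qed
qed

text \<open>Serves for Fourier coefficients of entire functions of period 1. The base point
  \<open>w\<close> is kept free so that the path of integration can be moved vertically.\<close>

definition unit_integral :: "(complex \<Rightarrow> complex) \<Rightarrow> complex \<Rightarrow> complex" where
  "unit_integral f w = integral {0..1} (\<lambda>x. f (w + of_real x))"

lemma unit_integral_primitive:
  fixes w :: complex
  assumes "\<And>z. z \<in> closed_segment w (w + 1) \<Longrightarrow> (P has_field_derivative f z) (at z)"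
  shows "((\<lambda>x. f (w + of_real x)) has_integral (P (w + 1) - P w)) {0..1}"
proof -
  have "((\<lambda>x. f (w + of_real x)) has_integral (P (w + of_real 1) - P (w + of_real 0))) {0..1}"
  proof (rule fundamental_theorem_of_calculus)
    fix x :: real assume x: "x \<in> {0..1}"
    have "w + of_real x \<in> closed_segment w (w + 1)"
      using x unfolding closed_segment_def
      by (auto intro!: exI[of _ x] simp: algebra_simps scaleR_conv_of_real)
    note * = assms[OF this]
    have "((\<lambda>x. w + of_real x) has_vector_derivative 1) (at x within {0..1})"
      by (auto intro!: derivative_eq_intros)
    from field_vector_diff_chain_within[OF this has_field_derivative_at_within[OF *]]
    show "((\<lambda>x. P (w + of_real x)) has_vector_derivative f (w + of_real x)) (at x within {0..1})"
      by (simp add: o_def)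
  qed auto
  thus ?thesis by simp
qed

lemma continuous_on_unit_shift:
  assumes "f holomorphic_on UNIV"
  shows "continuous_on A (\<lambda>x::real. f (w + of_real x))"
proof -
  have "continuous_on UNIV f" using assms by (rule holomorphic_on_imp_continuous_on)
  thus ?thesis by (rule continuous_on_compose2[of UNIV f]) (auto intro!: continuous_intros)
qed

lemma unit_integral_add:
  assumes "f holomorphic_on UNIV" "g holomorphic_on UNIV"
  shows "unit_integral (\<lambda>z. f z + g z) w = unit_integral f w + unit_integral g w"
  unfolding unit_integral_def
  by (intro integral_add integrable_continuous_real continuous_on_unit_shift assms)

lemma unit_integral_diff:
  assumes "f holomorphic_on UNIV" "g holomorphic_on UNIV"
  shows "unit_integral (\<lambda>z. f z - g z) w = unit_integral f w - unit_integral g w"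
  unfolding unit_integral_def
  by (intro integral_diff integrable_continuous_real continuous_on_unit_shift assms)

lemma unit_integral_cmult: "unit_integral (\<lambda>z. c * f z) w = c * unit_integral f w"
  unfolding unit_integral_def by simp

text \<open>An entire primitive \<open>P\<close> turns the integral into
  \<open>P (w + 1) - P w\<close>, whose derivative in \<open>w\<close> vanishes by
  periodicity.\<close>

lemma unit_integral_shift:
  assumes hol: "f holomorphic_on UNIV" and per: "\<And>z. f (z + 1) = f z"
  shows "unit_integral f w = unit_integral f 0"
proof -
  obtain P where P: "\<And>z. (P has_field_derivative f z) (at z)"
    using holomorphic_convex_primitive'[OF convex_UNIV open_UNIV hol] by auto
  have eq: "unit_integral f w = P (w + 1) - P w" for w
    unfolding unit_integral_def by (rule integral_unique, rule unit_integral_primitive, rule P)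
  have D: "((\<lambda>w. P (w + 1) - P w) has_field_derivative 0) (at w)" for w
  proof -
    have "((\<lambda>w. P (w + 1)) has_field_derivative f (w + 1) * 1) (at w)"
      by (rule DERIV_chain2[OF P]) (auto intro!: derivative_eq_intros)
    from DERIV_diff[OF this P] show ?thesis by (simp add: per)
  qed
  have "P (w + 1) - P w = P (0 + 1) - P 0"
    using has_field_derivative_zero_constant[of UNIV "\<lambda>w. P (w + 1) - P w"] D
    by (metis UNIV_I convex_UNIV)
  thus ?thesis by (simp add: eq)
qed

lemma unit_integral_ee:
  assumes "m \<noteq> 0"
  shows "unit_integral (\<lambda>z. ee (of_int m * (z - w))) 0 = 0"
proof -
  define c where "c = 2 * of_real pi * \<i> * of_int m"
  have c: "c \<noteq> 0" using assms by (simp add: c_def)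
  have "((\<lambda>z. ee (of_int m * (z - w)) / c) has_field_derivative ee (of_int m * (z - w))) (at z)" for z
    using c by (auto intro!: derivative_eq_intros simp: c_def)
  from unit_integral_primitive[OF this, of 0]
  have "unit_integral (\<lambda>z. ee (of_int m * (z - w))) 0 = ee (of_int m * (1 - w)) / c - ee (of_int m * (0 - w)) / c"
    unfolding unit_integral_def by (intro integral_unique) auto
  also have "of_int m * (1 - w) = of_int m * (0 - w) + of_int m" by (simp add: algebra_simps)
  finally show ?thesis by (simp only: ee_add_int) simp
qed

lemma norm_unit_integral_le:
  assumes "f holomorphic_on UNIV" "\<And>x. x \<in> {0..1} \<Longrightarrow> norm (f (w + of_real x)) \<le> B"
  shows "norm (unit_integral f w) \<le> B"
  unfolding unit_integral_def
  using integral_bound[of 0 1 "\<lambda>x. f (w + of_real x)" B] continuous_on_unit_shift[OF assms(1)] assms(2) by auto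

lemma entire_divide_simple_zeros:
  assumes f: "f holomorphic_on UNIV" and g: "g holomorphic_on UNIV"
    and zero: "\<And>z. g z = 0 \<Longrightarrow> f z = 0" and simple: "\<And>z. g z = 0 \<Longrightarrow> deriv g z \<noteq> 0"
  shows "(\<lambda>z. if g z = 0 then deriv f z / deriv g z else f z / g z) holomorphic_on UNIV" (is "?h holomorphic_on _")
proof -
  have "?h field_differentiable at a" for a
  proof (cases "g a = 0")
    case False
    have "isCont g a" using g by (simp add: holomorphic_on_imp_differentiable_at field_differentiable_imp_continuous_at)
    from continuous_at_avoid[OF this False]
    obtain d where d: "d > 0" "\<And>z. z \<in> ball a d \<Longrightarrow> g z \<noteq> 0" by auto
    have "(\<lambda>z. f z / g z) holomorphic_on ball a d"
      using d f g by (intro holomorphic_intros) (auto intro: holomorphic_on_subset)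
    hence "?h holomorphic_on ball a d" by (rule holomorphic_transform) (use d in auto)
    thus ?thesis using d by (auto intro: holomorphic_on_imp_differentiable_at)
  next
    case True
    \<comment> \<open>Dividing numerator and denominator by \<open>z - a\<close> does not change the
      quotient. Both difference quotients are entire, and that of \<open>g\<close> is nonzero near
      \<open>a\<close> because the zero is simple.\<close>
    define f1 where "f1 = (\<lambda>z. if z = a then deriv f a else (f z - f a) / (z - a))"
    define g1 where "g1 = (\<lambda>z. if z = a then deriv g a else (g z - g a) / (z - a))"
    have f1: "f1 holomorphic_on UNIV" unfolding f1_def by (rule pole_lemma[OF f]) auto
    have g1: "g1 holomorphic_on UNIV" unfolding g1_def by (rule pole_lemma[OF g]) auto
    have "g1 a \<noteq> 0" using simple[OF True] by (simp add: g1_def)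
    moreover have "isCont g1 a" using g1 by (simp add: holomorphic_on_imp_differentiable_at field_differentiable_imp_continuous_at)
    ultimately obtain d where d: "d > 0" "\<And>z. z \<in> ball a d \<Longrightarrow> g1 z \<noteq> 0"
      using continuous_at_avoid[of a g1 0] by auto
    have "(\<lambda>z. f1 z / g1 z) holomorphic_on ball a d"
      using d f1 g1 by (intro holomorphic_intros) (auto intro: holomorphic_on_subset)
    hence "?h holomorphic_on ball a d"
    proof (rule holomorphic_transform)
      fix z assume z: "z \<in> ball a d"
      show "f1 z / g1 z = ?h z"
        using d(2)[OF z] True zero[OF True] by (auto simp: f1_def g1_def)
    qed
    thus ?thesis using d by (auto intro: holomorphic_on_imp_differentiable_at)
  qed
  thus ?thesis by (auto simp: holomorphic_on_def field_differentiable_at_within)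
qed

section \<open>Poisson summation for the Gaussian\<close>

text \<open>The periodized Gaussian, taken as an entire function of a complex variable so that its
  Fourier coefficients can be found by moving the path of integration.\<close>

definition gaussian_sum :: "real \<Rightarrow> complex \<Rightarrow> complex" where
  "gaussian_sum t z = (\<Sum>\<^sub>\<infinity>n::int. exp (- (of_real pi * (z + of_int n)^2 / of_real t)))"

lemma norm_gauss_term_le:
  fixes z :: complex
  assumes t: "t > 0" and z: "norm z \<le> K"
  shows "norm (exp (- (of_real pi * (z + of_int n)^2 / of_real t)))
    \<le> exp (pi * K^2 / t) * exp (- (pi / t) * real_of_int (n^2) + (2 * pi * K / t) * real_of_int \<bar>n\<bar>)"
proof -
  have re: "Re ((z + of_int n)^2) = real_of_int (n^2) + 2 * (Re z * of_int n) + Re z ^ 2 - Im z ^ 2"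
    by (simp add: power2_eq_square algebra_simps)
  have "\<bar>Re z * of_int n\<bar> \<le> K * real_of_int \<bar>n\<bar>"
    using abs_Re_le_cmod[of z] z by (simp add: abs_mult mult_right_mono)
  hence 1: "- (2 * (Re z * of_int n)) \<le> 2 * (K * real_of_int \<bar>n\<bar>)" by linarith
  have "\<bar>Im z\<bar> \<le> K" using abs_Im_le_cmod[of z] z by linarith
  hence 2: "Im z ^ 2 \<le> K ^ 2" by (rule abs_le_square_iff[THEN iffD1, OF order.trans]) (use z norm_ge_zero[of z] in linarith)
  have "- Re ((z + of_int n)^2) \<le> K^2 - real_of_int (n^2) + 2 * (K * real_of_int \<bar>n\<bar>)"
    unfolding re using 1 2 by (smt (verit) zero_le_power2)
  hence "(pi / t) * (- Re ((z + of_int n)^2)) \<le> (pi / t) * (K^2 - real_of_int (n^2) + 2 * (K * real_of_int \<bar>n\<bar>))"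
    using t by (intro mult_left_mono) auto
  hence "- (pi * Re ((z + of_int n)^2) / t) \<le> pi * K^2 / t + (- (pi / t) * real_of_int (n^2) + (2 * pi * K / t) * real_of_int \<bar>n\<bar>)"
    by (simp add: algebra_simps)
  moreover have "Re (- (of_real pi * (z + of_int n)^2 / of_real t)) = - (pi * Re ((z + of_int n)^2) / t)"
    by (simp add: Re_divide_of_real)
  ultimately show ?thesis by (simp add: exp_add[symmetric])
qed

lemma summable_gauss_bound:
  assumes "t > 0"
  shows "(\<lambda>n::int. exp (pi * K^2 / t) * exp (- (pi / t) * real_of_int (n^2) + (2 * pi * K / t) * real_of_int \<bar>n\<bar>)) summable_on UNIV"
  by (intro summable_on_cmult_right summable_on_int_gauss) (use assms in auto)

lemma gaussian_sum_holomorphic: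
  assumes "t > 0"
  shows "gaussian_sum t holomorphic_on UNIV"
  unfolding gaussian_sum_def
proof (rule holomorphic_on_infsum)
  fix x :: complex
  let ?K = "norm x + 1"
  define M where "M = (\<lambda>n::int. exp (pi * ?K^2 / t) * exp (- (pi / t) * real_of_int (n^2) + (2 * pi * ?K / t) * real_of_int \<bar>n\<bar>))"
  have "norm y \<le> ?K" if "y \<in> cball x 1" for y
    using that norm_triangle_ineq2[of y x] by (auto simp: dist_norm norm_minus_commute)
  hence "\<forall>n. \<forall>y\<in>cball x 1. norm (exp (- (of_real pi * (y + of_int n)^2 / of_real t))) \<le> M n"
    unfolding M_def using norm_gauss_term_le[OF assms] by simp
  moreover have "M summable_on UNIV" unfolding M_def by (rule summable_gauss_bound[OF assms])
  ultimately show "\<exists>d>0. cball x d \<subseteq> UNIV \<and> (\<exists>M. M summable_on UNIV \<and> (\<forall>n. \<forall>y\<in>cball x d. norm (exp (- (of_real pi * (y + of_int n)^2 / of_real t))) \<le> M n))"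
    by (intro exI[of _ 1] conjI exI[of _ M]) auto
qed (auto intro!: holomorphic_intros simp: assms)

lemma gaussian_sum_periodic: "gaussian_sum t (z + 1) = gaussian_sum t z"
proof -
  have "gaussian_sum t (z + 1) = (\<Sum>\<^sub>\<infinity>n::int. exp (- (of_real pi * (z + of_int (n + 1))^2 / of_real t)))"
    unfolding gaussian_sum_def by (simp add: add_ac)
  also have "\<dots> = gaussian_sum t z" unfolding gaussian_sum_def
    by (rule infsum_reindex_bij_betw[of "\<lambda>n. n + 1" UNIV UNIV "\<lambda>n. exp (- (of_real pi * (z + of_int n)^2 / of_real t))"])
       (auto simp: bij_betw_def inj_on_def intro!: image_eqI[of _ _ "_ - 1"])
  finally show ?thesis .
qed

text \<open>Adding \<open>\<i> * t\<close> to the argument changes each exponent by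
  \<open>pi * t\<close> minus 2 pi i (z + n), and the integer \<open>n\<close> drops out of the
  exponential.\<close>

lemma gaussian_sum_quasi_periodic:
  assumes t: "t > 0"
  shows "gaussian_sum t (z + \<i> * of_real t) = of_real (exp (pi * t)) * ee (- z) * gaussian_sum t z"
proof -
  have "exp (- (of_real pi * (z + \<i> * of_real t + of_int n)^2 / of_real t))
      = of_real (exp (pi * t)) * ee (- z) * exp (- (of_real pi * (z + of_int n)^2 / of_real t))" for n
  proof -
    have "- (of_real pi * (z + \<i> * of_real t + of_int n)^2 / of_real t)
       = of_real (pi * t) + 2 * of_real pi * \<i> * (- z) + 2 * of_real pi * \<i> * (of_int (- n)) + - (of_real pi * (z + of_int n)^2 / of_real t)"
      using t by (simp add: field_simps power2_eq_square)
    also have "exp \<dots> = of_real (exp (pi * t)) * ee (- z) * ee (of_int (- n)) * exp (- (of_real pi * (z + of_int n)^2 / of_real t))"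
      by (simp only: exp_add ee_def exp_of_real)
    finally show ?thesis by (simp only: ee_of_int mult_1_right)
  qed
  thus ?thesis unfolding gaussian_sum_def by (simp add: infsum_cmult_right')
qed

text \<open>Unfolding: the integral of the sum of translates over one period is the integral of a
  single Gaussian over the line, read off from the normal density of variance
  \<open>t / (2 * pi)\<close>.\<close>

lemma gaussian_sum_real_integral:
  assumes t: "t > 0"
  shows "unit_integral (gaussian_sum t) 0 = of_real (sqrt t)"
proof -
  define g :: "real \<Rightarrow> real" where "g = (\<lambda>x. exp (- (pi * x^2 / t)))"
  define \<sigma> where "\<sigma> = sqrt (t / (2 * pi))"
  have \<sigma>: "\<sigma> > 0" "\<sigma>^2 = t / (2 * pi)" using t by (simp_all add: \<sigma>_def)
  have g_eq: "g = (\<lambda>x. sqrt t * normal_density 0 \<sigma> x)"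
    using t by (auto simp: g_def normal_density_def \<sigma> fun_eq_iff real_sqrt_mult field_simps)
  have g_int: "integrable lborel g" and g_val: "integral\<^sup>L lborel g = sqrt t"
    unfolding g_eq using \<sigma> by auto
  have g_cont: "continuous_on A g" for A unfolding g_def using t by (intro continuous_intros) auto
  define I where "I = (\<lambda>N::nat. integral {- real N..real N + 1} g)"
  have I_lim: "I \<longlonglongrightarrow> sqrt t"
  proof -
    have "(\<lambda>N. integral\<^sup>L lborel (\<lambda>x. indicator {- real N..real N + 1} x *\<^sub>R g x)) \<longlonglongrightarrow> integral\<^sup>L lborel g"
    proof (rule integral_dominated_convergence[where w = g])
      show "AE x in lborel. (\<lambda>N. indicator {- real N..real N + 1} x *\<^sub>R g x) \<longlonglongrightarrow> g x"
      proof (intro AE_I2 tendsto_eventually)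
        fix x :: real
        show "\<forall>\<^sub>F N in sequentially. indicator {- real N..real N + 1} x *\<^sub>R g x = g x"
          using eventually_ge_at_top[of "nat \<lceil>\<bar>x\<bar>\<rceil>"]
        proof eventually_elim
          case (elim N)
          hence "\<bar>x\<bar> \<le> real N" by linarith
          thus ?case by (auto simp: indicator_def)
        qed
      qed
    qed (use g_int in \<open>auto simp: g_def indicator_def\<close>)
    moreover have "integral\<^sup>L lborel (\<lambda>x. indicator {- real N..real N + 1} x *\<^sub>R g x) = I N" for N
    proof -
      have "set_integrable lborel {- real N..real N + 1} g"
        unfolding set_integrable_def by (intro borel_integrable_atLeastAtMost' [unfolded set_integrable_def] g_cont)
      from set_borel_integral_eq_integral(2)[OF this] show ?thesis
        unfolding set_lebesgue_integral_def I_def by simp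
    qed
    ultimately show ?thesis by (simp add: g_val)
  qed
  define h where "h = (\<lambda>(n::int) (x::real). exp (- (of_real pi * (of_real x + of_int n)^2 / of_real t)) :: complex)"
  have h_g: "h n x = of_real (g (x + of_int n))" for n x
    unfolding h_def g_def by (simp flip: exp_of_real)
  have ul: "uniform_limit {0..1} (\<lambda>X x. \<Sum>n\<in>X. h n x) (\<lambda>x. \<Sum>\<^sub>\<infinity>n. h n x) (finite_subsets_at_top UNIV)"
  proof (rule Weierstrass_m_test_general[OF _ summable_gauss_bound[OF t, of 1]])
    fix n :: int and x :: real assume "x \<in> {0..1}"
    thus "norm (h n x) \<le> exp (pi * 1^2 / t) * exp (- (pi / t) * real_of_int (n^2) + (2 * pi * 1 / t) * real_of_int \<bar>n\<bar>)"
      unfolding h_def by (intro norm_gauss_term_le[OF t]) auto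
  qed
  have ul2: "uniform_limit {0..1} (\<lambda>N x. \<Sum>n\<in>{- int N..int N}. h n x) (\<lambda>x. gaussian_sum t (of_real x)) sequentially"
    using filterlim_compose[OF ul filterlim_int_interval] unfolding gaussian_sum_def h_def by simp
  have h_cont: "continuous_on {0..1} (h n)" for n
    unfolding h_def using t by (intro continuous_intros) auto
  obtain J K where JK: "\<And>N. ((\<lambda>x. \<Sum>n\<in>{- int N..int N}. h n x) has_integral J N) {0..1}"
      "((\<lambda>x. gaussian_sum t (of_real x)) has_integral K) {0..1}" "J \<longlonglongrightarrow> K"
    by (rule uniform_limit_integral[OF ul2]) (auto intro!: continuous_intros h_cont)
  have hI: "((\<lambda>x. h n x) has_integral of_real (integral {of_int n..of_int n + 1} g)) {0..1}" for n
  proof -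
    have "((\<lambda>x. g (x + of_int n)) has_integral integral {0..1} (\<lambda>x. g (x + of_int n))) {0..1}"
      by (intro integrable_integral integrable_continuous_real continuous_on_compose2[OF g_cont[of UNIV]] continuous_intros) auto
    moreover have "integral {0..1} (\<lambda>x. g (x + of_int n)) = integral {of_int n..of_int n + 1} g"
      using integral_shift[of 0 "of_int n" 1 g] g_cont by (simp add: o_def add_ac)
    ultimately have "((\<lambda>x. g (x + of_int n)) has_integral integral {of_int n..of_int n + 1} g) {0..1}" by simp
    from has_integral_linear[OF this bounded_linear_of_real[where ?'a = complex]]
    show ?thesis by (simp add: o_def h_g)
  qed
  have J: "J N = of_real (I N)" for N
  proof -
    have "J N = (\<Sum>n\<in>{- int N..int N}. of_real (integral {of_int n..of_int n + 1} g))"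
      by (rule has_integral_unique[OF JK(1)], rule has_integral_sum) (auto intro: hI)
    also have "\<dots> = of_real (\<Sum>n\<in>{- int N..int N}. integral {of_int n..of_int n + 1} g)" by simp
    also have "(\<Sum>n\<in>{- int N..int N}. integral {of_int n..of_int n + 1} g) = I N"
    proof -
      have int: "g integrable_on {a..b}" for a b
        by (intro integrable_continuous_real g_cont)
      have "(\<Sum>n\<in>{- int N..- int N + int M}. integral {of_int n..of_int n + 1} g) = integral {- real N..- real N + real M + 1} g" for M
      proof (induction M)
        case (Suc M)
        have "{- int N..- int N + int (Suc M)} = insert (- int N + int (Suc M)) {- int N..- int N + int M}" by auto
        hence "(\<Sum>n\<in>{- int N..- int N + int (Suc M)}. integral {of_int n..of_int n + 1} g)
           = integral {- real N + real M + 1..- real N + real M + 1 + 1} g + integral {- real N..- real N + real M + 1} g"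
          using Suc.IH by (simp add: add_ac)
        also have "\<dots> = integral {- real N..- real N + real M + 1 + 1} g"
          using Henstock_Kurzweil_Integration.integral_combine[of "- real N" "- real N + real M + 1" "- real N + real M + 1 + 1" g] int
          by (simp add: add.commute)
        finally show ?case by (simp add: add_ac)
      qed simp
      from this[of "2 * N"] show ?thesis by (simp add: I_def)
    qed
    finally show ?thesis .
  qed
  have "J \<longlonglongrightarrow> of_real (sqrt t)" unfolding J using I_lim by (rule tendsto_of_real)
  with JK(3) have "K = of_real (sqrt t)" by (rule LIMSEQ_unique)
  with JK(2) show ?thesis unfolding unit_integral_def by (simp add: integral_unique)
qed

definition gaussian_sum_coeff :: "real \<Rightarrow> int \<Rightarrow> complex" where
  "gaussian_sum_coeff t m = unit_integral (\<lambda>z. gaussian_sum t z * ee (- (of_int m * z))) 0"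

text \<open>Moving the path up by \<open>\<i> * t\<close> preserves the coefficient, while
  quasi-periodicity turns the integrand for \<open>m\<close> into a multiple of the one for
  \<open>m + 1\<close>. All coefficients thus follow from the one at 0.\<close>

lemma gaussian_sum_coeff_step:
  assumes t: "t > 0"
  shows "gaussian_sum_coeff t (m + 1) = of_real (exp (- (pi * t * (2 * of_int m + 1)))) * gaussian_sum_coeff t m"
proof -
  let ?f = "\<lambda>z. gaussian_sum t z * ee (- (of_int m * z))"
  have "ee (- (of_int m * (z + 1))) = ee (- (of_int m * z))" for z
    using ee_add_int[of "- (of_int m * z)" "- m"] by (simp add: algebra_simps)
  hence per: "?f (z + 1) = ?f z" for z by (simp add: gaussian_sum_periodic)
  have hol: "?f holomorphic_on UNIV" by (intro holomorphic_intros gaussian_sum_holomorphic t)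
  have "gaussian_sum_coeff t m = unit_integral ?f (\<i> * of_real t)"
    unfolding gaussian_sum_coeff_def by (rule unit_integral_shift[OF hol per, symmetric])
  also have "\<dots> = unit_integral (\<lambda>z. of_real (exp (pi * t * (2 * of_int m + 1))) * (gaussian_sum t z * ee (- (of_int (m + 1) * z)))) 0"
  proof -
    have "?f (\<i> * of_real t + of_real x) = of_real (exp (pi * t * (2 * of_int m + 1))) * (gaussian_sum t (of_real x) * ee (- (of_int (m + 1) * of_real x)))" for x
    proof -
      have "ee (- (of_int m * (\<i> * of_real t + of_real x))) = of_real (exp (2 * pi * t * of_int m)) * ee (- (of_int m * of_real x))"
        by (simp add: ee_def exp_of_real[symmetric] exp_add[symmetric] algebra_simps)
      moreover have "gaussian_sum t (\<i> * of_real t + of_real x) = of_real (exp (pi * t)) * ee (- of_real x) * gaussian_sum t (of_real x)"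
        using gaussian_sum_quasi_periodic[OF t, of "of_real x"] by (simp add: add_ac)
      moreover have "ee (- (of_int (m + 1) * of_real x)) = ee (- (of_int m * of_real x)) * ee (- of_real x)"
        by (simp add: ee_add[symmetric] algebra_simps)
      moreover have "exp (pi * t * (2 * of_int m + 1)) = exp (2 * pi * t * of_int m) * exp (pi * t)"
        by (simp add: exp_add[symmetric] algebra_simps)
      ultimately show ?thesis by simp
    qed
    thus ?thesis unfolding unit_integral_def by simp
  qed
  also have "\<dots> = of_real (exp (pi * t * (2 * of_int m + 1))) * gaussian_sum_coeff t (m + 1)"
    unfolding unit_integral_cmult gaussian_sum_coeff_def ..
  finally show ?thesis
    by (simp add: mult.assoc[symmetric] exp_minus flip: of_real_mult)
qed

lemma gaussian_sum_coeff_eq: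
  assumes t: "t > 0"
  shows "gaussian_sum_coeff t m = of_real (exp (- (pi * t * of_int (m^2)))) * of_real (sqrt t)"
proof (induction m rule: int_induct[of _ 0])
  case base
  show ?case using gaussian_sum_real_integral[OF t] by (simp add: gaussian_sum_coeff_def)
next
  case (step1 i)
  thus ?case using gaussian_sum_coeff_step[OF t, of i]
    by (simp add: exp_add[symmetric] power2_eq_square algebra_simps flip: of_real_mult)
next
  case (step2 i)
  have "of_real (exp (- (pi * t * (2 * of_int (i - 1) + 1)))) * gaussian_sum_coeff t (i - 1) = of_real (exp (- (pi * t * of_int (i^2)))) * of_real (sqrt t)"
    using gaussian_sum_coeff_step[OF t, of "i - 1"] step2 by simp
  hence "of_real (exp (pi * t * (2 * of_int (i - 1) + 1))) * (of_real (exp (- (pi * t * (2 * of_int (i - 1) + 1)))) * gaussian_sum_coeff t (i - 1))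
    = of_real (exp (pi * t * (2 * of_int (i - 1) + 1))) * (of_real (exp (- (pi * t * of_int (i^2)))) * of_real (sqrt t))" by simp
  also have "of_real (exp (pi * t * (2 * of_int (i - 1) + 1))) * (of_real (exp (- (pi * t * (2 * of_int (i - 1) + 1)))) * gaussian_sum_coeff t (i - 1)) = gaussian_sum_coeff t (i - 1)"
    by (simp add: mult.assoc[symmetric] exp_minus flip: of_real_mult del: of_int_diff of_int_mult)
  finally have "gaussian_sum_coeff t (i - 1) = of_real (exp (pi * t * (2 * of_int (i - 1) + 1)) * exp (- (pi * t * of_int (i^2)))) * of_real (sqrt t)"
    by (simp only: of_real_mult mult.assoc)
  also have "exp (pi * t * (2 * of_int (i - 1) + 1)) * exp (- (pi * t * of_int (i^2))) = exp (- (pi * t * of_int ((i - 1)^2)))"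
    by (simp add: exp_add[symmetric] power2_eq_square algebra_simps)
  finally show ?case .
qed

text \<open>With $H(z) = (g(z) - g(w))/(e(z-w) - 1)$, which is entire and periodic, the partial Fourier sums
  of $g$ at $w$ telescope to $g(w)$ plus two Fourier coefficients of $H$, and these tend to $0$.\<close>

lemma gaussian_sum_pointwise:
  assumes t: "t > 0"
  shows "(\<lambda>N. \<Sum>m\<in>{- int N..int N}. ee (of_int m * w) * gaussian_sum_coeff t m) \<longlonglongrightarrow> gaussian_sum t w"
proof -
  let ?g = "\<lambda>z. ee (z - w) - 1"
  let ?f = "\<lambda>z. gaussian_sum t z - gaussian_sum t w"
  define H where "H = (\<lambda>z. if ?g z = 0 then deriv ?f z / deriv ?g z else ?f z / ?g z)"
  have dg: "deriv ?g z = 2 * of_real pi * \<i> * ee (z - w)" for z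
    by (rule DERIV_imp_deriv) (auto intro!: derivative_eq_intros)
  have gper: "gaussian_sum t (z + of_int n) = gaussian_sum t z" for z n
  proof (induction n rule: int_induct[of _ 0])
    case (step1 i) thus ?case using gaussian_sum_periodic[of t "z + of_int i"] by (simp add: add_ac)
  next
    case (step2 i) thus ?case using gaussian_sum_periodic[of t "z + of_int (i - 1)"] by (simp add: add_ac)
  qed simp
  have zero: "?f z = 0" if "?g z = 0" for z
  proof -
    from that obtain n where "z - w = of_int n" using ee_eq_1_iff by auto
    hence "z = w + of_int n" by (simp add: algebra_simps)
    thus ?thesis using gper by simp
  qed
  have fhol: "?f holomorphic_on UNIV" by (intro holomorphic_intros gaussian_sum_holomorphic t)
  have Hhol: "H holomorphic_on UNIV"
    unfolding H_def
  proof (rule entire_divide_simple_zeros[OF fhol])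
    show "?g holomorphic_on UNIV" by (intro holomorphic_intros)
    show "?f z = 0" if "?g z = 0" for z using that by (rule zero)
    show "deriv ?g z \<noteq> 0" if "?g z = 0" for z unfolding dg by simp
  qed
  have Heq: "gaussian_sum t z = gaussian_sum t w + (H z * ee (z - w) - H z)" for z
    using zero[of z] by (auto simp: H_def field_simps)
  have Hper: "H (z + 1) = H z" for z
  proof -
    have e: "ee (z + 1 - w) = ee (z - w)"
      using ee_add_int[of "z - w" 1] by (simp add: algebra_simps)
    have df: "deriv ?f z = deriv (gaussian_sum t) z" for z
      using gaussian_sum_holomorphic[OF t] by (subst deriv_diff) (auto intro: holomorphic_on_imp_differentiable_at)
    have "gaussian_sum t field_differentiable at (z + 1)"
      using gaussian_sum_holomorphic[OF t] by (auto intro: holomorphic_on_imp_differentiable_at)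
    hence "(gaussian_sum t has_field_derivative deriv (gaussian_sum t) (z + 1)) (at (z + 1))"
      by (simp add: DERIV_deriv_iff_field_differentiable)
    hence "((\<lambda>z. gaussian_sum t (z + 1)) has_field_derivative deriv (gaussian_sum t) (z + 1)) (at z)"
      by (simp add: DERIV_shift)
    hence "deriv (gaussian_sum t) z = deriv (gaussian_sum t) (z + 1)" by (intro DERIV_imp_deriv) (simp add: gaussian_sum_periodic)
    thus ?thesis by (simp add: H_def dg e df gaussian_sum_periodic)
  qed
  define b where "b = (\<lambda>m::int. unit_integral (\<lambda>z. H z * ee (- (of_int m * (z - w)))) 0)"
  \<comment> \<open>Multiplying \<open>H\<close> by \<open>ee (z - w) - 1\<close> gives the Gaussian
    sum minus its value at \<open>w\<close>. The first factor shifts Fourier coefficients by one,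
    and the constant is seen only at \<open>m = 0\<close>.\<close>
  have rec: "ee (of_int m * w) * gaussian_sum_coeff t m = (if m = 0 then gaussian_sum t w else 0) + (b (m - 1) - b m)" for m
  proof -
    have "ee (of_int m * w) * gaussian_sum_coeff t m = unit_integral (\<lambda>z. ee (of_int m * w) * (gaussian_sum t z * ee (- (of_int m * z)))) 0"
      unfolding unit_integral_cmult gaussian_sum_coeff_def ..
    also have "(\<lambda>z. ee (of_int m * w) * (gaussian_sum t z * ee (- (of_int m * z))))
       = (\<lambda>z. gaussian_sum t w * ee (of_int (- m) * (z - w)) + (H z * ee (- (of_int (m - 1) * (z - w))) - H z * ee (- (of_int m * (z - w)))))"
    proof
      fix z
      have 1: "ee (of_int m * w) * ee (- (of_int m * z)) = ee (- (of_int m * (z - w)))"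
        by (simp add: ee_add[symmetric] algebra_simps)
      have 2: "ee (- (of_int (m - 1) * (z - w))) = ee (z - w) * ee (- (of_int m * (z - w)))"
        by (simp add: ee_add[symmetric] algebra_simps)
      have "ee (of_int m * w) * (gaussian_sum t z * ee (- (of_int m * z))) = gaussian_sum t z * ee (- (of_int m * (z - w)))"
        using 1 by (simp add: mult_ac)
      also have "\<dots> = gaussian_sum t w * ee (- (of_int m * (z - w))) + (H z * ee (z - w) * ee (- (of_int m * (z - w))) - H z * ee (- (of_int m * (z - w))))"
        by (subst Heq) (simp add: algebra_simps)
      finally show "ee (of_int m * w) * (gaussian_sum t z * ee (- (of_int m * z)))
       = gaussian_sum t w * ee (of_int (- m) * (z - w)) + (H z * ee (- (of_int (m - 1) * (z - w))) - H z * ee (- (of_int m * (z - w))))"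
        unfolding 2 by simp
    qed
    also have "unit_integral \<dots> 0 = unit_integral (\<lambda>z. gaussian_sum t w * ee (of_int (- m) * (z - w))) 0 + (b (m - 1) - b m)"
      unfolding b_def
      by (subst unit_integral_add unit_integral_diff; (intro holomorphic_intros Hhol)?)+ (rule refl)
    also have "unit_integral (\<lambda>z. gaussian_sum t w * ee (of_int (- m) * (z - w))) 0 = (if m = 0 then gaussian_sum t w else 0)"
    proof (cases "m = 0")
      case True thus ?thesis by (simp add: unit_integral_def)
    next
      case False thus ?thesis unfolding unit_integral_cmult using unit_integral_ee[of "-m" w] by simp
    qed
    finally show ?thesis .
  qed
  have bshift: "b m = unit_integral (\<lambda>z. H z * ee (- (of_int m * (z - w)))) v" for m v
  proof -
    have "ee (- (of_int m * (z + 1 - w))) = ee (- (of_int m * (z - w)))" for z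
      using ee_add_int[of "- (of_int m * (z - w))" "- m"] by (simp add: algebra_simps)
    thus ?thesis unfolding b_def
      by (intro unit_integral_shift[symmetric] holomorphic_intros Hhol) (simp add: Hper)
  qed
  \<comment> \<open>Computing \<open>b m\<close> at height \<open>y\<close> produces the factor
    \<open>exp (2 * pi * y * m)\<close>. The choice \<open>y = - 1\<close> gives decay for large
    positive \<open>m\<close>, and \<open>y = 1\<close> for large negative \<open>m\<close>.\<close>
  have bbound: "\<exists>C. \<forall>m. norm (b m) \<le> C * exp (2 * pi * y * of_int m)" for y :: real
  proof -
    have "compact ((\<lambda>x. H (w + \<i> * of_real y + of_real x)) ` {0..1})"
      by (intro compact_continuous_image continuous_on_unit_shift Hhol) auto
    then obtain C where C: "\<And>x. x \<in> {0..1} \<Longrightarrow> norm (H (w + \<i> * of_real y + of_real x)) \<le> C"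
      using compact_imp_bounded bounded_iff by (metis imageI)
    have "norm (b m) \<le> C * exp (2 * pi * y * of_int m)" for m
      unfolding bshift[of m "w + \<i> * of_real y"]
    proof (rule norm_unit_integral_le)
      fix x :: real assume x: "x \<in> {0..1}"
      show "norm (H (w + \<i> * of_real y + of_real x) * ee (- (of_int m * (w + \<i> * of_real y + of_real x - w)))) \<le> C * exp (2 * pi * y * of_int m)"
        unfolding norm_mult norm_ee using C[OF x] by (simp add: mult_ac mult_right_mono)
    qed (intro holomorphic_intros Hhol)
    thus ?thesis by blast
  qed
  have lim0: "(\<lambda>N::nat. C * exp (- (2 * pi * real N))) \<longlonglongrightarrow> 0" for C :: real
    by real_asymp
  have b1: "(\<lambda>N. b (int N)) \<longlonglongrightarrow> 0"
  proof -
    obtain C where "\<And>m. norm (b m) \<le> C * exp (2 * pi * (-1) * of_int m)" using bbound[of "-1"] by blast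
    hence "norm (b (int N)) \<le> C * exp (- (2 * pi * real N))" for N by (metis mult_minus1_right mult_minus_left of_int_of_nat_eq)
    thus ?thesis by (intro tendsto_norm_zero_cancel[OF tendsto_sandwich[OF _ _ tendsto_const lim0[of C]]]) auto
  qed
  have b2: "(\<lambda>N. b (- int N - 1)) \<longlonglongrightarrow> 0"
  proof -
    obtain C where C: "\<And>m. norm (b m) \<le> C * exp (2 * pi * 1 * of_int m)" using bbound[of 1] by blast
    have "norm (b (- int N - 1)) \<le> (C * exp (- (2 * pi))) * exp (- (2 * pi * real N))" for N
      using C[of "- int N - 1"] by (simp add: algebra_simps exp_add[symmetric] exp_diff)  (simp add: exp_minus field_simps)
    thus ?thesis by (intro tendsto_norm_zero_cancel[OF tendsto_sandwich[OF _ _ tendsto_const lim0[of "C * exp (- (2 * pi))"]]]) auto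
  qed
  have tele: "(\<Sum>m\<in>{- int N..int N}. ee (of_int m * w) * gaussian_sum_coeff t m) = gaussian_sum t w + (b (- int N - 1) - b (int N))" for N
  proof -
    have "(\<Sum>m\<in>{- int N..int N}. b (m - 1) - b m) = b (- int N - 1) - b (int N)"
    proof -
      have "(\<Sum>m\<in>{- int N..- int N + int M}. b (m - 1) - b m) = b (- int N - 1) - b (- int N + int M)" for M
      proof (induction M)
        case (Suc M)
        have "{- int N..- int N + int (Suc M)} = insert (- int N + int (Suc M)) {- int N..- int N + int M}" by auto
        thus ?case using Suc.IH by (simp add: algebra_simps)
      qed simp
      from this[of "2 * N"] show ?thesis by simp
    qed
    moreover have "(\<Sum>m\<in>{- int N..int N}. if m = 0 then gaussian_sum t w else 0) = gaussian_sum t w" by simp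
    ultimately show ?thesis unfolding rec sum.distrib by simp
  qed
  show ?thesis unfolding tele using tendsto_add[OF tendsto_const tendsto_diff[OF b2 b1]] by simp
qed

theorem gaussian_sum_poisson:
  assumes t: "t > 0"
  shows "gaussian_sum t w = of_real (sqrt t) * (\<Sum>\<^sub>\<infinity>m::int. of_real (exp (- (pi * t * of_int (m^2)))) * ee (of_int m * w))"
proof -
  let ?T = "\<lambda>m::int. of_real (exp (- (pi * t * of_int (m^2)))) * ee (of_int m * w)"
  have "(\<lambda>m. norm (?T m)) summable_on UNIV"
  proof (rule Infinite_Sum.abs_summable_on_comparison_test'[OF summable_on_int_gauss[of "pi * t" "2 * pi * \<bar>Im w\<bar>"]])
    fix m :: int
    have "- (of_int m * Im w) \<le> \<bar>Im w\<bar> * real_of_int \<bar>m\<bar>"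
      by (metis abs_ge_minus_self abs_mult mult.commute of_int_abs)
    hence "2 * pi * (- (of_int m * Im w)) \<le> 2 * pi * (\<bar>Im w\<bar> * real_of_int \<bar>m\<bar>)" by (intro mult_left_mono) auto
    thus "norm (?T m) \<le> exp (- (pi * t) * real_of_int (m^2) + 2 * pi * \<bar>Im w\<bar> * real_of_int \<bar>m\<bar>)"
      by (simp add: norm_mult norm_ee exp_add[symmetric])
  qed (use t in auto)
  hence "?T summable_on UNIV" by (rule abs_summable_summable)
  hence "(sum ?T \<longlongrightarrow> infsum ?T UNIV) (finite_subsets_at_top UNIV)"
    using has_sum_infsum has_sum_def by blast
  from filterlim_compose[OF this filterlim_int_interval]
  have "(\<lambda>N. of_real (sqrt t) * sum ?T {- int N..int N}) \<longlonglongrightarrow> of_real (sqrt t) * infsum ?T UNIV"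
    by (intro tendsto_intros)
  moreover have "(\<lambda>N. of_real (sqrt t) * sum ?T {- int N..int N}) \<longlonglongrightarrow> gaussian_sum t w"
    using gaussian_sum_pointwise[OF t, of w] unfolding gaussian_sum_coeff_eq[OF t] sum_distrib_left by (simp add: mult_ac)
  ultimately show ?thesis using LIMSEQ_unique by blast
qed

section \<open>Theta functions attached to periodic functions\<close>

definition upper :: "complex set" where "upper = {z. Im z > 0}"

lemma open_upper: "open upper" unfolding upper_def by (rule open_halfspace_Im_gt)
lemma convex_upper: "convex upper" unfolding upper_def by (rule convex_halfspace_Im_gt)
lemma connected_upper: "connected upper" by (intro convex_connected convex_upper)

lemma Im_minus_inverse: "Im (- 1 / z) = Im z / (norm z)^2"
  by (simp add: Im_divide cmod_power2)

lemma upper_S: "z \<in> upper \<Longrightarrow> - 1 / z \<in> upper"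
  unfolding upper_def mem_Collect_eq Im_minus_inverse by (intro divide_pos_pos zero_less_power) auto

lemma upper_nonzero: "z \<in> upper \<Longrightarrow> z \<noteq> 0" by (auto simp: upper_def)

lemma periodic_int_mult:
  fixes f :: "int \<Rightarrow> 'a"
  assumes "\<And>n. f (n + N) = f n"
  shows "f (n + N * k) = f n"
proof (induction k rule: int_induct[of _ 0])
  case (step1 i) thus ?case using assms[of "n + N * i"] by (simp add: algebra_simps)
next
  case (step2 i) thus ?case using assms[of "n + N * (i - 1)"] by (simp add: algebra_simps)
qed simp

lemma periodic_int_mod:
  fixes f :: "int \<Rightarrow> 'a"
  assumes "\<And>n. f (n + N) = f n"
  shows "f (n mod N) = f n"
  using periodic_int_mult[of f N "n mod N" "n div N", OF assms] by simp

lemma periodic_int_bounded: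
  fixes f :: "int \<Rightarrow> complex"
  assumes "N > 0" "\<And>n. f (n + N) = f n"
  shows "\<exists>C. \<forall>n. norm (f n) \<le> C"
proof (intro exI allI)
  fix n
  have "norm (f (n mod N)) \<le> (\<Sum>a\<in>{0..<N}. norm (f a))"
    using assms(1) by (intro member_le_sum) auto
  thus "norm (f n) \<le> (\<Sum>a\<in>{0..<N}. norm (f a))" by (simp add: periodic_int_mod[of f, OF assms(2)])
qed

definition theta_series :: "(int \<Rightarrow> complex) \<Rightarrow> complex \<Rightarrow> complex" where
  "theta_series a \<tau> = (\<Sum>\<^sub>\<infinity>n::int. a n * ee (of_int (n^2) * \<tau>))"

lemma norm_theta_series_term_le:
  assumes "\<And>n. norm (a n) \<le> C" "Im \<tau> \<ge> y"
  shows "norm (a n * ee (of_int (n^2) * \<tau>)) \<le> C * exp (- (2 * pi * y) * real_of_int (n^2) + 0 * real_of_int \<bar>n\<bar>)"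
proof -
  have "2 * pi * (real_of_int (n^2) * y) \<le> 2 * pi * (real_of_int (n^2) * Im \<tau>)"
    using assms(2) by (intro mult_left_mono) auto
  hence "exp (- (2 * pi * (real_of_int (n^2) * Im \<tau>))) \<le> exp (- (2 * pi * y) * real_of_int (n^2) + 0 * real_of_int \<bar>n\<bar>)"
    by (simp add: mult_ac)
  moreover have "C \<ge> 0" using assms(1)[of 0] norm_ge_zero order.trans by blast
  ultimately show ?thesis unfolding norm_mult norm_ee
    by (intro mult_mono assms) (auto simp flip: of_int_power)
qed

lemma theta_series_summable:
  assumes "\<And>n. norm (a n) \<le> C" "\<tau> \<in> upper"
  shows "(\<lambda>n. a n * ee (of_int (n^2) * \<tau>)) summable_on UNIV"
proof -
  have "(\<lambda>n. norm (a n * ee (of_int (n^2) * \<tau>))) summable_on UNIV"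
    by (rule Infinite_Sum.abs_summable_on_comparison_test'[OF _ norm_theta_series_term_le[OF assms(1) order.refl]],
        intro summable_on_cmult_right summable_on_int_gauss) (use assms(2) in \<open>auto simp: upper_def\<close>)
  thus ?thesis by (rule abs_summable_summable)
qed

lemma theta_series_holomorphic:
  assumes "\<And>n. norm (a n) \<le> C"
  shows "theta_series a holomorphic_on upper"
  unfolding theta_series_def
proof (rule holomorphic_on_infsum)
  fix x assume x: "x \<in> upper"
  define y where "y = Im x / 2"
  have y: "y > 0" using x by (simp add: y_def upper_def)
  have Im: "Im z \<ge> y" if "z \<in> cball x y" for z
  proof -
    have "\<bar>Im (x - z)\<bar> \<le> y" using that abs_Im_le_cmod[of "x - z"] by (simp add: dist_norm)
    thus ?thesis unfolding y_def minus_complex.sel by linarith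
  qed
  define M where "M = (\<lambda>n. C * exp (- (2 * pi * y) * real_of_int (n^2) + 0 * real_of_int \<bar>n\<bar>))"
  have "\<forall>n. \<forall>z\<in>cball x y. norm (a n * ee (of_int (n^2) * z)) \<le> M n"
    unfolding M_def using norm_theta_series_term_le[of a C y, OF assms Im] by blast
  moreover have "M summable_on UNIV" unfolding M_def
    by (intro summable_on_cmult_right summable_on_int_gauss) (use y in auto)
  moreover have "cball x y \<subseteq> upper" using Im y by (fastforce simp: upper_def)
  ultimately show "\<exists>d>0. cball x d \<subseteq> upper \<and> (\<exists>M. M summable_on UNIV \<and> (\<forall>n. \<forall>z\<in>cball x d. norm (a n * ee (of_int (n^2) * z)) \<le> M n))"
    using y by (intro exI[of _ y] conjI exI[of _ M]) auto
qed (auto intro!: holomorphic_intros open_upper)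

lemma infsum_sum_swap:
  fixes f :: "'a \<Rightarrow> 'b \<Rightarrow> complex"
  assumes "\<And>a. a \<in> A \<Longrightarrow> (\<lambda>m. f a m) summable_on UNIV"
  shows "(\<Sum>\<^sub>\<infinity>m. \<Sum>a\<in>A. f a m) = (\<Sum>a\<in>A. \<Sum>\<^sub>\<infinity>m. f a m)"
proof -
  have "((\<lambda>m. \<Sum>a\<in>A. f a m) has_sum (\<Sum>a\<in>A. \<Sum>\<^sub>\<infinity>m. f a m)) UNIV"
    using assms
  proof (induction A rule: infinite_finite_induct)
    case (insert a A)
    thus ?case by (simp add: has_sum_add)
  qed auto
  thus ?thesis by (rule infsumI)
qed

lemma infsum_int_residues:
  fixes f :: "int \<Rightarrow> complex"
  assumes "N > 0" "f summable_on UNIV"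
  shows "(\<Sum>\<^sub>\<infinity>m. f m) = (\<Sum>a\<in>{0..<N}. \<Sum>\<^sub>\<infinity>n. f (a + N * n))"
proof -
  let ?h = "\<lambda>(a,n). a + N * n"
  have bij: "bij_betw ?h ({0..<N} \<times> UNIV) UNIV"
    by (rule bij_betw_byWitness[where f' = "\<lambda>m. (m mod N, m div N)"]) (use assms(1) in auto)
  have s: "(\<lambda>(a,n). f (a + N * n)) summable_on ({0..<N} \<times> UNIV)"
    using summable_on_reindex_bij_betw[OF bij, of f] assms(2) by (simp add: case_prod_unfold)
  have "(\<Sum>\<^sub>\<infinity>m. f m) = (\<Sum>\<^sub>\<infinity>(a,n)\<in>{0..<N} \<times> UNIV. f (a + N * n))"
    using infsum_reindex_bij_betw[OF bij, of f] by (simp add: case_prod_unfold)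
  also have "\<dots> = (\<Sum>\<^sub>\<infinity>a\<in>{0..<N}. \<Sum>\<^sub>\<infinity>n. f (a + N * n))"
    using infsum_Sigma'_banach[OF s] by simp
  finally show ?thesis by simp
qed

text \<open>The even primitive quadratic character modulo 12. Its values are the coefficients in
  eta(z) = sum over n >= 1 of chi12(n) e(n^2 z / 24).\<close>

definition chi12 :: "int \<Rightarrow> complex" where
  "chi12 n = (if n mod 12 \<in> {1, 11} then 1 else if n mod 12 \<in> {5, 7} then - 1 else 0)"

lemma chi12_cong: "m mod 12 = n mod 12 \<Longrightarrow> chi12 m = chi12 n" by (simp add: chi12_def)

lemma norm_chi12: "norm (chi12 n) \<le> 1" by (simp add: chi12_def)

lemma mod_12_cases:
  fixes n :: int
  shows "n mod 12 \<in> {0,1,2,3,4,5,6,7,8,9,10,11}"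
proof -
  have "0 \<le> n mod 12" "n mod 12 < 12" by auto
  thus ?thesis by (simp only: insert_iff empty_iff) presburger
qed

lemma chi12_mult: "chi12 (m * n) = chi12 m * chi12 n"
proof -
  have "chi12 (m * n) = chi12 ((m mod 12) * (n mod 12))" by (intro chi12_cong) (simp add: mod_mult_eq)
  moreover have "chi12 (a * b) = chi12 a * chi12 b"
    if "a \<in> {0,1,2,3,4,5,6,7,8,9,10,11}" "b \<in> {0,1,2,3,4,5,6,7,8,9,10,11}" for a b
    using that unfolding insert_iff empty_iff by (elim disjE) (simp_all add: chi12_def)
  moreover have "chi12 (m mod 12) = chi12 m" "chi12 (n mod 12) = chi12 n" by (simp_all add: chi12_def)
  ultimately show ?thesis using mod_12_cases by metis
qed

text \<open>The units modulo 12 have squares congruent to 1 modulo 24. This gives all terms of the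
  theta series the same factor \<open>ee (1 / 24)\<close> under translation by 1.\<close>

lemma chi12_square_mod: "chi12 m \<noteq> 0 \<Longrightarrow> \<exists>j. m^2 = 1 + 24 * j"
proof -
  assume "chi12 m \<noteq> 0"
  hence "m mod 12 \<in> {1,5,7,11}" by (auto simp: chi12_def split: if_splits)
  moreover define q where "q = m div 12"
  ultimately have "m = 12 * q + 1 \<or> m = 12 * q + 5 \<or> m = 12 * q + 7 \<or> m = 12 * q + 11"
    by (auto simp: q_def) (metis mult_div_mod_eq)+
  thus ?thesis
  proof (elim disjE)
    assume "m = 12 * q + 1" thus ?thesis by (intro exI[of _ "6*q^2+q"]) (simp add: power2_eq_square algebra_simps)
  next
    assume "m = 12 * q + 5" thus ?thesis by (intro exI[of _ "6*q^2+5*q+1"]) (simp add: power2_eq_square algebra_simps)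
  next
    assume "m = 12 * q + 7" thus ?thesis by (intro exI[of _ "6*q^2+7*q+2"]) (simp add: power2_eq_square algebra_simps)
  next
    assume "m = 12 * q + 11" thus ?thesis by (intro exI[of _ "6*q^2+11*q+5"]) (simp add: power2_eq_square algebra_simps)
  qed
qed

text \<open>The character is its own finite Fourier transform up to \<open>sqrt 12\<close>, which is
  why the inversion S maps these theta series to series with the same character.\<close>

lemma chi12_gauss:
  "(\<Sum>a\<in>{0..<12::int}. chi12 a * ee (of_int (m * a) / 12)) = of_real (sqrt 12) * chi12 m"
proof -
  define w where "w = ee (1 / 12)"
  have "w = cis (pi / 6)" by (simp add: w_def ee_def cis_conv_exp field_simps)
  hence w: "w = Complex (sqrt 3 / 2) (1 / 2)" by (simp add: complex_eq_iff cos_30 sin_30)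
  have w2: "w^2 = Complex (1/2) (sqrt 3 / 2)" by (simp add: w power2_eq_square complex_eq_iff)
  have w3: "w^3 = \<i>" by (simp add: power3_eq_cube w complex_eq_iff)
  \<comment> \<open>Only twelve values of \<open>m\<close> have to be checked, and
    \<open>w^3 = \<i>\<close> reduces every power of the twelfth root of unity to an exponent below
    3.\<close>
  have pw: "w ^ n = \<i> * w ^ (n - 3)" if "n \<ge> 3" for n
    using that power_add[of w 3 "n - 3"] w3 by simp
  define F where "F = (\<lambda>m. \<Sum>a\<in>{0..<12::int}. chi12 a * ee (of_int (m * a) / 12))"
  have per: "F (n + 12) = F n" for n
    unfolding F_def
  proof (intro sum.cong refl)
    fix a :: int
    have "of_int ((n + 12) * a) / 12 = of_int (n * a) / 12 + (of_int a :: complex)" by (simp add: field_simps)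
    thus "chi12 a * ee (of_int ((n + 12) * a) / 12) = chi12 a * ee (of_int (n * a) / 12)" by (simp only: ee_add_int)
  qed
  have iv: "{0..<12::int} = {0,1,2,3,4,5,6,7,8,9,10,11}"
    by (simp only: set_eq_iff atLeastLessThan_iff insert_iff empty_iff) presburger
  have F: "F (int n) = w ^ n - w ^ (5 * n) - w ^ (7 * n) + w ^ (11 * n)" for n
  proof -
    have "ee (of_int (int n * int k) / 12) = w ^ (k * n)" for k
      unfolding w_def ee_of_nat_mult[symmetric] by (simp add: mult_ac)
    from this[of 1] this[of 5] this[of 7] this[of 11] show ?thesis
      unfolding F_def iv by (simp add: chi12_def)
  qed
  have s12: "sqrt 12 = 2 * sqrt 3" using real_sqrt_mult[of 4 3] by simp
  have "F (int n) = of_real (sqrt 12) * chi12 (int n)" if "n \<in> {0,1,2,3,4,5,6,7,8,9,10,11}" for n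
    using that unfolding F insert_iff empty_iff
    apply (elim disjE)
    apply (simp_all add: chi12_def s12)
    apply (simp_all add: pw)
    apply (simp_all add: w2)
    apply (simp_all add: w complex_eq_iff)
    done
  moreover have "nat (m mod 12) \<in> {0,1,2,3,4,5,6,7,8,9,10,11}" using mod_12_cases[of m] by auto
  ultimately have "F (int (nat (m mod 12))) = of_real (sqrt 12) * chi12 (int (nat (m mod 12)))" by blast
  hence "F (m mod 12) = of_real (sqrt 12) * chi12 (m mod 12)" by simp
  moreover have "F (m mod 12) = F m" by (rule periodic_int_mod[of F, OF per])
  moreover have "chi12 (m mod 12) = chi12 m" by (simp add: chi12_def)
  ultimately show ?thesis unfolding F_def by simp
qed

text \<open>The scaling by \<open>L\<close> puts eta(Lz), with \<open>\<psi>\<close> the indicator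
  of multiples of \<open>L\<close>, and eta((z + 24j)/L), with a quadratic exponential as
  \<open>\<psi>\<close>, into one family. The division by 2 makes \<open>L = 1\<close>,
  \<open>\<psi> = 1\<close> equal to eta, where \<open>m\<close> and \<open>- m\<close> contribute
  alike.\<close>

definition weil_theta :: "int \<Rightarrow> (int \<Rightarrow> complex) \<Rightarrow> complex \<Rightarrow> complex" where
  "weil_theta L \<psi> z = theta_series (\<lambda>m. chi12 m * \<psi> m) (z / (24 * of_int L)) / 2"

text \<open>A normalized Fourier transform modulo \<open>L\<close>. The argument
  \<open>12 * a\<close> is what the Chinese remainder theorem leaves for \<open>\<psi>\<close> when
  the character modulo 12 is split off.\<close>

definition fhat :: "int \<Rightarrow> (int \<Rightarrow> complex) \<Rightarrow> int \<Rightarrow> complex" where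
  "fhat L \<psi> m = (\<Sum>a\<in>{0..<L}. \<psi> (12 * a) * ee (of_int (m * a) / of_int L)) / of_real (sqrt (of_int L))"

lemma fhat_periodic:
  assumes "L > 0"
  shows "fhat L \<psi> (m + L) = fhat L \<psi> m"
proof -
  have "of_int ((m + L) * a) / of_int L = of_int (m * a) / (of_int L :: complex) + of_int a" for a
    using assms by (simp add: field_simps)
  thus ?thesis unfolding fhat_def by (simp only: ee_add_int)
qed

lemma bounded_chi12_mult:
  assumes "L > 0" "\<And>n. \<psi> (n + L) = \<psi> n"
  obtains C where "\<And>n. norm (chi12 n * \<psi> n) \<le> C"
proof -
  obtain C where C: "\<And>n. norm (\<psi> n) \<le> C" using periodic_int_bounded[of L \<psi>] assms by blast
  have "norm (chi12 n * \<psi> n) \<le> 1 * C" for n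
    unfolding norm_mult by (intro mult_mono norm_chi12 C) auto
  thus ?thesis using that by blast
qed

lemma divide_upper: "z \<in> upper \<Longrightarrow> c > 0 \<Longrightarrow> z / of_real c \<in> upper"
  by (simp add: upper_def Im_divide_of_real)

lemma divide_upper_int: "z \<in> upper \<Longrightarrow> c > 0 \<Longrightarrow> z / of_int c \<in> upper"
  using divide_upper[of z "of_int c"] by simp

lemma weil_theta_holomorphic:
  assumes "L > 0" "\<And>n. \<psi> (n + L) = \<psi> n"
  shows "weil_theta L \<psi> holomorphic_on upper"
proof -
  obtain C where C: "\<And>n. norm (chi12 n * \<psi> n) \<le> C" using bounded_chi12_mult assms by blast
  have "(theta_series (\<lambda>m. chi12 m * \<psi> m) \<circ> (\<lambda>z. z / of_int (24 * L))) holomorphic_on upper"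
    by (rule holomorphic_on_compose_gen[OF _ theta_series_holomorphic[OF C]])
       (use assms(1) divide_upper_int[of _ "24 * L"] in \<open>auto intro!: holomorphic_intros\<close>)
  thus ?thesis unfolding weil_theta_def o_def by (intro holomorphic_intros) simp_all
qed

text \<open>Residues modulo \<open>12 * L\<close> are written as \<open>12 * a + L * b\<close>.
  There \<open>\<psi>\<close> depends only on \<open>a\<close>, the character only on
  \<open>b\<close> because \<open>chi12 L = 1\<close>, and the exponential factors, so the sum is a
  product.\<close>

lemma finite_fourier_chi12:
  assumes L: "L > 0" "coprime L 12" "chi12 L = 1" and per: "\<And>n. \<psi> (n + L) = \<psi> n"
  shows "(\<Sum>a\<in>{0..<12 * L}. chi12 a * \<psi> a * ee (of_int (m * a) / of_int (12 * L)))
       = of_real (sqrt 12) * chi12 m * (\<Sum>a\<in>{0..<L}. \<psi> (12 * a) * ee (of_int (m * a) / of_int L))"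
proof -
  define F where "F = (\<lambda>a. chi12 a * \<psi> a * ee (of_int (m * a) / of_int (12 * L)))"
  have Fper: "F (a + 12 * L) = F a" for a
  proof -
    have "of_int (m * (a + 12 * L)) / of_int (12 * L) = of_int (m * a) / (of_int (12 * L) :: complex) + of_int m"
      using L(1) by (simp add: field_simps)
    moreover have "chi12 (a + 12 * L) = chi12 a" by (intro chi12_cong) simp
    moreover have "\<psi> (a + 12 * L) = \<psi> a" using periodic_int_mult[of \<psi> L a 12, OF per] by (simp add: mult.commute)
    ultimately show ?thesis unfolding F_def by (simp only: ee_add_int)
  qed
  define h where "h = (\<lambda>(a,b). (12 * a + L * b) mod (12 * L))"
  have inj: "inj_on h ({0..<L} \<times> {0..<12})"
  proof (rule inj_onI, clarify)
    fix a b a' b' assume ab: "a \<in> {0..<L}" "b \<in> {0..<12}" "a' \<in> {0..<L}" "b' \<in> {0..<12}" and eq: "h (a, b) = h (a', b')"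
    from eq have c: "[12 * a + L * b = 12 * a' + L * b'] (mod (12 * L))" by (simp add: h_def cong_def)
    have "[12 * a + L * b = 12 * a' + L * b'] (mod L)"
      using c by (rule cong_dvd_modulus) simp
    hence "[12 * a = 12 * a'] (mod L)" by (simp add: cong_def mod_add_right_eq)
    hence "[a = a'] (mod L)" using L(2) cong_mult_lcancel[of 12 L a a'] by (simp add: coprime_commute)
    hence "a = a'" using ab by (simp add: cong_def)
    moreover have "[12 * a + L * b = 12 * a' + L * b'] (mod 12)"
      using c by (rule cong_dvd_modulus) simp
    hence "[L * b = L * b'] (mod 12)" by (simp add: cong_def mod_add_left_eq)
    hence "[b = b'] (mod 12)" using L(2) cong_mult_lcancel[of L 12 b b'] by simp
    hence "b = b'" using ab by (simp add: cong_def)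
    ultimately show "a = a' \<and> b = b'" by simp
  qed
  have img: "h ` ({0..<L} \<times> {0..<12}) = {0..<12 * L}"
  proof (rule card_subset_eq)
    show "h ` ({0..<L} \<times> {0..<12}) \<subseteq> {0..<12 * L}" using L(1) by (auto simp: h_def)
    show "card (h ` ({0..<L} \<times> {0..<12})) = card {0..<12 * L}"
      unfolding card_image[OF inj] using L(1) by (simp add: card_cartesian_product nat_mult_distrib)
  qed simp
  have "(\<Sum>a\<in>{0..<12 * L}. F a) = (\<Sum>ab\<in>{0..<L} \<times> {0..<12}. F (h ab))"
    unfolding img[symmetric] by (subst sum.reindex[OF inj]) simp
  also have "\<dots> = (\<Sum>(a,b)\<in>{0..<L} \<times> {0..<12}. (\<psi> (12 * a) * ee (of_int (m * a) / of_int L)) * (chi12 b * ee (of_int (m * b) / 12)))"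
  proof (rule sum.cong[OF refl], clarify)
    fix a b :: int
    have "F (h (a, b)) = F (12 * a + L * b)" unfolding h_def prod.case by (rule periodic_int_mod[of F, OF Fper])
    also have "chi12 (12 * a + L * b) = chi12 (L * b)" by (intro chi12_cong) simp
    hence "chi12 (12 * a + L * b) = chi12 b" by (simp add: chi12_mult L)
    moreover have "\<psi> (12 * a + L * b) = \<psi> (12 * a)" by (rule periodic_int_mult[of \<psi>, OF per])
    moreover have "of_int (m * (12 * a + L * b)) / of_int (12 * L) = of_int (m * a) / of_int L + of_int (m * b) / (12 :: complex)"
      using L(1) by (simp add: field_simps)
    ultimately show "F (h (a, b)) = (\<psi> (12 * a) * ee (of_int (m * a) / of_int L)) * (chi12 b * ee (of_int (m * b) / 12))"
      unfolding F_def by (simp only: ee_add mult_ac)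
  qed
  also have "\<dots> = (\<Sum>a\<in>{0..<L}. \<psi> (12 * a) * ee (of_int (m * a) / of_int L)) * (\<Sum>b\<in>{0..<12}. chi12 b * ee (of_int (m * b) / 12))"
    unfolding sum_product sum.cartesian_product ..
  finally show ?thesis unfolding F_def chi12_gauss by (simp only: mult_ac)
qed

text \<open>Grouping the terms by residues \<open>a\<close> modulo \<open>N = 12 * L\<close> gives
  Gaussian sums at \<open>a / N\<close> with parameter \<open>t = y / N\<close>. Poisson summation
  turns the dependence on \<open>a\<close> into exponentials, and the sum over \<open>a\<close>
  becomes a finite Fourier transform.\<close>

lemma weil_theta_S_imag:
  assumes L: "L > 0" "coprime L 12" "chi12 L = 1" and per: "\<And>n. \<psi> (n + L) = \<psi> n" and y: "y > 0"
  shows "weil_theta L \<psi> (\<i> / of_real y) = of_real (sqrt y) * weil_theta L (fhat L \<psi>) (\<i> * of_real y)"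
proof -
  define N where "N = 12 * L"
  have N: "N > 0" using L by (simp add: N_def)
  define b where "b = (\<lambda>m. chi12 m * \<psi> m)"
  obtain C where C: "\<And>n. norm (b n) \<le> C" using bounded_chi12_mult[of L \<psi>, OF L(1) per] unfolding b_def by blast
  obtain C' where C': "\<And>n. norm (chi12 n * fhat L \<psi> n) \<le> C'" using bounded_chi12_mult[of L "fhat L \<psi>", OF L(1) fhat_periodic[OF L(1)]] by blast
  have bper: "b (n + N) = b n" for n
    using periodic_int_mult[of \<psi> L n 12, OF per] chi12_cong[of "n + N" n]
    unfolding b_def N_def by (simp add: mult.commute)
  define \<tau> where "\<tau> = \<i> / of_real y / (24 * of_int L)"
  have \<tau>: "\<tau> \<in> upper" "\<tau> = \<i> / (2 * of_int N * of_real y)" using L(1) y by (simp_all add: \<tau>_def upper_def N_def Im_divide_of_real)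
  define t where "t = y / of_int N"
  have t: "t > 0" using y N by (simp add: t_def)
  let ?E = "\<lambda>m::int. of_real (exp (- (pi * t * of_int (m^2))))"
  have "theta_series b \<tau> = (\<Sum>a\<in>{0..<N}. \<Sum>\<^sub>\<infinity>n. b (a + N * n) * ee (of_int ((a + N * n)^2) * \<tau>))"
    unfolding theta_series_def by (rule infsum_int_residues[OF N theta_series_summable[OF C \<tau>(1)]])
  also have "\<dots> = (\<Sum>a\<in>{0..<N}. b a * gaussian_sum t (of_int a / of_int N))"
  proof (rule sum.cong[OF refl])
    fix a
    have "b (a + N * n) * ee (of_int ((a + N * n)^2) * \<tau>) = b a * exp (- (of_real pi * (of_int a / of_int N + of_int n)^2 / of_real t))" for n
    proof -
      have "2 * of_real pi * \<i> * (of_int ((a + N * n)^2) * \<tau>) = - (of_real pi * (of_int a / of_int N + of_int n)^2 / of_real t)"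
        unfolding \<tau>(2) t_def using N y by (simp add: field_simps power2_eq_square)
      thus ?thesis unfolding ee_def periodic_int_mult[of b, OF bper] by simp
    qed
    thus "(\<Sum>\<^sub>\<infinity>n. b (a + N * n) * ee (of_int ((a + N * n)^2) * \<tau>)) = b a * gaussian_sum t (of_int a / of_int N)"
      unfolding gaussian_sum_def by (simp add: infsum_cmult_right')
  qed
  also have "\<dots> = of_real (sqrt t) * (\<Sum>a\<in>{0..<N}. \<Sum>\<^sub>\<infinity>m. b a * (?E m * ee (of_int m * (of_int a / of_int N))))"
    unfolding gaussian_sum_poisson[OF t] by (simp add: infsum_cmult_right' sum_distrib_left mult_ac)
  also have "(\<Sum>a\<in>{0..<N}. \<Sum>\<^sub>\<infinity>m. b a * (?E m * ee (of_int m * (of_int a / of_int N))))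
     = (\<Sum>\<^sub>\<infinity>m. \<Sum>a\<in>{0..<N}. b a * (?E m * ee (of_int m * (of_int a / of_int N))))"
  proof (rule infsum_sum_swap[symmetric])
    fix a :: int
    have "(\<lambda>m. norm (?E m * ee (of_int m * (of_int a / of_int N)))) summable_on UNIV"
    proof -
      have im: "Im (of_int m * (of_int a / of_int N)) = 0" for m
        using Im_divide_of_real[of "of_int (m * a)" "of_int N"] by simp
      have "norm (?E m * ee (of_int m * (of_int a / of_int N))) = exp (- (pi * t) * real_of_int (m^2) + 0 * real_of_int \<bar>m\<bar>)" for m
        unfolding norm_mult norm_ee im by simp
      thus ?thesis using summable_on_int_gauss[of "pi * t" 0] t by simp
    qed
    hence "(\<lambda>m. ?E m * ee (of_int m * (of_int a / of_int N))) summable_on UNIV" by (rule abs_summable_summable)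
    thus "(\<lambda>m. b a * (?E m * ee (of_int m * (of_int a / of_int N)))) summable_on UNIV" by (rule summable_on_cmult_right)
  qed
  also have "\<dots> = (\<Sum>\<^sub>\<infinity>m. of_real (sqrt (of_int N)) * (chi12 m * fhat L \<psi> m * ee (of_int (m^2) * (\<i> * of_real y / (24 * of_int L)))))"
  proof (rule infsum_cong)
    fix m :: int
    have 1: "?E m = ee (of_int (m^2) * (\<i> * of_real y / (24 * of_int L)))"
    proof -
      have "2 * of_real pi * \<i> * (of_int (m^2) * (\<i> * of_real y / (24 * of_int L))) = of_real (- (pi * t * of_int (m^2)))"
        using L(1) by (simp add: t_def N_def field_simps)
      thus ?thesis unfolding ee_def by (simp only: exp_of_real)
    qed
    have "(\<Sum>a\<in>{0..<N}. b a * (?E m * ee (of_int m * (of_int a / of_int N))))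
       = ?E m * (\<Sum>a\<in>{0..<12 * L}. chi12 a * \<psi> a * ee (of_int (m * a) / of_int (12 * L)))"
      unfolding sum_distrib_left b_def N_def by (intro sum.cong refl) (simp add: mult_ac)
    also have "(\<Sum>a\<in>{0..<12 * L}. chi12 a * \<psi> a * ee (of_int (m * a) / of_int (12 * L)))
       = of_real (sqrt 12) * chi12 m * (of_real (sqrt (of_int L)) * fhat L \<psi> m)"
      unfolding finite_fourier_chi12[of L \<psi>, OF L per] fhat_def using L(1) by simp
    also have "\<dots> = of_real (sqrt (of_int N)) * (chi12 m * fhat L \<psi> m)"
      unfolding N_def by (simp add: real_sqrt_mult)
    finally show "(\<Sum>a\<in>{0..<N}. b a * (?E m * ee (of_int m * (of_int a / of_int N))))
      = of_real (sqrt (of_int N)) * (chi12 m * fhat L \<psi> m * ee (of_int (m^2) * (\<i> * of_real y / (24 * of_int L))))"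
      unfolding 1 by (simp only: mult_ac)
  qed
  also have "\<dots> = of_real (sqrt (of_int N)) * theta_series (\<lambda>m. chi12 m * fhat L \<psi> m) (\<i> * of_real y / (24 * of_int L))"
    unfolding theta_series_def by (rule infsum_cmult_right')
  also have "of_real (sqrt t) * \<dots> = of_real (sqrt y) * theta_series (\<lambda>m. chi12 m * fhat L \<psi> m) (\<i> * of_real y / (24 * of_int L))"
  proof -
    have "sqrt t * sqrt (of_int N) = sqrt y" using N by (simp add: t_def flip: real_sqrt_mult)
    thus ?thesis by (metis mult.assoc of_real_mult)
  qed
  finally show ?thesis unfolding weil_theta_def b_def \<tau>_def by simp
qed

text \<open>Both sides are holomorphic on the upper half-plane, and they agree on the imaginary
  axis, where the chosen square root of \<open>- \<i> * z\<close> is positive.\<close>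

theorem weil_theta_S:
  assumes L: "L > 0" "coprime L 12" "chi12 L = 1" and per: "\<And>n. \<psi> (n + L) = \<psi> n" and z: "z \<in> upper"
  shows "weil_theta L \<psi> (- 1 / z) = csqrt (- \<i> * z) * weil_theta L (fhat L \<psi>) z"
proof -
  let ?f = "\<lambda>z. weil_theta L \<psi> (- 1 / z) - csqrt (- \<i> * z) * weil_theta L (fhat L \<psi>) z"
  have h1: "(weil_theta L \<psi> \<circ> (\<lambda>z. - 1 / z)) holomorphic_on upper"
    by (rule holomorphic_on_compose_gen[OF _ weil_theta_holomorphic[of L \<psi>, OF L(1) per]])
       (auto intro!: holomorphic_intros dest: upper_nonzero upper_S)
  have nonpos: "- \<i> * z \<notin> \<real>\<^sub>\<le>\<^sub>0" if "z \<in> upper" for z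
    using that by (auto simp: upper_def complex_nonpos_Reals_iff)
  have hol: "?f holomorphic_on upper"
    using h1 unfolding o_def
    by (intro holomorphic_intros weil_theta_holomorphic[of L "fhat L \<psi>", OF L(1) fhat_periodic[OF L(1)]] nonpos) auto
  have lim: "\<i> islimpt ((\<lambda>y. \<i> * of_real y) ` {0<..})"
    unfolding islimpt_sequential
  proof (intro exI[of _ "\<lambda>n. \<i> * of_real (1 + 1 / real (Suc n))"] conjI allI)
    show "\<i> * of_real (1 + 1 / real (Suc n)) \<in> (\<lambda>y. \<i> * of_real y) ` {0<..} - {\<i>}" for n
      by (auto simp: complex_eq_iff add_pos_pos intro!: imageI)
    have "(\<lambda>n. 1 + 1 / real (Suc n)) \<longlonglongrightarrow> 1 + 0"
      by (intro tendsto_intros LIMSEQ_Suc lim_1_over_n)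
    hence "(\<lambda>n. \<i> * of_real (1 + 1 / real (Suc n))) \<longlonglongrightarrow> \<i> * of_real (1 + 0)" by (intro tendsto_mult tendsto_const tendsto_of_real)
    thus "(\<lambda>n. \<i> * of_real (1 + 1 / real (Suc n))) \<longlonglongrightarrow> \<i>" by simp
  qed
  have "?f z = 0"
  proof (rule analytic_continuation[OF hol open_upper connected_upper _ _ lim _ z])
    show "?f w = 0" if w: "w \<in> (\<lambda>y. \<i> * of_real y) ` {0<..}" for w
    proof -
      obtain y where y: "y > 0" "w = \<i> * of_real y" using w by auto
      have 1: "- 1 / w = \<i> / of_real y" using y by (simp add: field_simps)
      have 2: "csqrt (- \<i> * w) = of_real (sqrt y)" using y by (simp add: csqrt_of_real_nonneg)
      show ?thesis unfolding 1 2 unfolding y(2) using weil_theta_S_imag[of L \<psi>, OF L per y(1)] by simp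
    qed
  qed (auto simp: upper_def)
  thus ?thesis by simp
qed

text \<open>On the support of the character m^2 / (24 L) = m^2 / 24 - k m^2 / L, and m^2 / 24 is
  congruent to 1/24 modulo 1.\<close>

lemma weil_theta_T:
  assumes "L = 1 + 24 * k" "k \<ge> 0"
  shows "weil_theta L \<psi> (z + 1) = ee (1 / 24) * weil_theta L (\<lambda>m. \<psi> m * ee (of_int (- k * m^2) / of_int L)) z"
proof -
  have L: "L > 0" using assms by simp
  have eq: "chi12 m * \<psi> m * ee (of_int (m^2) * ((z + 1) / (24 * of_int L)))
     = ee (1 / 24) * (chi12 m * (\<psi> m * ee (of_int (- k * m^2) / of_int L)) * ee (of_int (m^2) * (z / (24 * of_int L))))" for m
  proof (cases "chi12 m = 0")
    case False
    then obtain j where j: "m^2 = 1 + 24 * j" using chi12_square_mod by blast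
    have LC: "(of_int L :: complex) \<noteq> 0" using L by simp
    have "of_int (m^2) / (24 * of_int L) + of_int (k * m^2) / of_int L = (of_int (m^2) * (1 + 24 * of_int k)) / (24 * of_int L :: complex)"
      using LC by (simp add: field_simps)
    also have "1 + 24 * of_int k = (of_int L :: complex)" using assms(1) by simp
    finally have "of_int (m^2) / (24 * of_int L) + of_int (k * m^2) / of_int L = (of_int (m^2) / 24 :: complex)" using LC by simp
    also have "\<dots> = 1 / 24 + of_int j" unfolding j by (simp add: field_simps)
    finally have "of_int (m^2) * ((z + 1) / (24 * of_int L)) = (1 / 24 + of_int (- k * m^2) / of_int L + of_int (m^2) * (z / (24 * of_int L))) + of_int j"
      by (simp add: algebra_simps add_divide_distrib)
    hence "ee (of_int (m^2) * ((z + 1) / (24 * of_int L))) = ee (1 / 24) * ee (of_int (- k * m^2) / of_int L) * ee (of_int (m^2) * (z / (24 * of_int L)))"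
      by (simp only: ee_add ee_of_int mult_1_right)
    thus ?thesis by (simp only: mult_ac)
  qed simp
  show ?thesis unfolding weil_theta_def theta_series_def eq by (simp only: infsum_cmult_right' times_divide_eq_right)
qed

section \<open>The eta function and the pentagonal number theorem\<close>

definition phi :: "complex \<Rightarrow> complex" where "phi q = (\<Prod>n. 1 - q ^ Suc n)"

lemma phi_uniformly_convergent:
  assumes "r < 1"
  shows "uniform_limit (cball 0 r) (\<lambda>N q. \<Prod>n<N. 1 - q ^ Suc n) phi sequentially"
proof (cases "r \<ge> 0")
  case True
  have uc: "uniformly_convergent_on (cball 0 r) (\<lambda>N q. \<Prod>n<N. 1 - q ^ Suc n :: complex)"
  proof (rule uniformly_convergent_on_prod')
    show "uniformly_convergent_on (cball 0 r) (\<lambda>N q. \<Sum>n<N. norm (1 - q ^ Suc n - 1 :: complex))"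
    proof (rule Weierstrass_m_test')
      fix n and q :: complex assume "q \<in> cball 0 r"
      hence "norm q ^ Suc n \<le> r ^ Suc n" by (intro power_mono) auto
      thus "norm (norm (1 - q ^ Suc n - 1)) \<le> r ^ Suc n" by (simp add: norm_mult norm_power)
    next
      show "summable (\<lambda>n. r ^ Suc n)" using True assms by (subst summable_Suc_iff) (auto intro: summable_geometric)
    qed
  qed (auto intro!: continuous_intros)
  then obtain g where g: "uniform_limit (cball 0 r) (\<lambda>N q. \<Prod>n<N. 1 - q ^ Suc n :: complex) g sequentially"
    by (auto simp: uniformly_convergent_on_def)
  have "g q = phi q" if q: "q \<in> cball 0 r" for q
  proof -
    have nq: "norm q < 1" using q assms by simp
    have "summable (\<lambda>n. norm q ^ Suc n)" using nq by (subst summable_Suc_iff) (auto intro: summable_geometric)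
    hence "abs_convergent_prod (\<lambda>n. 1 - q ^ Suc n)"
      by (simp add: abs_convergent_prod_conv_summable norm_mult norm_power)
    hence "convergent_prod (\<lambda>n. 1 - q ^ Suc n)" by (rule abs_convergent_prod_imp_convergent_prod)
    hence "(\<lambda>N. \<Prod>n<N. 1 - q ^ Suc n) \<longlonglongrightarrow> phi q"
      unfolding phi_def using has_prod_imp_tendsto' by blast
    moreover have "(\<lambda>N. \<Prod>n<N. 1 - q ^ Suc n) \<longlonglongrightarrow> g q" by (rule tendsto_uniform_limitI[OF g q])
    ultimately show ?thesis using LIMSEQ_unique by blast
  qed
  hence "uniform_limit (cball 0 r) (\<lambda>N q. \<Prod>n<N. 1 - q ^ Suc n) g sequentially \<longleftrightarrow> ?thesis"
    by (intro uniform_limit_cong') auto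
  thus ?thesis using g by blast
qed auto

lemma phi_tendsto: "norm q < 1 \<Longrightarrow> (\<lambda>N. \<Prod>n<N. 1 - q ^ Suc n) \<longlonglongrightarrow> phi q"
  by (rule tendsto_uniform_limitI[OF phi_uniformly_convergent[of "norm q"]]) auto

lemma phi_holomorphic: "phi holomorphic_on ball 0 1"
proof (rule holomorphic_uniform_sequence[where f = "\<lambda>N q. \<Prod>n<N. 1 - q ^ Suc n"])
  fix x :: complex assume x: "x \<in> ball 0 1"
  define d where "d = (1 - norm x) / 2"
  have d: "d > 0" using x by (simp add: d_def)
  have sub: "cball x d \<subseteq> cball 0 (norm x + d)"
    by (auto simp: dist_norm) (metis add.commute add_left_mono norm_minus_commute norm_triangle_sub order.trans)
  have lt: "norm x + d < 1" using x by (simp add: d_def field_simps)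
  show "\<exists>d>0. cball x d \<subseteq> ball 0 1 \<and> uniform_limit (cball x d) (\<lambda>N q. \<Prod>n<N. 1 - q ^ Suc n) phi sequentially"
    using d sub lt uniform_limit_on_subset[OF phi_uniformly_convergent[OF lt] sub]
    by (intro exI[of _ d]) fastforce
qed (auto intro!: holomorphic_intros)

lemma phi_nonzero:
  assumes "norm q < 1"
  shows "phi q \<noteq> 0"
proof -
  have "summable (\<lambda>n. norm q ^ Suc n)" using assms by (subst summable_Suc_iff) (auto intro: summable_geometric)
  hence "abs_convergent_prod (\<lambda>n. 1 - q ^ Suc n)"
    by (simp add: abs_convergent_prod_conv_summable norm_mult norm_power)
  hence "convergent_prod (\<lambda>n. 1 - q ^ Suc n)" by (rule abs_convergent_prod_imp_convergent_prod)
  moreover have "1 - q ^ Suc n \<noteq> 0" for n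
  proof
    assume "1 - q ^ Suc n = 0"
    hence "norm q ^ Suc n = 1" by (metis norm_one norm_power right_minus_eq)
    moreover have "norm q ^ Suc n \<le> norm q ^ 1" using assms by (intro power_decreasing) auto
    ultimately show False using assms by simp
  qed
  ultimately show ?thesis unfolding phi_def by (rule prodinf_nonzero)
qed

lemma two_triangle: "2 * int (triangle n) = int n * (int n + 1)"
  by (induction n) (auto simp: algebra_simps)

text \<open>Shanks' finite form of the pentagonal number theorem.\<close>

lemma shanks_pentagonal:
  fixes q :: "'a :: comm_ring_1"
  shows "(\<Sum>s\<le>n. (-1) ^ s * (\<Prod>j\<in>{s..<n}. 1 - q ^ Suc j) * q ^ (s * n + triangle s))
       = (\<Sum>k\<le>n. if k = 0 then 1 else (-1) ^ k * (q ^ (k^2 + triangle (k - 1)) + q ^ (k^2 + triangle k)))"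
proof (induction n)
  case (Suc n)
  define T where "T = (\<lambda>s n. (-1) ^ s * (\<Prod>j\<in>{s..<n}. 1 - q ^ Suc j) * q ^ (s * n + triangle s))"
  \<comment> \<open>\<open>A s\<close> is the term that telescopes:
    \<open>T s (Suc n) = T s n + A (s - 1) - A s\<close>, with the middle term absent for
    \<open>s = 0\<close>. Passing from \<open>n\<close> to \<open>Suc n\<close> therefore adds just
    \<open>- A n\<close> and \<open>T (Suc n) (Suc n)\<close>, the next two pentagonal
    terms.\<close>
  define A where "A = (\<lambda>s. (-1) ^ s * (\<Prod>j\<in>{s..<n}. 1 - q ^ Suc j) * q ^ ((s + 1) * Suc n + triangle s))"
  have step: "T s (Suc n) = T s n + (if s = 0 then 0 else A (s - 1)) - A s" if s: "s \<le> n" for s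
  proof -
    have P: "(\<Prod>j\<in>{s..<Suc n}. 1 - q ^ Suc j) = (\<Prod>j\<in>{s..<n}. 1 - q ^ Suc j) * (1 - q ^ Suc n)"
      using s by (simp add: prod.atLeastLessThan_Suc)
    have 1: "T s (Suc n) = (-1) ^ s * (\<Prod>j\<in>{s..<n}. 1 - q ^ Suc j) * q ^ (s * Suc n + triangle s) - A s"
      unfolding T_def A_def P by (simp add: algebra_simps power_add)
    show ?thesis
    proof (cases s)
      case 0
      thus ?thesis using 1 by (simp add: T_def)
    next
      case (Suc u)
      have P2: "(\<Prod>j\<in>{u..<n}. 1 - q ^ Suc j) = (1 - q ^ s) * (\<Prod>j\<in>{s..<n}. 1 - q ^ Suc j)"
        using s Suc by (subst prod.atLeast_Suc_lessThan) auto
      have e1: "q ^ ((u + 1) * Suc n + triangle u) = q ^ (s * n + triangle s)"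
        using Suc by (intro arg_cong2[of _ _ _ _ "(^)"] refl) simp
      have e2: "q ^ (s * Suc n + triangle s) = q ^ s * q ^ (s * n + triangle s)"
        by (simp add: power_add[symmetric] algebra_simps)
      have "A u = - ((-1) ^ s * ((1 - q ^ s) * (\<Prod>j\<in>{s..<n}. 1 - q ^ Suc j)) * q ^ (s * n + triangle s))"
        unfolding A_def P2 e1 using Suc by simp
      moreover define P0 where "P0 = (\<Prod>j\<in>{s..<n}. 1 - q ^ Suc j)"
      ultimately have "T s n + A u = (-1) ^ s * P0 * (q ^ s * q ^ (s * n + triangle s))"
        unfolding T_def P0_def[symmetric] by (simp add: algebra_simps)
      thus ?thesis unfolding 1 e2 P0_def using Suc by simp
    qed
  qed
  have tele: "(\<Sum>s\<le>m. (if s = 0 then 0 else A (s - 1)) - A s) = - A m" for m by (induction m) auto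
  let ?G = "\<lambda>k. if k = 0 then 1 else (-1) ^ k * (q ^ (k^2 + triangle (k - 1)) + q ^ (k^2 + triangle k))"
  have IH: "(\<Sum>s\<le>n. T s n) = (\<Sum>k\<le>n. ?G k)" unfolding T_def by (rule Suc.IH)
  have "(\<Sum>s\<le>Suc n. T s (Suc n)) = (\<Sum>s\<le>n. T s n + ((if s = 0 then 0 else A (s - 1)) - A s)) + T (Suc n) (Suc n)"
    unfolding sum.atMost_Suc using step by (intro arg_cong2[of _ _ _ _ "(+)"] sum.cong refl) (simp only: atMost_iff add_diff_eq)
  also have "\<dots> = (\<Sum>k\<le>n. ?G k) + (- A n) + T (Suc n) (Suc n)" unfolding sum.distrib tele IH ..
  also have "- A n = (-1) ^ Suc n * q ^ ((Suc n)^2 + triangle n)" by (simp add: A_def power2_eq_square)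
  also have "T (Suc n) (Suc n) = (-1) ^ Suc n * q ^ ((Suc n)^2 + triangle (Suc n))" by (simp add: T_def power2_eq_square)
  also have "(\<Sum>k\<le>n. ?G k) + (-1) ^ Suc n * q ^ ((Suc n)^2 + triangle n) + (-1) ^ Suc n * q ^ ((Suc n)^2 + triangle (Suc n)) = (\<Sum>k\<le>Suc n. ?G k)"
    unfolding sum.atMost_Suc by (simp only: nat.distinct if_False diff_Suc_1 distrib_left add.assoc)
  finally show ?case unfolding T_def .
qed simp

text \<open>In the finite identity the term \<open>s = 0\<close> is the partial product of
  \<open>phi\<close>. Each of the other \<open>n\<close> terms carries a bounded product and a power
  of \<open>q\<close> of exponent at least \<open>n\<close>, so together they tend to 0.\<close>

lemma phi_pentagonal:
  assumes q: "norm q < 1"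
  shows "(\<lambda>n. \<Sum>k\<le>n. if k = 0 then 1 else (-1) ^ k * (q ^ (k^2 + triangle (k - 1)) + q ^ (k^2 + triangle k))) \<longlonglongrightarrow> phi q"
proof -
  \<comment> \<open>Bounds every partial product, by \<open>1 + x \<le> exp x\<close> and the sum of
    the geometric series.\<close>
  define D where "D = exp (norm q / (1 - norm q))"
  have prod_bound: "norm (\<Prod>j\<in>{s..<n}. 1 - q ^ Suc j) \<le> D" for s n
  proof -
    have "norm (\<Prod>j\<in>{s..<n}. 1 - q ^ Suc j) = (\<Prod>j\<in>{s..<n}. norm (1 - q ^ Suc j))" by (simp add: prod_norm)
    also have "\<dots> \<le> (\<Prod>j\<in>{s..<n}. exp (norm q ^ Suc j))"
    proof (intro prod_mono conjI)
      fix j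
      have "norm (1 - q ^ Suc j) \<le> 1 + norm q ^ Suc j"
        using norm_triangle_ineq4[of 1 "q ^ Suc j"] by (simp add: norm_power norm_mult)
      also have "\<dots> \<le> exp (norm q ^ Suc j)" by (rule exp_ge_add_one_self)
      finally show "norm (1 - q ^ Suc j) \<le> exp (norm q ^ Suc j)" .
    qed auto
    also have "\<dots> = exp (\<Sum>j\<in>{s..<n}. norm q ^ Suc j)" by (simp add: exp_sum)
    also have "(\<Sum>j\<in>{s..<n}. norm q ^ Suc j) \<le> (\<Sum>j. norm q ^ Suc j)"
    proof (rule sum_le_suminf)
      show "summable (\<lambda>j. norm q ^ Suc j)" using q by (subst summable_Suc_iff) (auto intro: summable_geometric)
    qed auto
    also have "(\<Sum>j. norm q ^ Suc j) = norm q / (1 - norm q)"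
      using q suminf_mult[of "\<lambda>j. norm q ^ j" "norm q"] by (simp add: suminf_geometric summable_geometric)
    finally show ?thesis unfolding D_def by simp
  qed
  have D: "D \<ge> 0" by (simp add: D_def)
  define R where "R = (\<lambda>n. \<Sum>s\<in>{1..n}. (-1) ^ s * (\<Prod>j\<in>{s..<n}. 1 - q ^ Suc j) * q ^ (s * n + triangle s))"
  have Rb: "norm (R n) \<le> D * (real n * norm q ^ n)" for n
  proof -
    have "norm (R n) \<le> (\<Sum>s\<in>{1..n}. D * norm q ^ n)"
      unfolding R_def
    proof (rule sum_norm_le)
      fix s assume s: "s \<in> {1..n}"
      have "norm q ^ (s * n + triangle s) \<le> norm q ^ n"
        using q s by (intro power_decreasing) (auto intro: trans_le_add1)
      hence "norm (\<Prod>j\<in>{s..<n}. 1 - q ^ Suc j) * norm q ^ (s * n + triangle s) \<le> D * norm q ^ n"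
        by (intro mult_mono prod_bound D) auto
      thus "norm ((-1) ^ s * (\<Prod>j\<in>{s..<n}. 1 - q ^ Suc j) * q ^ (s * n + triangle s)) \<le> D * norm q ^ n"
        by (simp add: norm_mult norm_power)
    qed
    thus ?thesis by (simp add: mult_ac)
  qed
  have "(\<lambda>n. D * (real n * norm q ^ n)) \<longlonglongrightarrow> D * 0"
    using powser_times_n_limit_0[of "norm q"] q by (intro tendsto_intros) auto
  hence R0: "R \<longlonglongrightarrow> 0"
    by (intro Lim_null_comparison[of R "\<lambda>n. D * (real n * norm q ^ n)"]) (use Rb in auto)
  have "(\<Sum>k\<le>n. if k = 0 then 1 else (-1) ^ k * (q ^ (k^2 + triangle (k - 1)) + q ^ (k^2 + triangle k)))
     = (\<Prod>j<n. 1 - q ^ Suc j) + R n" for n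
  proof -
    have "{..n} = insert 0 {1..n}" by auto
    thus ?thesis unfolding shanks_pentagonal[symmetric] R_def by (simp add: atLeast0LessThan)
  qed
  thus ?thesis using tendsto_add[OF phi_tendsto[OF q] R0] by simp
qed

text \<open>Defined by its theta series, so that the law under S is an instance of
  \<open>weil_theta_S\<close>. The product enters only through \<open>eta_eq_phi\<close>.\<close>

definition eta :: "complex \<Rightarrow> complex" where "eta z = weil_theta 1 (\<lambda>_. 1) z"

lemma eta_holomorphic: "eta holomorphic_on upper"
  unfolding eta_def by (rule weil_theta_holomorphic) auto

lemma eta_S: "z \<in> upper \<Longrightarrow> eta (- 1 / z) = csqrt (- \<i> * z) * eta z"
proof -
  assume z: "z \<in> upper"
  have "{0..<1::int} = {0}" by auto
  hence "fhat 1 (\<lambda>_. 1) = (\<lambda>_. 1)" by (auto simp: fhat_def fun_eq_iff)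
  thus ?thesis using weil_theta_S[of 1 "\<lambda>_. 1" z] z by (simp add: eta_def chi12_def)
qed

lemma eta_T: "eta (z + 1) = ee (1 / 24) * eta z"
  using weil_theta_T[of 1 0 "\<lambda>_. 1" z] by (simp add: eta_def)

lemma ee_upper: "z \<in> upper \<Longrightarrow> norm (ee z) < 1"
  by (simp add: norm_ee upper_def)

lemma chi12_zero_mod: "n mod 12 \<in> {0, 2, 3, 4, 6, 8, 9, 10} \<Longrightarrow> chi12 n = 0"
  by (auto simp: chi12_def)

text \<open>The character lives on residues 1 and 5 modulo 6, which are exchanged by a change of
  sign; this accounts for the factor 2. For \<open>m = 1 + 6 * n\<close> the exponent is (1 + 6n)^2
  = 1 + 24 n(3n + 1)/2, and symmetric summation in \<open>n\<close> gives the pentagonal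
  series.\<close>

lemma eta_eq_phi:
  assumes z: "z \<in> upper"
  shows "eta z = ee (z / 24) * phi (ee z)"
proof -
  define \<tau> where "\<tau> = z / 24"
  have \<tau>: "\<tau> \<in> upper" using divide_upper[of z 24] z by (simp add: \<tau>_def)
  define f where "f = (\<lambda>n::int. chi12 n * ee (of_int (n^2) * \<tau>))"
  have summ: "f summable_on UNIV" unfolding f_def by (rule theta_series_summable[of chi12 1]) (use norm_chi12 \<tau> in auto)
  have even: "f (- n) = f n" for n
  proof -
    have "chi12 (- n) = chi12 (- 1) * chi12 n" using chi12_mult[of "-1" n] by simp
    thus ?thesis by (simp add: f_def chi12_def)
  qed
  have "2 * eta z = (\<Sum>\<^sub>\<infinity>n. f n)" by (simp add: eta_def weil_theta_def theta_series_def f_def \<tau>_def)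
  also have "\<dots> = (\<Sum>a\<in>{0..<6}. \<Sum>\<^sub>\<infinity>n. f (a + 6 * n))" by (rule infsum_int_residues[OF _ summ]) simp
  also have "{0..<6::int} = {0,1,2,3,4,5}" by auto
  also have "(\<Sum>a\<in>{0,1,2,3,4,5}. \<Sum>\<^sub>\<infinity>n. f (a + 6 * n)) = (\<Sum>\<^sub>\<infinity>n. f (1 + 6 * n)) + (\<Sum>\<^sub>\<infinity>n. f (5 + 6 * n))"
  proof -
    have "(0 + 6 * n) mod 12 = 0 \<or> (0 + 6 * n) mod 12 = 6" "(2 + 6 * n) mod 12 = 2 \<or> (2 + 6 * n) mod 12 = 8"
      "(3 + 6 * n) mod 12 = 3 \<or> (3 + 6 * n) mod 12 = 9" "(4 + 6 * n) mod 12 = 4 \<or> (4 + 6 * n) mod 12 = 10" for n :: int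
      by presburger+
    hence "chi12 (0 + 6 * n) = 0" "chi12 (2 + 6 * n) = 0" "chi12 (3 + 6 * n) = 0" "chi12 (4 + 6 * n) = 0" for n
      by (intro chi12_zero_mod, simp only: insert_iff, blast)+
    hence "f (0 + 6 * n) = 0" "f (2 + 6 * n) = 0" "f (3 + 6 * n) = 0" "f (4 + 6 * n) = 0" for n
      unfolding f_def by (simp_all only: mult_zero_left)
    hence "(\<Sum>\<^sub>\<infinity>n. f (0 + 6 * n)) = 0" "(\<Sum>\<^sub>\<infinity>n. f (2 + 6 * n)) = 0" "(\<Sum>\<^sub>\<infinity>n. f (3 + 6 * n)) = 0" "(\<Sum>\<^sub>\<infinity>n. f (4 + 6 * n)) = 0"
      by (simp_all only: infsum_0_simp)
    thus ?thesis by simp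
  qed
  also have "(\<Sum>\<^sub>\<infinity>n. f (5 + 6 * n)) = (\<Sum>\<^sub>\<infinity>n. f (1 + 6 * n))"
  proof (rule infsum_reindex_bij_witness[of UNIV "\<lambda>n. - 1 - n" "\<lambda>n. - 1 - n"])
    fix n :: int
    have "1 + 6 * (- 1 - n) = - (5 + 6 * n)" by simp
    thus "f (1 + 6 * (- 1 - n)) = f (5 + 6 * n)" using even by metis
  qed auto
  finally have eta_eq: "eta z = (\<Sum>\<^sub>\<infinity>n. f (1 + 6 * n))" by simp
  have s1: "(\<lambda>n. f (1 + 6 * n)) summable_on UNIV"
  proof -
    have "(f \<circ> (\<lambda>n. 1 + 6 * n)) summable_on UNIV"
      using summable_on_subset_banach[OF summ, of "range (\<lambda>n. 1 + 6 * n)"]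
      by (subst summable_on_reindex[symmetric]) (auto simp: inj_on_def)
    thus ?thesis by (simp add: o_def)
  qed
  hence "(sum (\<lambda>n. f (1 + 6 * n)) \<longlongrightarrow> eta z) (finite_subsets_at_top UNIV)"
    unfolding eta_eq using has_sum_infsum has_sum_def by blast
  from filterlim_compose[OF this filterlim_int_interval]
  have lim: "(\<lambda>N. \<Sum>n\<in>{- int N..int N}. f (1 + 6 * n)) \<longlonglongrightarrow> eta z" .
  define q where "q = ee z"
  have fp: "f (1 + 6 * int k) = (-1) ^ k * (ee \<tau> * q ^ (k^2 + triangle k))" for k
  proof -
    have "chi12 (1 + 6 * int k) = (-1) ^ k"
    proof (cases "even k")
      case True
      then obtain j where "k = 2 * j" by blast
      thus ?thesis by (simp add: chi12_def)
    next
      case False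
      then obtain j where "k = 2 * j + 1" using oddE by blast
      hence "(1 + 6 * int k) mod 12 = 7" by (simp; presburger)
      thus ?thesis using False by (simp add: chi12_def)
    qed
    moreover have "of_int ((1 + 6 * int k)^2) * \<tau> = \<tau> + of_nat (k^2 + triangle k) * z"
    proof -
      have "(1 + 6 * int k)^2 = 1 + 24 * int (k^2 + triangle k)"
        using two_triangle[of k] by (simp add: power2_eq_square algebra_simps)
      hence "of_int ((1 + 6 * int k)^2) * \<tau> = of_int (1 + 24 * int (k^2 + triangle k)) * \<tau>" by simp
      also have "\<dots> = \<tau> + of_nat (k^2 + triangle k) * (24 * \<tau>)" by (simp add: algebra_simps)
      finally show ?thesis by (simp add: \<tau>_def)
    qed
    ultimately show ?thesis unfolding f_def q_def by (simp only: ee_add ee_of_nat_mult)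
  qed
  have fm: "f (1 + 6 * (- int k)) = (-1) ^ k * (ee \<tau> * q ^ (k^2 + triangle (k - 1)))" if k: "k > 0" for k
  proof -
    have "chi12 (1 + 6 * (- int k)) = (-1) ^ k"
    proof (cases "even k")
      case True
      then obtain j where "k = 2 * j" by blast
      hence "(1 + 6 * (- int k)) mod 12 = 1" by (simp; presburger)
      thus ?thesis using True by (simp add: chi12_def)
    next
      case False
      then obtain j where "k = 2 * j + 1" using oddE by blast
      hence "(1 + 6 * (- int k)) mod 12 = 7" by (simp; presburger)
      thus ?thesis using False by (simp add: chi12_def)
    qed
    moreover have "of_int ((1 + 6 * (- int k))^2) * \<tau> = \<tau> + of_nat (k^2 + triangle (k - 1)) * z"
    proof -
      obtain m where m: "k = Suc m" using k by (cases k) auto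
      have "2 * int (triangle m) = int m * (int m + 1)"
        by (rule two_triangle)
      hence "(1 + 6 * (- int k))^2 = 1 + 24 * int (k^2 + triangle (k - 1))"
        unfolding m by (simp add: power2_eq_square algebra_simps)
      hence "of_int ((1 + 6 * (- int k))^2) * \<tau> = of_int (1 + 24 * int (k^2 + triangle (k - 1))) * \<tau>" by simp
      also have "\<dots> = \<tau> + of_nat (k^2 + triangle (k - 1)) * (24 * \<tau>)" by (simp add: algebra_simps)
      finally show ?thesis by (simp add: \<tau>_def)
    qed
    ultimately show ?thesis unfolding f_def q_def by (simp only: ee_add ee_of_nat_mult)
  qed
  have sums: "(\<Sum>n\<in>{- int N..int N}. f (1 + 6 * n))
     = ee \<tau> * (\<Sum>k\<le>N. if k = 0 then 1 else (-1) ^ k * (q ^ (k^2 + triangle (k - 1)) + q ^ (k^2 + triangle k)))" for N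
  proof (induction N)
    case 0
    show ?case using fp[of 0] by simp
  next
    case (Suc N)
    have "{- int (Suc N)..int (Suc N)} = insert (- int (Suc N)) (insert (int (Suc N)) {- int N..int N})" by auto
    hence "(\<Sum>n\<in>{- int (Suc N)..int (Suc N)}. f (1 + 6 * n)) = f (1 + 6 * (- int (Suc N))) + (f (1 + 6 * int (Suc N)) + (\<Sum>n\<in>{- int N..int N}. f (1 + 6 * n)))"
      by simp
    also note Suc.IH
    also note fp
    also note fm[OF zero_less_Suc]
    finally show ?case by (simp add: algebra_simps)
  qed
  have "(\<lambda>N. ee \<tau> * (\<Sum>k\<le>N. if k = 0 then 1 else (-1) ^ k * (q ^ (k^2 + triangle (k - 1)) + q ^ (k^2 + triangle k)))) \<longlonglongrightarrow> ee \<tau> * phi q"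
    using phi_pentagonal[of q] ee_upper[OF z] by (intro tendsto_intros) (simp add: q_def)
  from LIMSEQ_unique[OF lim[unfolded sums] this] show ?thesis by (simp add: \<tau>_def q_def)
qed

lemma eta_nonzero: "z \<in> upper \<Longrightarrow> eta z \<noteq> 0"
  using eta_eq_phi phi_nonzero ee_upper by simp

section \<open>Sums over residue classes and the Legendre symbol\<close>

lemma dvd_residue_zero: "(l::int) dvd t \<Longrightarrow> 0 \<le> t \<Longrightarrow> t < l \<Longrightarrow> t = 0"
  by (simp add: dvd_eq_mod_eq_0)

lemma sum_residues_affine:
  fixes f :: "int \<Rightarrow> complex"
  assumes N: "N > 0" "coprime u N" and per: "\<And>n. f (n + N) = f n"
  shows "(\<Sum>t\<in>{0..<N}. f (u * t + v)) = (\<Sum>t\<in>{0..<N}. f t)"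
proof -
  let ?h = "\<lambda>t. (u * t + v) mod N"
  have inj: "inj_on ?h {0..<N}"
  proof (rule inj_onI)
    fix a b assume ab: "a \<in> {0..<N}" "b \<in> {0..<N}" "?h a = ?h b"
    hence "[u * a + v = u * b + v] (mod N)" by (simp add: cong_def)
    hence "[u * a = u * b] (mod N)" by (simp add: cong_add_rcancel)
    hence "[a = b] (mod N)" using N(2) by (simp add: cong_mult_lcancel)
    thus "a = b" using ab by (simp add: cong_def)
  qed
  have img: "?h ` {0..<N} = {0..<N}"
    by (rule card_subset_eq) (use N card_image[OF inj] in auto)
  have "(\<Sum>t\<in>{0..<N}. f t) = (\<Sum>t\<in>{0..<N}. f (?h t))"
    using sum.reindex[OF inj, of f] unfolding img by simp
  also have "\<dots> = (\<Sum>t\<in>{0..<N}. f (u * t + v))" by (simp add: periodic_int_mod[of f, OF per])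
  finally show ?thesis ..
qed

lemma ee_frac_cong:
  assumes "[x = y] (mod N)" "N > 0"
  shows "ee (of_int x / of_int N) = ee (of_int y / of_int N)"
proof -
  obtain j where "y = x + N * j" using assms(1) by (metis cong_iff_lin)
  hence "of_int y / of_int N = of_int x / (of_int N :: complex) + of_int j" using assms(2) by (simp add: field_simps)
  thus ?thesis by simp
qed

lemma sum_ee_frac:
  assumes N: "N > 0"
  shows "(\<Sum>t\<in>{0..<N}. ee (of_int (x * t) / of_int N)) = (if N dvd x then of_int N else 0)"
proof (cases "N dvd x")
  case True
  have "ee (of_int (x * t) / of_int N) = 1" for t
    using ee_frac_cong[of "x * t" 0 N] True N by (simp add: cong_0_iff)
  thus ?thesis using True N by simp
next
  case False
  let ?f = "\<lambda>t. ee (of_int (x * t) / of_int N)"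
  have per: "?f (t + N) = ?f t" for t
    by (rule ee_frac_cong) (use N in \<open>auto simp: cong_def algebra_simps\<close>)
  have "(\<Sum>t\<in>{0..<N}. ?f t) = (\<Sum>t\<in>{0..<N}. ?f (1 * t + 1))"
    by (rule sum_residues_affine[OF N, symmetric]) (use per in auto)
  also have "\<dots> = ?f 1 * (\<Sum>t\<in>{0..<N}. ?f t)"
    unfolding sum_distrib_left by (intro sum.cong refl) (simp add: ee_add[symmetric] algebra_simps add_divide_distrib)
  finally have "(?f 1 - 1) * (\<Sum>t\<in>{0..<N}. ?f t) = 0" by (simp add: algebra_simps)
  moreover have "?f 1 \<noteq> 1"
  proof
    assume "?f 1 = 1"
    then obtain j where "of_int x / of_int N = (of_int j :: complex)" using ee_eq_1_iff by auto
    hence "of_int x = (of_int (j * N) :: complex)" using N by (simp add: field_simps)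
    hence "x = j * N" by (simp only: of_int_eq_iff)
    thus False using False by simp
  qed
  ultimately show ?thesis using False by simp
qed

lemma sum_residues_split:
  fixes f :: "int \<Rightarrow> complex"
  assumes "N > 0" "M > 0"
  shows "(\<Sum>t\<in>{0..<N * M}. f t) = (\<Sum>a\<in>{0..<N}. \<Sum>b\<in>{0..<M}. f (a + N * b))"
proof -
  let ?h = "\<lambda>(a,b). a + N * b"
  have "bij_betw ?h ({0..<N} \<times> {0..<M}) {0..<N * M}"
  proof (rule bij_betw_byWitness[where f' = "\<lambda>t. (t mod N, t div N)"])
    show "?h ` ({0..<N} \<times> {0..<M}) \<subseteq> {0..<N * M}"
    proof clarify
      fix a b assume ab: "a \<in> {0..<N}" "b \<in> {0..<M}"
      have "N * b \<le> N * (M - 1)" using ab assms by (intro mult_left_mono) auto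
      thus "a + N * b \<in> {0..<N * M}" using ab assms by (auto simp: algebra_simps)
    qed
    show "(\<lambda>t. (t mod N, t div N)) ` {0..<N * M} \<subseteq> {0..<N} \<times> {0..<M}"
    proof clarify
      fix t assume t: "t \<in> {0..<N * M}"
      have "N * (t div N) \<le> t" using mult_div_mod_eq[of N t] pos_mod_sign[of N t] assms by linarith
      hence "N * (t div N) < N * M" using t by simp
      hence "t div N < M" using assms by simp
      thus "t mod N \<in> {0..<N} \<and> t div N \<in> {0..<M}" using t assms by (auto simp: pos_imp_zdiv_nonneg_iff)
    qed
  qed (use assms in auto)
  hence "(\<Sum>t\<in>{0..<N * M}. f t) = (\<Sum>ab\<in>{0..<N} \<times> {0..<M}. f (?h ab))" by (rule sum.reindex_bij_betw[symmetric])
  thus ?thesis by (simp add: sum.cartesian_product case_prod_unfold)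
qed

lemma Legendre_cong: "[a = b] (mod p) \<Longrightarrow> Legendre a p = Legendre b p"
  unfolding Legendre_def QuadRes_def by (simp add: cong_def)

lemma Legendre_square_mult:
  assumes "prime p" "\<not> p dvd u"
  shows "Legendre (a * u^2) p = Legendre a p"
proof -
  have cop: "coprime u p" using assms by (metis coprime_commute prime_imp_coprime)
  obtain w where w: "[u * w = 1] (mod p)" using cong_solve_coprime_int[OF cop] by auto
  have 0: "[a * u^2 = 0] (mod p) \<longleftrightarrow> [a = 0] (mod p)"
    using cop by (simp add: cong_0_iff coprime_commute coprime_dvd_mult_left_iff)
  have "QuadRes p (a * u^2) \<longleftrightarrow> QuadRes p a"
  proof
    assume "QuadRes p a"
    then obtain y where "[y^2 = a] (mod p)" by (auto simp: QuadRes_def)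
    hence "[(y * u)^2 = a * u^2] (mod p)" by (simp add: power_mult_distrib cong_scalar_right)
    thus "QuadRes p (a * u^2)" unfolding QuadRes_def ..
  next
    assume "QuadRes p (a * u^2)"
    then obtain y where y: "[y^2 = a * u^2] (mod p)" by (auto simp: QuadRes_def)
    have "[(y * w)^2 = a * (u * w)^2] (mod p)"
      using cong_scalar_right[OF y, of "w^2"] by (simp add: power_mult_distrib mult_ac)
    moreover have "[a * (u * w)^2 = a * 1^2] (mod p)" using w by (intro cong_mult cong_refl cong_pow)
    ultimately have "[(y * w)^2 = a] (mod p)" using cong_trans by fastforce
    thus "QuadRes p a" unfolding QuadRes_def ..
  qed
  thus ?thesis unfolding Legendre_def using 0 by simp
qed

text \<open>By Euler's criterion both sides agree modulo \<open>p\<close>, and as they lie in {-1,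
  0, 1} they differ by at most 2, which is less than \<open>p\<close>.\<close>

lemma Legendre_mult:
  assumes p: "prime (p::int)" "p > 2"
  shows "Legendre (a * b) p = Legendre a p * Legendre b p"
proof -
  have P: "prime (nat p)" "2 < nat p" "int (nat p) = p" 
    using conjunct2[OF prime_int_nat_transfer[THEN iffD1, OF p(1)]] p(2) by simp_all
  have eu: "[Legendre x p = x ^ ((nat p - 1) div 2)] (mod p)" for x
    using euler_criterion[OF P(1,2), of x] P(3) by simp
  have "[Legendre (a * b) p = Legendre a p * Legendre b p] (mod p)"
    using eu[of "a * b"] cong_mult[OF eu[of a] eu[of b]]
    by (metis cong_sym cong_trans power_mult_distrib)
  hence "p dvd Legendre (a * b) p - Legendre a p * Legendre b p" by (simp add: cong_iff_dvd_diff)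
  moreover
  have L3: "Legendre x p = -1 \<or> Legendre x p = 0 \<or> Legendre x p = 1" for x by (simp add: Legendre_def)
  have "\<bar>Legendre (a * b) p - Legendre a p * Legendre b p\<bar> < p"
    using p(2) L3[of a] L3[of b] L3[of "a * b"] by (elim disjE) simp_all
  ultimately show ?thesis using dvd_residue_zero[of p "\<bar>Legendre (a * b) p - Legendre a p * Legendre b p\<bar>"] by simp
qed

section \<open>Quadratic Gauss sums\<close>

definition gauss_sum :: "int \<Rightarrow> int \<Rightarrow> complex" where
  "gauss_sum l y = (\<Sum>t\<in>{0..<l}. ee (of_int (y * t^2) / of_int l))"

lemma card_square_roots:
  assumes l: "prime l" "l > 2" and x: "x \<in> {0..<l}"
  shows "int (card {t\<in>{0..<l}. [t^2 = x] (mod l)}) = 1 + Legendre x l"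
proof (cases "x = 0")
  case True
  have "{t\<in>{0..<l}. [t^2 = x] (mod l)} = {0}"
    using l True dvd_residue_zero by (auto simp: cong_0_iff prime_dvd_power_iff)
  thus ?thesis using True by (simp add: Legendre_def)
next
  case False
  hence n0: "\<not> [x = 0] (mod l)" using x by (simp add: cong_def)
  show ?thesis
  proof (cases "QuadRes l x")
    case False
    hence "{t\<in>{0..<l}. [t^2 = x] (mod l)} = {}" by (auto simp: QuadRes_def)
    hence "card {t\<in>{0..<l}. [t^2 = x] (mod l)} = 0" by (simp only: card.empty)
    thus ?thesis using False n0 by (simp add: Legendre_def)
  next
    case True
    then obtain y where y: "[y^2 = x] (mod l)" by (auto simp: QuadRes_def)
    define t0 where "t0 = y mod l"
    have t0: "[t0^2 = x] (mod l)" "t0 \<in> {0..<l}" using y l by (auto simp: t0_def cong_def power_mod)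
    have t00: "t0 \<noteq> 0" using t0 n0 by (metis cong_sym zero_power2)
    have "{t\<in>{0..<l}. [t^2 = x] (mod l)} = {t0, l - t0}"
    proof (intro Set.set_eqI iffI)
      fix t assume "t \<in> {t\<in>{0..<l}. [t^2 = x] (mod l)}"
      hence t: "t \<in> {0..<l}" "[t^2 = x] (mod l)" by auto
      have "[t^2 = t0^2] (mod l)" using t t0 cong_sym cong_trans by blast
      hence "l dvd (t - t0) * (t + t0)" by (simp add: cong_iff_dvd_diff power2_eq_square algebra_simps)
      hence "l dvd t - t0 \<or> l dvd t + t0" using l(1) by (simp add: prime_dvd_mult_iff)
      thus "t \<in> {t0, l - t0}"
      proof
        assume "l dvd t - t0"
        hence "[t = t0] (mod l)" by (simp add: cong_iff_dvd_diff)
        thus ?thesis using t t0 by (simp add: cong_def)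
      next
        assume "l dvd t + t0"
        then obtain j where j: "t + t0 = l * j" by blast
        have "0 < l * j" "l * j < l * 2" unfolding j[symmetric] using t t0 t00 by auto
        hence "0 < j" "j < 2" using l(2) by (auto simp: zero_less_mult_iff)
        hence "j = 1" by simp
        thus ?thesis using j t by simp
      qed
    next
      fix t assume t: "t \<in> {t0, l - t0}"
      have "(l - t0)^2 = t0^2 + l * (l - 2 * t0)" by (simp add: power2_eq_square algebra_simps)
      hence "[(l - t0)^2 = t0^2] (mod l)" by (simp add: cong_def)
      hence "[(l - t0)^2 = x] (mod l)" using t0 cong_trans by blast
      thus "t \<in> {t\<in>{0..<l}. [t^2 = x] (mod l)}" using t t0 t00 by auto
    qed
    moreover have "t0 \<noteq> l - t0"
    proof
      assume "t0 = l - t0"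
      hence "2 * t0 = l" by simp
      hence "2 dvd l" by (metis dvd_triv_left)
      thus False using l primes_dvd_imp_eq[of 2 l] by simp
    qed
    ultimately show ?thesis using n0 True by (simp add: Legendre_def)
  qed
qed

text \<open>A residue \<open>x\<close> has \<open>1 + Legendre x l\<close> square roots, so grouping
  the arguments by their squares separates a plain sum from a character sum.\<close>

lemma sum_squares_Legendre:
  fixes f :: "int \<Rightarrow> complex"
  assumes l: "prime l" "l > 2" and per: "\<And>n. f (n + l) = f n"
  shows "(\<Sum>t\<in>{0..<l}. f (t^2)) = (\<Sum>x\<in>{0..<l}. (1 + of_int (Legendre x l)) * f x)"
proof -
  have "(\<Sum>t\<in>{0..<l}. f (t^2)) = (\<Sum>t\<in>{0..<l}. f (t^2 mod l))" by (simp add: periodic_int_mod[of f, OF per])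
  also have "\<dots> = (\<Sum>x\<in>{0..<l}. \<Sum>t\<in>{t\<in>{0..<l}. t^2 mod l = x}. f (t^2 mod l))"
    by (rule sum.group[symmetric]) (use l in auto)
  also have "\<dots> = (\<Sum>x\<in>{0..<l}. (1 + of_int (Legendre x l)) * f x)"
  proof (rule sum.cong[OF refl])
    fix x assume x: "x \<in> {0..<l}"
    have "{t\<in>{0..<l}. t^2 mod l = x} = {t\<in>{0..<l}. [t^2 = x] (mod l)}" using x by (auto simp: cong_def)
    hence card: "int (card {t\<in>{0..<l}. t^2 mod l = x}) = 1 + Legendre x l" using card_square_roots[OF l x] by simp
    have "(\<Sum>t\<in>{t\<in>{0..<l}. t^2 mod l = x}. f (t^2 mod l)) = (\<Sum>t\<in>{t\<in>{0..<l}. t^2 mod l = x}. f x)"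
      by (intro sum.cong) auto
    also have "\<dots> = of_int (int (card {t\<in>{0..<l}. t^2 mod l = x})) * f x" by simp
    finally show "(\<Sum>t\<in>{t\<in>{0..<l}. t^2 mod l = x}. f (t^2 mod l)) = (1 + of_int (Legendre x l)) * f x"
      unfolding card by simp
  qed
  finally show ?thesis .
qed

text \<open>If \<open>l\<close> does not divide \<open>n\<close>, substitute \<open>n * x\<close>
  for \<open>x\<close>. Otherwise the exponential is trivial, and the symbols sum to 0 because
  \<open>gauss_sum l 0 = l\<close>.\<close>

lemma sum_Legendre_ee:
  assumes l: "prime l" "l > 2"
  shows "(\<Sum>x\<in>{0..<l}. of_int (Legendre x l) * ee (of_int (n * x) / of_int l)) = of_int (Legendre n l) * gauss_sum l 1"
proof -
  have lpos: "l > 0" using l by simp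
  have per: "ee (of_int (y * (x + l)) / of_int l) = ee (of_int (y * x) / of_int l)" for x y
    by (rule ee_frac_cong) (use lpos in \<open>auto simp: cong_def algebra_simps\<close>)
  have gs: "gauss_sum l y = (\<Sum>x\<in>{0..<l}. ee (of_int (y * x) / of_int l)) + (\<Sum>x\<in>{0..<l}. of_int (Legendre x l) * ee (of_int (y * x) / of_int l))" for y
    unfolding gauss_sum_def
    using sum_squares_Legendre[OF l, of "\<lambda>x. ee (of_int (y * x) / of_int l)", OF per]
    by (simp add: algebra_simps sum.distrib)
  show ?thesis
  proof (cases "l dvd n")
    case True
    have "ee (of_int (n * x) / of_int l) = 1" for x
      using ee_frac_cong[of "n * x" 0 l] True lpos by (simp add: cong_0_iff)
    moreover have "gauss_sum l 0 = of_int l" using lpos by (simp add: gauss_sum_def)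
    hence "(\<Sum>x\<in>{0..<l}. of_int (Legendre x l)) = (0 :: complex)" using gs[of 0] lpos by simp
    moreover have "Legendre n l = 0" using True by (simp add: Legendre_def cong_0_iff)
    ultimately show ?thesis by simp
  next
    case False
    let ?f = "\<lambda>x. of_int (Legendre x l) * ee (of_int x / of_int l)"
    have fper: "?f (x + l) = ?f x" for x
      using Legendre_cong[of "x + l" x l] per[of 1 x] by (simp add: cong_def)
    have "gauss_sum l 1 = (\<Sum>x\<in>{0..<l}. ?f x)"
      using gs[of 1] sum_ee_frac[OF lpos, of 1] l by (simp add: zdvd1_eq)
    also have "\<dots> = (\<Sum>x\<in>{0..<l}. ?f (n * x + 0))"
      by (rule sum_residues_affine[OF lpos, symmetric])
         (use False l fper in \<open>auto simp: coprime_commute prime_imp_coprime\<close>)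
    also have "\<dots> = of_int (Legendre n l) * (\<Sum>x\<in>{0..<l}. of_int (Legendre x l) * ee (of_int (n * x) / of_int l))"
      by (simp add: Legendre_mult[OF l] sum_distrib_left mult_ac)
    finally have "of_int (Legendre n l) * gauss_sum l 1 = of_int (Legendre n l * Legendre n l) * (\<Sum>x\<in>{0..<l}. of_int (Legendre x l) * ee (of_int (n * x) / of_int l))"
      by simp
    moreover have "Legendre n l * Legendre n l = 1" using False by (simp add: Legendre_def cong_0_iff)
    ultimately show ?thesis by simp
  qed
qed

lemma gauss_sum_Legendre:
  assumes l: "prime l" "l > 2" and y: "\<not> l dvd y"
  shows "gauss_sum l y = of_int (Legendre y l) * gauss_sum l 1"
proof -
  have lpos: "l > 0" using l by simp
  have per: "ee (of_int (y * (x + l)) / of_int l) = ee (of_int (y * x) / of_int l)" for x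
    by (rule ee_frac_cong) (use lpos in \<open>auto simp: cong_def algebra_simps\<close>)
  have "gauss_sum l y = (\<Sum>x\<in>{0..<l}. ee (of_int (y * x) / of_int l)) + (\<Sum>x\<in>{0..<l}. of_int (Legendre x l) * ee (of_int (y * x) / of_int l))"
    unfolding gauss_sum_def
    using sum_squares_Legendre[OF l, of "\<lambda>x. ee (of_int (y * x) / of_int l)", OF per]
    by (simp add: algebra_simps sum.distrib)
  thus ?thesis using sum_ee_frac[OF lpos, of y] y sum_Legendre_ee[OF l, of y] by simp
qed

text \<open>With \<open>s = u + t\<close> the exponent \<open>y * s^2 - y * t^2\<close> becomes
  linear in \<open>t\<close>, and the sum over \<open>t\<close> annihilates every \<open>u\<close>
  except 0.\<close>

lemma gauss_sum_mult_minus: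
  assumes l: "prime l" "l > 2" and y: "\<not> l dvd y"
  shows "gauss_sum l y * gauss_sum l (- y) = of_int l"
proof -
  have lpos: "l > 0" using l by simp
  have "gauss_sum l y * gauss_sum l (- y) = (\<Sum>t\<in>{0..<l}. \<Sum>s\<in>{0..<l}. ee (of_int (y * s^2) / of_int l) * ee (of_int (- y * t^2) / of_int l))"
    unfolding gauss_sum_def sum_product by (rule sum.swap)
  also have "\<dots> = (\<Sum>t\<in>{0..<l}. \<Sum>u\<in>{0..<l}. ee (of_int (y * u^2) / of_int l) * ee (of_int (2 * y * u * t) / of_int l))"
  proof (rule sum.cong[OF refl])
    fix t
    let ?f = "\<lambda>s. ee (of_int (y * s^2) / of_int l) * ee (of_int (- y * t^2) / of_int l)"
    have per: "?f (s + l) = ?f s" for s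
    proof -
      have "y * (s + l)^2 = y * s^2 + l * (y * (2 * s + l))" by (simp add: power2_eq_square algebra_simps)
      hence "[y * (s + l)^2 = y * s^2] (mod l)" by (simp add: cong_def)
      from ee_frac_cong[OF this lpos] show ?thesis by simp
    qed
    have "(\<Sum>s\<in>{0..<l}. ?f s) = (\<Sum>u\<in>{0..<l}. ?f (1 * u + t))"
      by (rule sum_residues_affine[OF lpos, symmetric]) (use per in auto)
    also have "\<dots> = (\<Sum>u\<in>{0..<l}. ee (of_int (y * u^2) / of_int l) * ee (of_int (2 * y * u * t) / of_int l))"
      unfolding ee_add[symmetric] add_divide_distrib[symmetric] of_int_add[symmetric]
      by (intro sum.cong arg_cong[of _ _ "\<lambda>x. ee (of_int x / _)"] refl) (simp add: power2_eq_square algebra_simps)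
    finally show "(\<Sum>s\<in>{0..<l}. ?f s) = (\<Sum>u\<in>{0..<l}. ee (of_int (y * u^2) / of_int l) * ee (of_int (2 * y * u * t) / of_int l))" .
  qed
  also have "\<dots> = (\<Sum>u\<in>{0..<l}. ee (of_int (y * u^2) / of_int l) * (\<Sum>t\<in>{0..<l}. ee (of_int (2 * y * u * t) / of_int l)))"
    unfolding sum_distrib_left by (rule sum.swap)
  also have "\<dots> = (\<Sum>u\<in>{0..<l}. if u = 0 then of_int l else 0)"
  proof (rule sum.cong[OF refl])
    fix u assume u: "u \<in> {0..<l}"
    have "l dvd 2 * y * u \<longleftrightarrow> u = 0"
    proof
      assume "l dvd 2 * y * u"
      hence "l dvd 2 \<or> l dvd y \<or> l dvd u" using l(1) by (simp add: prime_dvd_mult_iff)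
      thus "u = 0" using y u l(2) zdvd_not_zless[of u l] zdvd_imp_le[of l 2] by force
    qed simp
    thus "ee (of_int (y * u^2) / of_int l) * (\<Sum>t\<in>{0..<l}. ee (of_int (2 * y * u * t) / of_int l)) = (if u = 0 then of_int l else 0)"
      unfolding sum_ee_frac[OF lpos] by simp
  qed
  also have "\<dots> = of_int l" using lpos by simp
  finally show ?thesis .
qed

text \<open>Enters through \<open>mid_const\<close>, where the Gauss sum carries the even exponent
  \<open>1 - (r + s)\<close>.\<close>

lemma gauss_sum_square:
  assumes l: "prime l" "l > 2"
  shows "gauss_sum l 1 ^ 2 = of_int (Legendre (- 1) l) * of_int l"
proof -
  have n1: "\<not> l dvd 1" "\<not> l dvd -1" using l by auto
  have "gauss_sum l 1 * (of_int (Legendre (- 1) l) * gauss_sum l 1) = of_int l"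
    using gauss_sum_mult_minus[OF l n1(1)] gauss_sum_Legendre[OF l n1(2)] by simp
  moreover have "Legendre (- 1) l * Legendre (- 1) l = 1" using n1 by (simp add: Legendre_def cong_0_iff)
  hence "of_int (Legendre (- 1) l) * of_int (Legendre (- 1) l) = (1 :: complex)" by (metis of_int_1 of_int_mult)
  ultimately show ?thesis by (simp add: power2_eq_square) (metis mult.left_commute mult.right_neutral mult.assoc)
qed

lemma gauss_sum_nonzero:
  assumes "prime l" "l > 2" "\<not> l dvd y"
  shows "gauss_sum l y \<noteq> 0"
  using gauss_sum_mult_minus[OF assms] assms(2) by auto

lemma sum_residue_unique:
  fixes f :: "int \<Rightarrow> complex"
  assumes N: "N > 0" and per: "\<And>n. f (n + N) = f n" and P: "\<And>a. P a \<longleftrightarrow> [a = y] (mod N)"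
  shows "(\<Sum>a\<in>{0..<N}. if P a then f a else 0) = f y"
proof -
  have "(\<Sum>a\<in>{0..<N}. if P a then f a else 0) = (\<Sum>a\<in>{0..<N}. if a = y mod N then f a else 0)"
    using N by (intro sum.cong refl) (auto simp: P cong_def)
  also have "\<dots> = f (y mod N)" using N by simp
  finally show ?thesis by (simp add: periodic_int_mod[of f, OF per])
qed

lemma infsum_multiples:
  fixes f :: "int \<Rightarrow> complex"
  assumes "N \<noteq> 0"
  shows "(\<Sum>\<^sub>\<infinity>m. if N dvd m then f m else 0) = (\<Sum>\<^sub>\<infinity>n. f (N * n))"
proof -
  have "(\<Sum>\<^sub>\<infinity>m. if N dvd m then f m else 0) = (\<Sum>\<^sub>\<infinity>m\<in>range ((*) N). f m)"
    by (rule infsum_cong_neutral) auto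
  also have "\<dots> = (\<Sum>\<^sub>\<infinity>n. f (N * n))"
    using assms by (subst infsum_reindex) (auto simp: inj_on_def o_def)
  finally show ?thesis .
qed

lemma gauss_sum_cong: "l > 0 \<Longrightarrow> [x = y] (mod l) \<Longrightarrow> gauss_sum l x = gauss_sum l y"
  unfolding gauss_sum_def by (intro sum.cong refl ee_frac_cong cong_mult cong_refl)

lemma gauss_sum_mult_square:
  assumes "l > 0" "coprime b l"
  shows "gauss_sum l (y * b^2) = gauss_sum l y"
proof -
  let ?f = "\<lambda>t. ee (of_int (y * t^2) / of_int l)"
  have per: "?f (t + l) = ?f t" for t
  proof (rule ee_frac_cong)
    have "y * (t + l)^2 = y * t^2 + l * (y * (2 * t + l))" by (simp add: power2_eq_square algebra_simps)
    thus "[y * (t + l)^2 = y * t^2] (mod l)" by (simp add: cong_def)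
  qed (use assms in auto)
  have "gauss_sum l (y * b^2) = (\<Sum>t\<in>{0..<l}. ?f (b * t + 0))" by (simp add: gauss_sum_def power_mult_distrib mult_ac)
  also have "\<dots> = gauss_sum l y" unfolding gauss_sum_def by (rule sum_residues_affine) (use assms per in auto)
  finally show ?thesis .
qed

lemma ee_square_periodic:
  assumes "N > 0"
  shows "ee (of_int (x * (t + N)^2) / of_int N) = ee (of_int (x * t^2) / of_int N)"
proof (rule ee_frac_cong)
  have "x * (t + N)^2 = x * t^2 + N * (x * (2 * t + N))" by (simp add: power2_eq_square algebra_simps)
  thus "[x * (t + N)^2 = x * t^2] (mod N)" by (simp add: cong_def)
qed (use assms in auto)

lemma dvd_inverse_iff:
  fixes c c' t m N :: int
  assumes "[c * c' = 1] (mod N)"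
  shows "N dvd c * t - m \<longleftrightarrow> [t = c' * m] (mod N)"
proof -
  have N: "N dvd c * c' - 1" using assms by (simp add: cong_iff_dvd_diff)
  have 1: "t - c' * m = c' * (c * t - m) - (c * c' - 1) * t"
    and 2: "c * t - m = c * (t - c' * m) + (c * c' - 1) * m" by (simp_all add: algebra_simps)
  show ?thesis unfolding cong_iff_dvd_diff
    using N dvd_diff[OF dvd_mult dvd_mult2, of N "c * t - m" "c * c' - 1" c' t, folded 1]
      dvd_add[OF dvd_mult dvd_mult2, of N "t - c' * m" "c * c' - 1" c m, folded 2] by blast
qed

section \<open>The conjugates of the quotient eta(l^2 z)/eta(z)\<close>

text \<open>\<open>k\<close> is the order of eta(l^2 z)/eta(z) at infinity. Also \<open>- k\<close>
  is the inverse of 24 modulo \<open>l^2\<close>, which turns the fractions m^2 / 24 into an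
  integral quadratic form.\<close>

locale weil =
  fixes l k :: int
  assumes prime_l: "prime l" and l_gt: "l > 3" and lk: "l^2 = 1 + 24 * k"
begin

abbreviation L :: int where "L \<equiv> l^2"

definition eL :: "int \<Rightarrow> complex" where "eL x = ee (of_int x / of_int L)"

definition GL :: "int \<Rightarrow> complex" where "GL x = (\<Sum>t\<in>{0..<L}. eL (x * t^2))"

text \<open>The function attached to $(c,d)$ is, up to a constant, the image of $m \mapsto [\ell^2 \mid m]$,
  which belongs to $(0,1)$, under the Weil representation of the quadratic form $-k m^2$ on the integers modulo
  $\ell^2$; the factor in \<open>Psi\<close> removes the multiplier.\<close>

definition W :: "int \<Rightarrow> int \<Rightarrow> int \<Rightarrow> complex" where
  "W c d m = (\<Sum>t\<in>{0..<L}. if L dvd c * t - m then eL (- k * c * d * t^2) else 0)"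

definition Psi :: "int \<Rightarrow> int \<Rightarrow> int \<Rightarrow> complex" where
  "Psi c d m = (if l dvd c then of_int l / GL (- k * c * d) else 1) * W c d m"

definition R :: "int \<Rightarrow> int \<Rightarrow> complex \<Rightarrow> complex" where
  "R c d z = weil_theta L (Psi c d) z / eta z"

lemma l_pos: "l > 0" and l_gt2: "l > 2" and L_pos: "L > 0" and k_nonneg: "k \<ge> 0"
  using l_gt lk zero_less_power[of l 2] by auto

lemma L_not_dvd_k: "\<not> l dvd k"
proof
  assume "l dvd k"
  moreover have "l dvd l^2" by simp
  ultimately have "l dvd l^2 - 24 * k" by (intro dvd_diff dvd_mult) auto
  hence "l dvd 1" using lk by simp
  thus False using l_gt by simp
qed

lemma coprime_l: "coprime x l \<longleftrightarrow> \<not> l dvd x" "coprime x L \<longleftrightarrow> \<not> l dvd x"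
  using prime_l by (auto simp: coprime_commute prime_imp_coprime dest: coprime_common_divisor)
    (metis not_prime_unit coprime_common_divisor dvd_refl coprime_commute)+

lemma obtain_inverse:
  assumes "\<not> l dvd x"
  obtains y where "[x * y = 1] (mod L)"
  using cong_solve_coprime_int[of x L] assms coprime_l(2) by blast

lemma eL_cong: "[x = y] (mod L) \<Longrightarrow> eL x = eL y"
  unfolding eL_def by (rule ee_frac_cong[OF _ L_pos])

lemma eL_add: "eL (x + y) = eL x * eL y"
  by (simp add: eL_def add_divide_distrib ee_add)

lemma eL_0 [simp]: "eL 0 = 1" by (simp add: eL_def)

lemma eL_square_periodic: "eL (x * (t + L)^2) = eL (x * t^2)"
  unfolding eL_def by (rule ee_square_periodic[OF L_pos])

lemma GL_cong: "[x = y] (mod L) \<Longrightarrow> GL x = GL y"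
  unfolding GL_def by (intro sum.cong refl eL_cong cong_mult cong_refl)

lemma GL_square_mult:
  assumes "\<not> l dvd u"
  shows "GL (x * u^2) = GL x"
proof -
  have "GL (x * u^2) = (\<Sum>t\<in>{0..<L}. eL (x * (u * t + 0)^2))" by (simp add: GL_def power_mult_distrib mult_ac)
  also have "\<dots> = GL x" unfolding GL_def
    by (rule sum_residues_affine[OF L_pos]) (use assms coprime_l eL_square_periodic in auto)
  finally show ?thesis .
qed

text \<open>Writing \<open>t = a + l * b\<close> makes the exponent linear in \<open>b\<close>
  modulo \<open>L\<close>, so the sum over \<open>b\<close> vanishes unless \<open>a = 0\<close>.
  This is why no normalizing factor is needed when \<open>c\<close> is a unit.\<close>

lemma GL_unit:
  assumes "\<not> l dvd x"
  shows "GL x = of_int l"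
proof -
  have "GL x = (\<Sum>t\<in>{0..<l * l}. eL (x * t^2))" by (simp add: GL_def power2_eq_square)
  also have "\<dots> = (\<Sum>a\<in>{0..<l}. \<Sum>b\<in>{0..<l}. eL (x * (a + l * b)^2))"
    by (rule sum_residues_split[OF l_pos l_pos])
  also have "\<dots> = (\<Sum>a\<in>{0..<l}. if a = 0 then of_int l else 0)"
  proof (rule sum.cong[OF refl])
    fix a assume a: "a \<in> {0..<l}"
    have "eL (x * (a + l * b)^2) = eL (x * a^2) * ee (of_int ((2 * x * a) * b) / of_int l)" for b
    proof -
      have "x * (a + l * b)^2 = x * a^2 + l * ((2 * x * a) * b) + L * (x * b^2)"
        by (simp add: power2_eq_square algebra_simps)
      hence "[x * (a + l * b)^2 = x * a^2 + l * ((2 * x * a) * b)] (mod L)" by (simp add: cong_def)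
      hence "eL (x * (a + l * b)^2) = eL (x * a^2) * eL (l * ((2 * x * a) * b))" by (simp only: eL_cong eL_add)
      also have "eL (l * ((2 * x * a) * b)) = ee (of_int ((2 * x * a) * b) / of_int l)"
        using l_pos by (simp add: eL_def power2_eq_square)
      finally show ?thesis .
    qed
    hence "(\<Sum>b\<in>{0..<l}. eL (x * (a + l * b)^2)) = eL (x * a^2) * (if l dvd 2 * x * a then of_int l else 0)"
      by (simp only: sum_distrib_left[symmetric] sum_ee_frac[OF l_pos])
    moreover have "l dvd 2 * x * a \<longleftrightarrow> a = 0"
    proof
      assume "l dvd 2 * x * a"
      hence "l dvd 2 \<or> l dvd x \<or> l dvd a" using prime_l by (simp add: prime_dvd_mult_iff)
      moreover have "\<not> l dvd 2" using l_gt zdvd_imp_le[of l 2] by auto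
      ultimately show "a = 0" using assms a dvd_residue_zero[of l a] by auto
    qed simp
    ultimately show "(\<Sum>b\<in>{0..<l}. eL (x * (a + l * b)^2)) = (if a = 0 then of_int l else 0)" by simp
  qed
  also have "\<dots> = of_int l" using l_pos by simp
  finally show ?thesis .
qed

lemma sum_periodic_l:
  fixes f :: "int \<Rightarrow> complex"
  assumes "\<And>t. f (t + l) = f t"
  shows "(\<Sum>t\<in>{0..<L}. f t) = of_int l * (\<Sum>t\<in>{0..<l}. f t)"
proof -
  have "(\<Sum>t\<in>{0..<L}. f t) = (\<Sum>a\<in>{0..<l}. \<Sum>b\<in>{0..<l}. f (a + l * b))"
    using sum_residues_split[OF l_pos l_pos, of f] by (simp add: power2_eq_square)
  also have "\<dots> = of_int l * (\<Sum>t\<in>{0..<l}. f t)"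
    using l_pos by (simp add: periodic_int_mult[of f, OF assms] sum_distrib_left)
  finally show ?thesis .
qed

lemma GL_mult_l: "GL (l * y) = of_int l * gauss_sum l y"
proof -
  have "eL (l * y * t^2) = ee (of_int (y * t^2) / of_int l)" for t
    using l_pos by (simp add: eL_def power2_eq_square)
  thus ?thesis unfolding GL_def gauss_sum_def
    by (simp only: sum_periodic_l[of "\<lambda>t. ee (of_int (y * t^2) / of_int l)", OF ee_square_periodic[OF l_pos]])
qed

lemma GL_0: "[x = 0] (mod L) \<Longrightarrow> GL x = of_int L"
  using GL_cong[of x 0] L_pos by (simp add: GL_def)

lemma GL_nonzero: "GL x \<noteq> 0"
proof (cases "l dvd x")
  case True
  then obtain y where y: "x = l * y" by blast
  show ?thesis
  proof (cases "l dvd y")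
    case True
    hence "[x = 0] (mod L)" unfolding y by (simp add: cong_0_iff power2_eq_square)
    thus ?thesis using GL_0 l_pos by simp
  next
    case False
    thus ?thesis unfolding y GL_mult_l using l_pos gauss_sum_nonzero[OF prime_l l_gt2 False] by simp
  qed
next
  case False
  thus ?thesis using GL_unit l_pos by simp
qed

lemma W_periodic: "W c d (m + L) = W c d m"
proof -
  have "L dvd c * t - (m + L) \<longleftrightarrow> L dvd c * t - m" for t
    by (metis diff_diff_add dvd_diff_right_iff dvd_refl dvd_diff dvd_add_right_iff diff_add_cancel)
  thus ?thesis by (simp only: W_def)
qed

lemma Psi_periodic: "Psi c d (m + L) = Psi c d m" by (simp only: Psi_def W_periodic)

lemma W_unit:
  assumes "[c * c' = 1] (mod L)"
  shows "W c d m = eL (- k * d * c' * m^2)"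
proof -
  have "W c d m = eL (- k * c * d * (c' * m)^2)"
    unfolding W_def by (rule sum_residue_unique[of L "\<lambda>t. eL (- k * c * d * t^2)", OF L_pos eL_square_periodic dvd_inverse_iff[OF assms]])
  also have "\<dots> = eL (- k * d * c' * m^2)"
  proof (rule eL_cong)
    have "[(c * c') * (- k * d * c' * m^2) = 1 * (- k * d * c' * m^2)] (mod L)" using assms by (intro cong_mult cong_refl)
    thus "[- k * c * d * (c' * m)^2 = - k * d * c' * m^2] (mod L)" by (simp add: power2_eq_square mult_ac)
  qed
  finally show ?thesis .
qed

text \<open>The Fourier variable is eliminated by solving \<open>12 * a = c * t\<close>; completing
  the square in \<open>t\<close> by the shift \<open>- d' * m\<close> leaves a Gauss sum times the
  exponential that \<open>W_unit\<close> assigns to \<open>(d, - c)\<close>.\<close>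

lemma fhat_W:
  assumes "[d * d' = 1] (mod L)"
  shows "fhat L (W c d) m = GL (- k * c * d) / of_int l * eL (k * c * d' * m^2)"
proof -
  \<comment> \<open>\<open>- 2 * k\<close> inverts 12 modulo \<open>L\<close>, since
    \<open>24 * k = L - 1\<close>.\<close>
  have k12: "[12 * (- 2 * k) = 1] (mod L)" 
  proof -
    have "12 * (- 2 * k) - 1 = - L" using lk by simp
    thus ?thesis by (simp only: cong_iff_dvd_diff dvd_minus_iff dvd_refl)
  qed
  have inner: "(\<Sum>a\<in>{0..<L}. if L dvd c * t - 12 * a then eL (m * a) else 0) = eL (m * (- 2 * k * (c * t)))" for t
  proof (rule sum_residue_unique[OF L_pos])
    show "eL (m * (n + L)) = eL (m * n)" for n by (rule eL_cong) (simp add: cong_def algebra_simps)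
    fix a
    have "L dvd c * t - 12 * a \<longleftrightarrow> L dvd 12 * a - c * t" by (simp add: dvd_diff_commute)
    also have "\<dots> \<longleftrightarrow> [a = - 2 * k * (c * t)] (mod L)" by (rule dvd_inverse_iff[OF k12])
    finally show "L dvd c * t - 12 * a \<longleftrightarrow> [a = - 2 * k * (c * t)] (mod L)" .
  qed
  have "(\<Sum>a\<in>{0..<L}. W c d (12 * a) * ee (of_int (m * a) / of_int L))
      = (\<Sum>a\<in>{0..<L}. \<Sum>t\<in>{0..<L}. if L dvd c * t - 12 * a then eL (- k * c * d * t^2) * eL (m * a) else 0)"
    unfolding W_def sum_distrib_right eL_def[symmetric] by (intro sum.cong refl) simp
  also have "\<dots> = (\<Sum>t\<in>{0..<L}. \<Sum>a\<in>{0..<L}. if L dvd c * t - 12 * a then eL (- k * c * d * t^2) * eL (m * a) else 0)"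
    by (rule sum.swap)
  also have "\<dots> = (\<Sum>t\<in>{0..<L}. eL (- k * c * d * t^2) * eL (m * (- 2 * k * (c * t))))"
  proof (rule sum.cong[OF refl])
    fix t
    have "(\<Sum>a\<in>{0..<L}. if L dvd c * t - 12 * a then eL (- k * c * d * t^2) * eL (m * a) else 0)
      = eL (- k * c * d * t^2) * (\<Sum>a\<in>{0..<L}. if L dvd c * t - 12 * a then eL (m * a) else 0)"
      unfolding sum_distrib_left by (intro sum.cong refl) simp
    thus "(\<Sum>a\<in>{0..<L}. if L dvd c * t - 12 * a then eL (- k * c * d * t^2) * eL (m * a) else 0)
      = eL (- k * c * d * t^2) * eL (m * (- 2 * k * (c * t)))" unfolding inner .
  qed
  also have "\<dots> = (\<Sum>t\<in>{0..<L}. eL (- k * c * d * (1 * t + (- d' * m))^2) * eL (m * (- 2 * k * (c * (1 * t + (- d' * m))))))"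
  proof (rule sum_residues_affine[OF L_pos, symmetric])
    have "eL (m * (- 2 * k * (c * (n + L)))) = eL (m * (- 2 * k * (c * n)))" for n
      by (rule eL_cong) (simp add: cong_iff_dvd_diff algebra_simps)
    thus "eL (- k * c * d * (n + L)^2) * eL (m * (- 2 * k * (c * (n + L)))) = eL (- k * c * d * n^2) * eL (m * (- 2 * k * (c * n)))" for n
      by (simp only: eL_square_periodic)
  qed simp
  also have "\<dots> = (\<Sum>t\<in>{0..<L}. eL (k * c * d' * m^2) * eL (- k * c * d * t^2))"
  proof (intro sum.cong refl, unfold eL_add[symmetric], rule eL_cong)
    fix t
    have "(- k * c * d * (1 * t + (- d' * m))^2 + m * (- 2 * k * (c * (1 * t + (- d' * m))))) - (k * c * d' * m^2 + - k * c * d * t^2)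
       = (d * d' - 1) * (2 * k * c * m * t - k * c * d' * m^2)"
      by (simp add: power2_eq_square algebra_simps)
    moreover have "L dvd d * d' - 1" using assms by (simp add: cong_iff_dvd_diff)
    ultimately show "[- k * c * d * (1 * t + (- d' * m))^2 + m * (- 2 * k * (c * (1 * t + (- d' * m)))) = k * c * d' * m^2 + - k * c * d * t^2] (mod L)"
      unfolding cong_iff_dvd_diff by simp
  qed
  also have "\<dots> = eL (k * c * d' * m^2) * GL (- k * c * d)" by (simp only: sum_distrib_left GL_def)
  moreover have "sqrt (of_int L) = of_int l" using l_pos by simp
  ultimately show ?thesis unfolding fhat_def by (simp add: mult.commute)
qed

lemma fhat_cmult: "fhat N (\<lambda>m. a * \<psi> m) = (\<lambda>m. a * fhat N \<psi> m)"
  by (simp add: fhat_def fun_eq_iff sum_distrib_left mult.assoc)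

text \<open>The Gauss sum in \<open>fhat_W\<close> is cancelled by the factor in \<open>Psi\<close>
  if \<open>l\<close> divides \<open>c\<close>, and equals \<open>l\<close> if \<open>c\<close> is a
  unit. In both cases S acts without any constant.\<close>

lemma fhat_Psi:
  assumes d: "\<not> l dvd d"
  shows "fhat L (Psi c d) = Psi d (- c)"
proof
  fix m
  obtain d' where d': "[d * d' = 1] (mod L)" using obtain_inverse[OF d] .
  define N where "N = (if l dvd c then of_int l / GL (- k * c * d) else 1)"
  have N: "N * (GL (- k * c * d) / of_int l) = 1"
  proof (cases "l dvd c")
    case True
    thus ?thesis using GL_nonzero l_pos by (simp add: N_def)
  next
    case False
    hence "\<not> l dvd - k * c * d" using d prime_l L_not_dvd_k by (simp add: prime_dvd_mult_iff)
    thus ?thesis using GL_unit[of "- k * c * d"] False l_pos by (simp add: N_def)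
  qed
  have "Psi c d = (\<lambda>m. N * W c d m)" by (auto simp: Psi_def N_def)
  hence "fhat L (Psi c d) m = N * fhat L (W c d) m" by (simp only: fhat_cmult)
  also have "\<dots> = N * (GL (- k * c * d) / of_int l) * eL (k * c * d' * m^2)" unfolding fhat_W[OF d'] by simp
  also have "\<dots> = eL (- k * (- c) * d' * m^2)" unfolding N by simp
  also have "\<dots> = Psi d (- c) m" unfolding Psi_def W_unit[OF d'] using d by simp
  finally show "fhat L (Psi c d) m = Psi d (- c) m" .
qed

lemma coprime_L_12: "coprime L 12"
proof (rule coprimeI)
  fix c :: int assume "c dvd L" "c dvd 12"
  hence "c dvd L - 12 * (2 * k)" by (intro dvd_diff dvd_mult2)
  thus "is_unit c" using lk by simp
qed

lemma chi12_L: "chi12 L = 1"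
proof -
  have "(1 + 24 * k) mod 12 = 1" by presburger
  thus ?thesis unfolding lk chi12_def by simp
qed

lemma csqrt_nonzero: "z \<in> upper \<Longrightarrow> csqrt (- \<i> * z) \<noteq> 0"
  using upper_nonzero by auto

text \<open>Follows by substituting \<open>u * t\<close> for \<open>t\<close> in \<open>W\<close>. A
  conjugate thus depends on the pair only up to units; \<open>u = - 1\<close> serves for the square
  of S, and \<open>u = p\<close> for clearing a division by \<open>p\<close>.\<close>

lemma R_scale:
  assumes u: "\<not> l dvd u"
  shows "R (u * c) (u * d) = R c d"
proof -
  have "W (u * c) (u * d) m = W c d m" for m
  proof -
    let ?f = "\<lambda>t. if L dvd c * t - m then eL (- k * c * d * t^2) else 0"
    have per: "?f (t + L) = ?f t" for t
    proof -
      have "c * (t + L) - m = (c * t - m) + L * c" by (simp add: algebra_simps)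
      hence "L dvd c * (t + L) - m \<longleftrightarrow> L dvd c * t - m" by (simp only: dvd_add_times_triv_right_iff mult.commute dvd_add_left_iff dvd_triv_left)
      thus ?thesis by (simp only: eL_square_periodic)
    qed
    have "W (u * c) (u * d) m = (\<Sum>t\<in>{0..<L}. ?f (u * t + 0))"
      unfolding W_def by (intro sum.cong refl) (simp add: power2_eq_square mult_ac)
    also have "\<dots> = W c d m" unfolding W_def
      by (rule sum_residues_affine[OF L_pos]) (use u coprime_l per in auto)
    finally show ?thesis .
  qed
  moreover have "l dvd u * c \<longleftrightarrow> l dvd c" using u prime_l by (simp add: prime_dvd_mult_iff)
  moreover have "GL (- k * (u * c) * (u * d)) = GL (- k * c * d)"
    using GL_square_mult[OF u, of "- k * c * d"] by (simp add: power2_eq_square mult_ac)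
  ultimately have "Psi (u * c) (u * d) = Psi c d" by (simp add: Psi_def fun_eq_iff)
  thus ?thesis by (intro ext) (simp only: R_def)
qed

lemma R_cong:
  assumes "[c = c'] (mod L)" "[d = d'] (mod L)"
  shows "R c d = R c' d'"
proof -
  have dvd: "l dvd c \<longleftrightarrow> l dvd c'"
    using assms(1) by (metis cong_dvd_iff cong_dvd_modulus dvd_triv_left power2_eq_square)
  have "L dvd c * t - m \<longleftrightarrow> L dvd c' * t - m" for t m
  proof -
    have "[c * t - m = c' * t - m] (mod L)" using assms by (intro cong_diff cong_mult cong_refl)
    thus ?thesis by (metis cong_dvd_iff dvd_refl cong_dvd_modulus)
  qed
  moreover have "eL (- k * c * d * t^2) = eL (- k * c' * d' * t^2)" for t
    by (intro eL_cong cong_mult cong_refl assms)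
  moreover have "GL (- k * c * d) = GL (- k * c' * d')" by (intro GL_cong cong_mult cong_refl assms)
  ultimately have "Psi c d = Psi c' d'" unfolding Psi_def W_def dvd by (simp only:)
  thus ?thesis by (intro ext) (simp only: R_def)
qed

text \<open>In \<open>W\<close> the summation forces \<open>m = c * t\<close>, so the factor
  \<open>eL (- k * m^2)\<close> replaces \<open>d\<close> by \<open>c + d\<close> in the exponent.
  If \<open>l\<close> divides \<open>c\<close>, the Gauss sum is unchanged because \<open>L\<close>
  divides \<open>c^2\<close>.\<close>

lemma R_T: "R c d (z + 1) = R c (c + d) z"
proof -
  have "Psi c d m * ee (of_int (- k * m^2) / of_int L) = Psi c (c + d) m" for m
  proof -
    have "W c d m * eL (- k * m^2) = W c (c + d) m"
      unfolding W_def sum_distrib_right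
    proof (rule sum.cong[OF refl])
      fix t
      have "eL (- k * c * d * t^2) * eL (- k * m^2) = eL (- k * c * (c + d) * t^2)" if "L dvd c * t - m"
        unfolding eL_add[symmetric]
      proof (rule eL_cong)
        have "[- k * (c * t)^2 = - k * m^2] (mod L)" using that by (intro cong_mult cong_refl cong_pow) (simp add: cong_iff_dvd_diff)
        hence "[- k * c * d * t^2 + - k * (c * t)^2 = - k * c * d * t^2 + - k * m^2] (mod L)" by (intro cong_add cong_refl)
        thus "[- k * c * d * t^2 + - k * m^2 = - k * c * (c + d) * t^2] (mod L)"
          by (simp add: power2_eq_square algebra_simps cong_sym)
      qed
      thus "(if L dvd c * t - m then eL (- k * c * d * t^2) else 0) * eL (- k * m^2) = (if L dvd c * t - m then eL (- k * c * (c + d) * t^2) else 0)"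
        by simp
    qed
    moreover have "GL (- k * c * d) = GL (- k * c * (c + d))" if "l dvd c"
    proof (rule GL_cong)
      have "L dvd c^2" using that by (simp add: dvd_power_same)
      moreover have "- k * c * d - (- k * c * (c + d)) = k * c^2" by (simp add: power2_eq_square algebra_simps)
      ultimately show "[- k * c * d = - k * c * (c + d)] (mod L)" unfolding cong_iff_dvd_diff by simp
    qed
    ultimately show ?thesis unfolding Psi_def eL_def[symmetric] by (auto simp: mult.assoc)
  qed
  thus ?thesis unfolding R_def weil_theta_T[OF lk k_nonneg] eta_T by simp
qed

lemma R_S_unit:
  assumes "\<not> l dvd d" "z \<in> upper"
  shows "R c d (- 1 / z) = R d (- c) z"
  unfolding R_def weil_theta_S[of L "Psi c d", OF L_pos coprime_L_12 chi12_L Psi_periodic assms(2)] eta_S[OF assms(2)]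
    fhat_Psi[OF assms(1)] using csqrt_nonzero[OF assms(2)] by simp

text \<open>If \<open>l\<close> divides \<open>d\<close>, then \<open>c\<close> is a unit and the
  unit case is applied to \<open>(d, - c)\<close> at \<open>- 1 / z\<close>; applying S twice only
  changes the sign of the pair.\<close>

lemma R_S:
  assumes "\<not> (l dvd c \<and> l dvd d)" "z \<in> upper"
  shows "R c d (- 1 / z) = R d (- c) z"
proof (cases "l dvd d")
  case False
  thus ?thesis using R_S_unit assms by blast
next
  case True
  hence c: "\<not> l dvd - c" using assms by simp
  have "R d (- c) (- 1 / (- 1 / z)) = R (- c) (- d) (- 1 / z)"
    by (rule R_S_unit[OF c upper_S[OF assms(2)]])
  moreover have "- 1 / (- 1 / z) = z" by simp
  moreover have "R (- c) (- d) = R c d" using R_scale[of "- 1" c d] l_gt by simp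
  ultimately show ?thesis by simp
qed

end

section \<open>Generators of the modular group and the transformation laws they imply\<close>

lemma sl2_induct:
  fixes P :: "int \<Rightarrow> int \<Rightarrow> int \<Rightarrow> int \<Rightarrow> bool"
  assumes one: "P 1 0 0 1"
    and S: "\<And>a b c d. P a b c d \<Longrightarrow> P b (- a) d (- c)"
    and T: "\<And>a b c d. P a b c d \<Longrightarrow> P a (a + b) c (c + d)"
    and T': "\<And>a b c d. P a b c d \<Longrightarrow> P a (b - a) c (d - c)"
    and det: "a * d - b * c = 1"
  shows "P a b c d"
proof -
  have Tn: "P a b c d \<Longrightarrow> P a (b + n * a) c (d + n * c)" for a b c d n
  proof (induction n rule: int_induct[of _ 0])
    case (step1 i) thus ?case using T[of a "b + i * a" c "d + i * c"] by (simp add: algebra_simps)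
  next
    case (step2 i) thus ?case using T'[of a "b + i * a" c "d + i * c"] by (simp add: algebra_simps)
  qed simp
  \<comment> \<open>S has order four, so one application of S is undone by three more.\<close>
  have S3: "P b (- a) d (- c) \<Longrightarrow> P a b c d" for a b c d
    using S[of b "- a" d "- c"] S[of "- a" "- b" "- c" "- d"] S[of "- b" a "- d" c] by simp
  show ?thesis using det
  proof (induction "nat \<bar>c\<bar>" arbitrary: a b c d rule: less_induct)
    case less
    show ?case
    proof (cases "c = 0")
      case True
      hence "a * d = 1" using less.prems by simp
      hence "(a = 1 \<and> d = 1) \<or> (a = - 1 \<and> d = - 1)" using zmult_eq_1_iff by blast
      thus ?thesis
      proof
        assume *: "a = 1 \<and> d = 1"
        show ?thesis using Tn[OF one, of b] * True by simp
      next
        assume *: "a = - 1 \<and> d = - 1"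
        have "P (- 1) 0 0 (- 1)" using S[OF S[OF one]] by simp
        from Tn[OF this, of "- b"] show ?thesis using * True by simp
      qed
    next
      case False
      \<comment> \<open>Euclidean algorithm on the bottom row: a power of T reduces \<open>d\<close>
        modulo \<open>c\<close>, then S puts the remainder in the place of \<open>c\<close>.\<close>
      define n where "n = d div c"
      have lt: "\<bar>d - n * c\<bar> < \<bar>c\<bar>" using False abs_mod_less[of c d] by (simp add: n_def minus_div_mult_eq_mod)
      have "P (b - n * a) (- a) (d - n * c) (- c)"
        by (rule less.hyps) (use lt less.prems in \<open>auto simp: algebra_simps\<close>)
      hence "P a (b - n * a) c (d - n * c)" by (rule S3)
      from Tn[OF this, of n] show ?thesis by simp
    qed
  qed
qed

definition mob :: "int \<Rightarrow> int \<Rightarrow> int \<Rightarrow> int \<Rightarrow> complex \<Rightarrow> complex" where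
  "mob a b c d z = (of_int a * z + of_int b) / (of_int c * z + of_int d)"

lemma denom_nonzero:
  assumes "a * d - b * c = (1 :: int)" "z \<in> upper"
  shows "of_int c * z + of_int d \<noteq> 0"
proof
  assume 0: "of_int c * z + of_int d = 0"
  hence "Im (of_int c * z + of_int d) = 0" "Re (of_int c * z + of_int d) = 0" by simp_all
  hence "c = 0" "of_int c * Re z + of_int d = 0" using assms(2) by (auto simp: upper_def)
  hence "c = 0" "d = 0" by auto
  thus False using assms(1) by simp
qed

lemma mob_S: "a * d - b * c = 1 \<Longrightarrow> z \<in> upper \<Longrightarrow> mob b (- a) d (- c) z = mob a b c d (- 1 / z)"
proof -
  assume "z \<in> upper"
  hence nz: "z \<noteq> 0" by (rule upper_nonzero)
  have e: "of_int x * (- 1 / z) + of_int y = (of_int y * z + of_int (- x)) / z" for x y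
    using nz by (simp add: field_simps)
  show ?thesis unfolding mob_def e using nz by simp
qed

text \<open>Equal to (pi i / 12) E_2. Starting from eta, the quasi-modularity of E_2 is obtained by
  differentiating the laws of eta.\<close>

definition eta_logderiv :: "complex \<Rightarrow> complex" where "eta_logderiv z = deriv eta z / eta z"

lemma eta_differentiable: "z \<in> upper \<Longrightarrow> (eta has_field_derivative deriv eta z) (at z)"
  using eta_holomorphic open_upper by (rule holomorphic_derivI)

lemma eta_logderiv_T: "z \<in> upper \<Longrightarrow> eta_logderiv (z + 1) = eta_logderiv z"
proof -
  assume z: "z \<in> upper"
  hence z1: "z + 1 \<in> upper" by (simp add: upper_def)
  have "((\<lambda>z. eta (z + 1)) has_field_derivative deriv eta (z + 1)) (at z)"
    using eta_differentiable[OF z1] by (simp add: DERIV_shift)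
  moreover have "((\<lambda>z. eta (z + 1)) has_field_derivative ee (1 / 24) * deriv eta z) (at z)"
    unfolding eta_T by (intro DERIV_cmult eta_differentiable z)
  ultimately have "deriv eta (z + 1) = ee (1 / 24) * deriv eta z" by (rule DERIV_unique)
  thus ?thesis by (simp add: eta_logderiv_def eta_T)
qed

lemma eta_logderiv_S: "z \<in> upper \<Longrightarrow> eta_logderiv (- 1 / z) = z^2 * eta_logderiv z + z / 2"
proof -
  assume z: "z \<in> upper"
  have nz: "z \<noteq> 0" "eta z \<noteq> 0" "eta (- 1 / z) \<noteq> 0" using z upper_nonzero eta_nonzero upper_S by blast+
  \<comment> \<open>Squaring removes the branch of the square root before differentiation.\<close>
  have sq: "eta (- 1 / w) ^ 2 = - \<i> * w * eta w ^ 2" if "w \<in> upper" for w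
    unfolding eta_S[OF that] power_mult_distrib power2_csqrt ..
  have "((\<lambda>w. eta (- 1 / w) ^ 2) has_field_derivative 2 * eta (- 1 / z) * (deriv eta (- 1 / z) * (1 / z^2))) (at z)"
  proof -
    have "((\<lambda>w. - 1 / w) has_field_derivative 1 / z^2) (at z)"
      using nz by (auto intro!: derivative_eq_intros simp: power2_eq_square field_simps)
    from DERIV_chain2[OF eta_differentiable[OF upper_S[OF z]] this]
    have "((\<lambda>w. eta (- 1 / w)) has_field_derivative deriv eta (- 1 / z) * (1 / z^2)) (at z)" .
    from DERIV_power[OF this, of 2] show ?thesis by (simp add: mult_ac)
  qed
  moreover have "((\<lambda>w. - \<i> * w * eta w ^ 2) has_field_derivative - \<i> * eta z ^ 2 - \<i> * z * (2 * eta z * deriv eta z)) (at z)"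
    using eta_differentiable[OF z] by (auto intro!: derivative_eq_intros)
  hence "((\<lambda>w. eta (- 1 / w) ^ 2) has_field_derivative - \<i> * eta z ^ 2 - \<i> * z * (2 * eta z * deriv eta z)) (at z)"
    by (rule has_field_derivative_transform_within_open[OF _ open_upper z]) (rule sq[symmetric])
  ultimately have "2 * eta (- 1 / z) * (deriv eta (- 1 / z) * (1 / z^2)) = - \<i> * eta z ^ 2 - \<i> * z * (2 * eta z * deriv eta z)"
    by (rule DERIV_unique)
  hence "2 * eta (- 1 / z) * (deriv eta (- 1 / z) * (1 / z^2)) / eta (- 1 / z) ^ 2 = (- \<i> * eta z ^ 2 - \<i> * z * (2 * eta z * deriv eta z)) / (- \<i> * z * eta z ^ 2)"
    unfolding sq[OF z] by simp
  moreover have "2 * eta (- 1 / z) * (deriv eta (- 1 / z) * (1 / z^2)) / eta (- 1 / z) ^ 2 = 2 * eta_logderiv (- 1 / z) / z^2"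
    using nz unfolding eta_logderiv_def by (simp add: power2_eq_square field_simps)
  moreover have "(- \<i> * eta z ^ 2 - \<i> * z * (2 * eta z * deriv eta z)) / (- \<i> * z * eta z ^ 2) = 1 / z + 2 * eta_logderiv z"
    using nz unfolding eta_logderiv_def by (simp add: power2_eq_square divide_simps) (simp add: algebra_simps)
  ultimately have "2 * eta_logderiv (- 1 / z) / z^2 = 1 / z + 2 * eta_logderiv z" by simp
  thus ?thesis using nz by (simp add: divide_simps power2_eq_square) (simp add: algebra_simps)
qed

text \<open>The correction \<open>c * (c * z + d) / 2\<close> is the cocycle of E_2; it cancels in
  the combination with \<open>p\<close> that occurs in the trace.\<close>

lemma eta_logderiv_mob:
  assumes "a * d - b * c = 1" "z \<in> upper"
  shows "eta_logderiv (mob a b c d z) = (of_int c * z + of_int d)^2 * eta_logderiv z + of_int c * (of_int c * z + of_int d) / 2"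
proof -
  let ?P = "\<lambda>a b c d. a * d - b * c = 1 \<and> (\<forall>z\<in>upper. eta_logderiv (mob a b c d z) = (of_int c * z + of_int d)^2 * eta_logderiv z + of_int c * (of_int c * z + of_int d) / 2)"
  have "?P a b c d"
  proof (rule sl2_induct[of ?P])
    show "?P 1 0 0 1" by (simp add: mob_def)
  next
    fix a b c d assume P: "?P a b c d"
    show "?P b (- a) d (- c)"
    proof (intro conjI ballI)
      fix z assume z: "z \<in> upper"
      have nz: "z \<noteq> 0" using z by (rule upper_nonzero)
      have "eta_logderiv (mob b (- a) d (- c) z) = (of_int c * (- 1 / z) + of_int d)^2 * eta_logderiv (- 1 / z) + of_int c * (of_int c * (- 1 / z) + of_int d) / 2"
        unfolding mob_S[OF conjunct1[OF P] z] using P upper_S[OF z] by blast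
      also have "\<dots> = (of_int d * z + of_int (- c))^2 * eta_logderiv z + of_int d * (of_int d * z + of_int (- c)) / 2"
        unfolding eta_logderiv_S[OF z] using nz by (simp add: field_simps power2_eq_square)
      finally show "eta_logderiv (mob b (- a) d (- c) z) = (of_int d * z + of_int (- c))^2 * eta_logderiv z + of_int d * (of_int d * z + of_int (- c)) / 2" .
    qed (use P in \<open>auto simp: algebra_simps\<close>)
  next
    fix a b c d assume P: "?P a b c d"
    show "?P a (a + b) c (c + d)"
    proof (intro conjI ballI)
      fix z assume z: "z \<in> upper"
      hence z1: "z + 1 \<in> upper" by (simp add: upper_def)
      have "mob a (a + b) c (c + d) z = mob a b c d (z + 1)" by (simp add: mob_def algebra_simps)
      moreover have "eta_logderiv (mob a b c d (z + 1)) = (of_int c * (z + 1) + of_int d)^2 * eta_logderiv (z + 1) + of_int c * (of_int c * (z + 1) + of_int d) / 2"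
        using P z1 by blast
      ultimately show "eta_logderiv (mob a (a + b) c (c + d) z) = (of_int c * z + of_int (c + d))^2 * eta_logderiv z + of_int c * (of_int c * z + of_int (c + d)) / 2"
        using eta_logderiv_T[OF z] by (simp add: algebra_simps)
    qed (use P in \<open>auto simp: algebra_simps\<close>)
  next
    fix a b c d assume P: "?P a b c d"
    show "?P a (b - a) c (d - c)"
    proof (intro conjI ballI)
      fix z assume z: "z \<in> upper"
      hence z1: "z - 1 \<in> upper" by (simp add: upper_def)
      have "mob a (b - a) c (d - c) z = mob a b c d (z - 1)" by (simp add: mob_def algebra_simps)
      moreover have "eta_logderiv (mob a b c d (z - 1)) = (of_int c * (z - 1) + of_int d)^2 * eta_logderiv (z - 1) + of_int c * (of_int c * (z - 1) + of_int d) / 2"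
        using P z1 by blast
      ultimately show "eta_logderiv (mob a (b - a) c (d - c) z) = (of_int c * z + of_int (d - c))^2 * eta_logderiv z + of_int c * (of_int c * z + of_int (d - c)) / 2"
        using eta_logderiv_T[OF z1] by (simp add: algebra_simps)
    qed (use P in \<open>auto simp: algebra_simps\<close>)
  qed (rule assms)
  thus ?thesis using assms by blast
qed

text \<open>The row \<open>(u, v)\<close> is multiplied by the matrix from the right. Invertibility
  of the matrix keeps the row from becoming divisible by \<open>l\<close>, as \<open>R_S\<close>
  requires.\<close>

lemma (in weil) R_mob:
  assumes "a * d - b * c = 1" "z \<in> upper" "\<not> (l dvd u \<and> l dvd v)"
  shows "R u v (mob a b c d z) = R (u * a + v * c) (u * b + v * d) z"
proof -
  let ?P = "\<lambda>a b c d. a * d - b * c = 1 \<and> (\<forall>z\<in>upper. R u v (mob a b c d z) = R (u * a + v * c) (u * b + v * d) z)"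
  have "?P a b c d"
  proof (rule sl2_induct[of ?P])
    show "?P 1 0 0 1" by (simp add: mob_def)
  next
    fix a b c d assume P: "?P a b c d"
    have nd: "\<not> (l dvd u * a + v * c \<and> l dvd u * b + v * d)"
    proof
      assume *: "l dvd u * a + v * c \<and> l dvd u * b + v * d"
      have "u = (u * a + v * c) * d - (u * b + v * d) * c + u * (1 - (a * d - b * c))" by (simp add: algebra_simps)
      hence "u = (u * a + v * c) * d - (u * b + v * d) * c" using P by simp
      hence "l dvd u" using * by (metis dvd_diff dvd_mult2)
      moreover have "v = (u * b + v * d) * a - (u * a + v * c) * b + v * (1 - (a * d - b * c))" by (simp add: algebra_simps)
      hence "v = (u * b + v * d) * a - (u * a + v * c) * b" using P by simp
      hence "l dvd v" using * by (metis dvd_diff dvd_mult2)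
      ultimately show False using assms by blast
    qed
    show "?P b (- a) d (- c)"
    proof (intro conjI ballI)
      fix z assume z: "z \<in> upper"
      have "R u v (mob b (- a) d (- c) z) = R (u * a + v * c) (u * b + v * d) (- 1 / z)"
        unfolding mob_S[OF conjunct1[OF P] z] using P upper_S[OF z] by blast
      also have "\<dots> = R (u * b + v * d) (- (u * a + v * c)) z" by (rule R_S[OF nd z])
      finally show "R u v (mob b (- a) d (- c) z) = R (u * b + v * d) (u * (- a) + v * (- c)) z" by simp
    qed (use P in \<open>auto simp: algebra_simps\<close>)
  next
    fix a b c d assume P: "?P a b c d"
    show "?P a (a + b) c (c + d)"
    proof (intro conjI ballI)
      fix z assume z: "z \<in> upper"
      hence z1: "z + 1 \<in> upper" by (simp add: upper_def)
      have "mob a (a + b) c (c + d) z = mob a b c d (z + 1)" by (simp add: mob_def algebra_simps)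
      hence "R u v (mob a (a + b) c (c + d) z) = R (u * a + v * c) (u * b + v * d) (z + 1)" using P z1 by simp
      thus "R u v (mob a (a + b) c (c + d) z) = R (u * a + v * c) (u * (a + b) + v * (c + d)) z"
        unfolding R_T by (simp add: algebra_simps)
    qed (use P in \<open>auto simp: algebra_simps\<close>)
  next
    fix a b c d assume P: "?P a b c d"
    show "?P a (b - a) c (d - c)"
    proof (intro conjI ballI)
      fix z assume z: "z \<in> upper"
      hence z1: "z - 1 \<in> upper" by (simp add: upper_def)
      have "mob a (b - a) c (d - c) z = mob a b c d (z - 1)" by (simp add: mob_def algebra_simps)
      hence "R u v (mob a (b - a) c (d - c) z) = R (u * a + v * c) (u * b + v * d) (z - 1)" using P z1 by simp
      moreover have "R (u * a + v * c) (u * (b - a) + v * (d - c)) (z - 1 + 1) = R (u * a + v * c) (u * b + v * d) (z - 1)"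
        unfolding R_T by (simp add: algebra_simps)
      ultimately show "R u v (mob a (b - a) c (d - c) z) = R (u * a + v * c) (u * (b - a) + v * (d - c)) z" by simp
    qed (use P in \<open>auto simp: algebra_simps\<close>)
  qed (rule assms)
  thus ?thesis using assms by blast
qed

context weil
begin

text \<open>Here \<open>Psi\<close> is the quadratic exponential with coefficient \<open>j\<close>,
  that is, a translation of the argument by \<open>24 * j\<close>. Since \<open>24 * k\<close> is -1
  modulo \<open>L\<close>, the integer \<open>24 * j\<close> represents d/c.\<close>

lemma R_eval_unit:
  assumes c: "\<not> l dvd c" and j: "[c * j = - k * d] (mod L)" and z: "z \<in> upper"
  shows "R c d z = eta ((z + 24 * of_int j) / of_int L) / eta z"
proof -
  obtain c' where c': "[c * c' = 1] (mod L)" using obtain_inverse[OF c] .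
  have "Psi c d m = eL (j * m^2)" for m
  proof -
    have "L dvd c * j - (- k * d)" using j by (simp only: cong_iff_dvd_diff)
    hence "[j = c' * (- k * d)] (mod L)" unfolding dvd_inverse_iff[OF c'] .
    hence "[j = - k * d * c'] (mod L)" by (simp only: mult_ac)
    hence "[- k * d * c' * m^2 = j * m^2] (mod L)" by (rule cong_mult[OF cong_sym cong_refl])
    hence "eL (- k * d * c' * m^2) = eL (j * m^2)" by (rule eL_cong)
    thus ?thesis using c unfolding Psi_def W_unit[OF c'] by simp
  qed
  moreover have "ee (of_int (m^2) * (((z + 24 * of_int j) / of_int L) / 24)) = eL (j * m^2) * ee (of_int (m^2) * (z / (24 * of_int L)))" for m
  proof -
    have "of_int (m^2) * (((z + 24 * of_int j) / of_int L) / 24) = of_int (j * m^2) / of_int L + of_int (m^2) * (z / (24 * of_int L))"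
      using L_pos by (simp add: field_simps)
    thus ?thesis unfolding eL_def by (simp only: ee_add)
  qed
  ultimately show ?thesis unfolding R_def eta_def weil_theta_def theta_series_def by (simp add: mult.assoc)
qed

text \<open>\<open>W\<close> is \<open>L\<close> on the multiples of \<open>L\<close>, and the
  normalizing factor is \<open>l / L\<close>; their product is the constant \<open>l\<close>, whose
  powers become the powers of \<open>l\<close> in the theorem.\<close>

lemma R_eval_infinity:
  assumes c: "L dvd c" and d: "\<not> l dvd d" and z: "z \<in> upper"
  shows "R c d z = of_int l * eta (of_int L * z) / eta z"
proof -
  have lc: "l dvd c" using c by (metis dvd_mult_left power2_eq_square)
  have c0: "[c = 0] (mod L)" using c by (simp add: cong_0_iff)
  have "[- k * c * d = 0] (mod L)" using c by (simp add: cong_0_iff)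
  hence GL: "GL (- k * c * d) = of_int L" by (rule GL_0)
  have "Psi c d m = (if L dvd m then of_int l else 0)" for m
  proof -
    have "L dvd c * t - m \<longleftrightarrow> L dvd m" for t using c by (simp add: dvd_diff_right_iff)
    moreover have "eL (- k * c * d * t^2) = 1" for t
      using eL_cong[of "- k * c * d * t^2" 0] c by (simp add: cong_0_iff)
    ultimately have "W c d m = (if L dvd m then of_int L else 0)" unfolding W_def using L_pos by simp
    thus ?thesis unfolding Psi_def GL using lc l_pos by (simp add: power2_eq_square)
  qed
  hence "theta_series (\<lambda>m. chi12 m * Psi c d m) (z / (24 * of_int L)) = (\<Sum>\<^sub>\<infinity>m. if L dvd m then chi12 m * of_int l * ee (of_int (m^2) * (z / (24 * of_int L))) else 0)"
    unfolding theta_series_def by (intro infsum_cong) simp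
  also have "\<dots> = (\<Sum>\<^sub>\<infinity>n. chi12 (L * n) * of_int l * ee (of_int ((L * n)^2) * (z / (24 * of_int L))))"
    using L_pos by (intro infsum_multiples) simp
  also have "\<dots> = (\<Sum>\<^sub>\<infinity>n. of_int l * (chi12 n * ee (of_int (n^2) * (of_int L * z / 24))))"
  proof (rule infsum_cong)
    fix n
    have "of_int ((L * n)^2) * (z / (24 * of_int L)) = of_int (n^2) * (of_int L * z / 24)"
      using L_pos by (simp add: field_simps power2_eq_square)
    thus "chi12 (L * n) * of_int l * ee (of_int ((L * n)^2) * (z / (24 * of_int L))) = of_int l * (chi12 n * ee (of_int (n^2) * (of_int L * z / 24)))"
      by (simp only: chi12_mult chi12_L mult_ac mult_1_left mult_1_right)
  qed
  also have "\<dots> = of_int l * theta_series chi12 (of_int L * z / 24)" unfolding theta_series_def by (rule infsum_cmult_right')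
  finally show ?thesis unfolding R_def eta_def weil_theta_def by simp
qed

text \<open>When \<open>l\<close> divides \<open>c\<close> exactly once, \<open>W\<close> is
  supported on the multiples \<open>l * n\<close> and is \<open>l\<close> times a quadratic
  exponential in \<open>n\<close> modulo \<open>l\<close>. The Gauss sum left in the denominator is
  the source of the Legendre symbols in the theorem.\<close>

lemma R_eval_middle:
  assumes b: "\<not> l dvd b" and d: "\<not> l dvd d" and j: "[b * j = - k * d] (mod l)" and z: "z \<in> upper"
  shows "R (l * b) d z = chi12 l * of_int l / gauss_sum l j * eta (z + 24 * of_int j / of_int l) / eta z"
proof -
  have lL: "l dvd L" by simp
  obtain b0 where "[b * b0 = 1] (mod L)" using obtain_inverse[OF b] .
  hence b0: "[b * b0 = 1] (mod l)" using lL by (rule cong_dvd_modulus)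
  have kbd: "[- k * b * d = j * b^2] (mod l)"
  proof -
    have "[b * (b * j) = b * (- k * d)] (mod l)" using j by (rule cong_mult[OF cong_refl])
    from cong_sym[OF this] show ?thesis by (simp add: power2_eq_square mult_ac)
  qed
  have GL: "GL (- k * (l * b) * d) = of_int l * gauss_sum l j"
  proof -
    have "GL (- k * (l * b) * d) = of_int l * gauss_sum l (- k * b * d)"
      using GL_mult_l[of "- k * b * d"] by (simp add: mult_ac)
    also have "gauss_sum l (- k * b * d) = gauss_sum l (j * b^2)" by (rule gauss_sum_cong[OF l_pos kbd])
    also have "\<dots> = gauss_sum l j" by (rule gauss_sum_mult_square[OF l_pos]) (use b coprime_l in simp)
    finally show ?thesis .
  qed
  have W1: "W (l * b) d (l * n) = of_int l * ee (of_int (j * n^2) / of_int l)" for n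
  proof -
    let ?f = "\<lambda>t. if l dvd b * t - n then ee (of_int (- k * b * d * t^2) / of_int l) else 0"
    have per: "?f (t + l) = ?f t" for t
    proof -
      have "b * (t + l) - n = (b * t - n) + b * l" by (simp add: algebra_simps)
      hence "l dvd b * (t + l) - n \<longleftrightarrow> l dvd b * t - n" by (simp only: dvd_add_times_triv_right_iff)
      thus ?thesis by (simp only: ee_square_periodic[OF l_pos])
    qed
    have "W (l * b) d (l * n) = (\<Sum>t\<in>{0..<L}. ?f t)"
      unfolding W_def
    proof (rule sum.cong[OF refl])
      fix t
      have "l * b * t - l * n = l * (b * t - n)" by (simp add: algebra_simps)
      hence "L dvd l * b * t - l * n \<longleftrightarrow> l dvd b * t - n" using l_pos by (simp add: power2_eq_square)
      moreover have "eL (- k * (l * b) * d * t^2) = ee (of_int (- k * b * d * t^2) / of_int l)"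
        using l_pos by (simp add: eL_def power2_eq_square mult_ac)
      ultimately show "(if L dvd l * b * t - l * n then eL (- k * (l * b) * d * t^2) else 0) = ?f t" by simp
    qed
    also have "\<dots> = of_int l * (\<Sum>t\<in>{0..<l}. ?f t)" by (rule sum_periodic_l[of ?f, OF per])
    also have "(\<Sum>t\<in>{0..<l}. ?f t) = ee (of_int (- k * b * d * (b0 * n)^2) / of_int l)"
    proof (rule sum_residue_unique[OF l_pos, of "\<lambda>t. ee (of_int (- k * b * d * t^2) / of_int l)", OF ee_square_periodic[OF l_pos]])
      fix t
      show "l dvd b * t - n \<longleftrightarrow> [t = b0 * n] (mod l)" by (rule dvd_inverse_iff[OF b0])
    qed
    also have "\<dots> = ee (of_int (j * n^2) / of_int l)"
    proof (rule ee_frac_cong[OF _ l_pos])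
      have "[- k * b * d * (b0 * n)^2 = j * b^2 * (b0 * n)^2] (mod l)" using kbd by (rule cong_mult[OF _ cong_refl])
      also have "j * b^2 * (b0 * n)^2 = (b * b0)^2 * (j * n^2)" by (simp add: power_mult_distrib mult_ac)
      also have "[(b * b0)^2 * (j * n^2) = 1^2 * (j * n^2)] (mod l)" using b0 by (rule cong_mult[OF cong_pow cong_refl])
      finally show "[- k * b * d * (b0 * n)^2 = j * n^2] (mod l)" by simp
    qed
    finally show ?thesis .
  qed
  have W0: "W (l * b) d m = 0" if "\<not> l dvd m" for m
    unfolding W_def
  proof (rule sum.neutral, rule ballI)
    fix t
    have "\<not> L dvd l * b * t - m"
    proof
      assume "L dvd l * b * t - m"
      hence "l dvd l * b * t - m" using lL dvd_trans by blast
      hence "l dvd m" by (simp add: dvd_diff_right_iff mult.assoc)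
      thus False using that by simp
    qed
    thus "(if L dvd l * b * t - m then eL (- k * (l * b) * d * t^2) else 0) = 0" by simp
  qed
  have "theta_series (\<lambda>m. chi12 m * Psi (l * b) d m) (z / (24 * of_int L)) = (\<Sum>\<^sub>\<infinity>m. if l dvd m then chi12 m * Psi (l * b) d m * ee (of_int (m^2) * (z / (24 * of_int L))) else 0)"
    unfolding theta_series_def by (intro infsum_cong) (auto simp: Psi_def W0)
  also have "\<dots> = (\<Sum>\<^sub>\<infinity>n. chi12 (l * n) * Psi (l * b) d (l * n) * ee (of_int ((l * n)^2) * (z / (24 * of_int L))))"
    using l_pos by (intro infsum_multiples) simp
  also have "\<dots> = (\<Sum>\<^sub>\<infinity>n. (chi12 l * of_int l / gauss_sum l j) * (chi12 n * ee (of_int (n^2) * ((z + 24 * of_int j / of_int l) / 24))))"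
  proof (rule infsum_cong)
    fix n
    have "of_int (n^2) * ((z + 24 * of_int j / of_int l) / 24) = of_int (j * n^2) / of_int l + of_int ((l * n)^2) * (z / (24 * of_int L))"
      using l_pos by (simp add: field_simps power2_eq_square)
    hence e: "ee (of_int (n^2) * ((z + 24 * of_int j / of_int l) / 24)) = ee (of_int (j * n^2) / of_int l) * ee (of_int ((l * n)^2) * (z / (24 * of_int L)))"
      by (simp only: ee_add)
    have "Psi (l * b) d (l * n) = of_int l / gauss_sum l j * ee (of_int (j * n^2) / of_int l)"
      unfolding Psi_def GL W1 using l_pos by simp
    thus "chi12 (l * n) * Psi (l * b) d (l * n) * ee (of_int ((l * n)^2) * (z / (24 * of_int L)))
      = (chi12 l * of_int l / gauss_sum l j) * (chi12 n * ee (of_int (n^2) * ((z + 24 * of_int j / of_int l) / 24)))"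
      unfolding e chi12_mult by simp
  qed
  also have "\<dots> = (chi12 l * of_int l / gauss_sum l j) * theta_series chi12 ((z + 24 * of_int j / of_int l) / 24)"
    unfolding theta_series_def by (rule infsum_cmult_right')
  finally show ?thesis unfolding R_def eta_def weil_theta_def by simp
qed

lemma R_holomorphic: "R c d holomorphic_on upper"
  unfolding R_def
  by (intro holomorphic_intros weil_theta_holomorphic[of L "Psi c d", OF L_pos Psi_periodic] eta_holomorphic) (use eta_nonzero in auto)

end

section \<open>Traces of weight two\<close>

text \<open>A primitive $F$ of $G$ satisfies $F(z+1) = F(z) + C$ and $F(-1/z) = F(z) + C'$. The fixed point
  $i$ gives $C' = 0$, and then $C = 0$ because $z \mapsto z+1$ and $z \mapsto -1/z$ agree at
  $e^{2\pi i/3}$.\<close>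

lemma weight2_constant_term:
  assumes hol: "G holomorphic_on upper"
    and T: "\<And>z. z \<in> upper \<Longrightarrow> G (z + 1) = G z"
    and S: "\<And>z. z \<in> upper \<Longrightarrow> G (- 1 / z) = z^2 * G z"
    and N: "finite N" "0 \<notin> N"
    and exp: "\<And>z. z \<in> upper \<Longrightarrow> G z = a + (\<Sum>n\<in>N. b n * ee (of_int n * z)) + rem z"
    and rem: "\<And>e. e > 0 \<Longrightarrow> \<exists>Y. \<forall>z. Im z \<ge> Y \<longrightarrow> norm (rem z) \<le> e"
  shows "a = (0 :: complex)"
proof -
  obtain F where F': "\<And>z. z \<in> upper \<Longrightarrow> (F has_field_derivative G z) (at z within upper)"
    using holomorphic_convex_primitive'[OF convex_upper open_upper hol] by blast
  have F: "(F has_field_derivative G z) (at z)" if "z \<in> upper" for z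
    using F'[OF that] unfolding at_within_open[OF that open_upper] .
  have up1: "z + 1 \<in> upper" if "z \<in> upper" for z using that by (simp add: upper_def)
  have const: "f z = f w" if "\<And>z. z \<in> upper \<Longrightarrow> (f has_field_derivative 0) (at z)" "z \<in> upper" "w \<in> upper" for f :: "complex \<Rightarrow> complex" and z w
  proof -
    have "\<exists>c. \<forall>x\<in>upper. f x = c"
      by (rule has_field_derivative_zero_constant[OF convex_upper]) (rule has_field_derivative_at_within[OF that(1)])
    thus ?thesis using that(2,3) by auto
  qed
  have FT: "F (z + 1) - F z = F (w + 1) - F w" if "z \<in> upper" "w \<in> upper" for z w
  proof (rule const[of "\<lambda>z. F (z + 1) - F z"])
    fix z assume z: "z \<in> upper"
    have "((\<lambda>z. F (z + 1)) has_field_derivative G (z + 1)) (at z)"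
      using F[OF up1[OF z]] by (simp add: DERIV_shift)
    from DERIV_diff[OF this F[OF z]] show "((\<lambda>z. F (z + 1) - F z) has_field_derivative 0) (at z)"
      by (simp add: T[OF z])
  qed (use that in auto)
  have FS: "F (- 1 / z) - F z = F (- 1 / w) - F w" if "z \<in> upper" "w \<in> upper" for z w
  proof (rule const[of "\<lambda>z. F (- 1 / z) - F z"])
    fix z assume z: "z \<in> upper"
    have nz: "z \<noteq> 0" using z by (rule upper_nonzero)
    have "((\<lambda>w. - 1 / w) has_field_derivative 1 / z^2) (at z)"
      using nz by (auto intro!: derivative_eq_intros simp: power2_eq_square field_simps)
    from DERIV_chain2[OF F[OF upper_S[OF z]] this]
    have "((\<lambda>w. F (- 1 / w)) has_field_derivative G (- 1 / z) * (1 / z^2)) (at z)" .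
    moreover have "G (- 1 / z) * (1 / z^2) - G z = 0" unfolding S[OF z] using nz by simp
    ultimately show "((\<lambda>z. F (- 1 / z) - F z) has_field_derivative 0) (at z)"
      using DERIV_diff[OF _ F[OF z], of "\<lambda>w. F (- 1 / w)"] by metis
  qed (use that in auto)
  define \<rho> where "\<rho> = Complex (- 1 / 2) (sqrt 3 / 2)"
  have \<rho>: "\<rho> \<in> upper" by (simp add: \<rho>_def upper_def)
  have iu: "\<i> \<in> upper" by (simp add: upper_def)
  have "(\<rho> + 1) * \<rho> = - 1" by (simp add: \<rho>_def complex_eq_iff)
  hence "- 1 / \<rho> = \<rho> + 1" using upper_nonzero[OF \<rho>] by (simp add: field_simps)
  moreover have "- 1 / \<i> = \<i>" by (simp add: field_simps)
  hence "F (- 1 / \<rho>) = F \<rho>" using FS[OF \<rho> iu] by (simp only: diff_self) simp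
  ultimately have mid_const: "F (z + 1) = F z" if "z \<in> upper" for z using FT[OF that \<rho>] by simp
  have "norm a \<le> e" if e: "e > 0" for e
  proof -
    obtain Y where Y: "\<And>z. Im z \<ge> Y \<Longrightarrow> norm (rem z) \<le> e" using rem[OF e] by blast
    define Q where "Q = {z. Im z > max 0 Y}"
    have Q: "convex Q" "Q \<subseteq> upper"
      unfolding Q_def using convex_halfspace_Im_gt by (blast, auto simp: upper_def)
    \<comment> \<open>\<open>P\<close> is a primitive of the remainder. Over one period
      \<open>F\<close> and the exponentials return to their values, so \<open>P\<close> changes by
      \<open>- a\<close>, whereas its derivative is at most \<open>e\<close> in norm along the
      path.\<close>
    define P where "P = (\<lambda>z. F z - a * z - (\<Sum>n\<in>N. b n * (ee (of_int n * z) / (2 * of_real pi * \<i> * of_int n))))"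
    have P: "(P has_field_derivative rem z) (at z within Q)" if z: "z \<in> Q" for z
    proof -
      have zu: "z \<in> upper" using z Q by blast
      have "((\<lambda>z. b n * (ee (of_int n * z) / (2 * of_real pi * \<i> * of_int n))) has_field_derivative b n * ee (of_int n * z)) (at z)" if "n \<in> N" for n
      proof -
        have "n \<noteq> 0" using that N by auto
        thus ?thesis by (auto intro!: derivative_eq_intros)
      qed
      hence "(P has_field_derivative G z - a - (\<Sum>n\<in>N. b n * ee (of_int n * z))) (at z)"
        unfolding P_def by (intro DERIV_diff F[OF zu] DERIV_sum) (auto intro!: derivative_eq_intros)
      moreover have "G z - a - (\<Sum>n\<in>N. b n * ee (of_int n * z)) = rem z" using exp[OF zu] by simp
      ultimately show ?thesis by (simp add: has_field_derivative_at_within)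
    qed
    define w where "w = Complex 0 (max 0 Y + 1)"
    have w: "w \<in> Q" "w + 1 \<in> Q" by (auto simp: w_def Q_def max_def)
    have "norm (P (w + 1) - P w) \<le> e * norm (w + 1 - w)"
      by (rule field_differentiable_bound[OF Q(1) P]) (use Y w in \<open>auto simp: Q_def\<close>)
    moreover have "P (w + 1) - P w = - a"
    proof -
      have "ee (of_int n * (w + 1)) = ee (of_int n * w)" for n
        by (simp only: distrib_left mult_1_right ee_add_int)
      thus ?thesis using mid_const[of w] w Q by (auto simp: P_def algebra_simps)
    qed
    ultimately show ?thesis by simp
  qed
  hence "norm a \<le> 0" by (meson dense_ge)
  thus ?thesis by simp
qed

lemma eta_logderiv_holomorphic: "eta_logderiv holomorphic_on upper"
  unfolding eta_logderiv_def by (intro holomorphic_intros eta_holomorphic open_upper) (use eta_nonzero in auto)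

lemma eta_logderiv_T_int: "z \<in> upper \<Longrightarrow> eta_logderiv (z + of_int n) = eta_logderiv z"
proof (induction n rule: int_induct[of _ 0])
  case (step1 i)
  have "z + of_int i \<in> upper" using step1 by (simp add: upper_def)
  from eta_logderiv_T[OF this] show ?case using step1 by (simp add: add_ac)
next
  case (step2 i)
  have "z + of_int (i - 1) \<in> upper" using step2 by (simp add: upper_def)
  from eta_logderiv_T[OF this] show ?case using step2 by (simp add: add_ac)
qed simp

text \<open>\<open>j * j' = - u\<close> modulo \<open>p\<close> defines an involution of the nonzero
  residues. It is used with \<open>u = 1\<close> for the cosets permuted by S, and with
  \<open>u = k * d\<close> to parametrize the cosets where \<open>l\<close> divides \<open>c\<close>
  once.\<close>

lemma sum_residue_involution:
  fixes F G :: "int \<Rightarrow> complex"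
  assumes p: "prime p" and u: "\<not> p dvd u"
    and FG: "\<And>j j'. j \<in> {1..<p} \<Longrightarrow> j' \<in> {1..<p} \<Longrightarrow> p dvd u + j * j' \<Longrightarrow> F j = G j'"
  shows "(\<Sum>j\<in>{1..<p}. F j) = (\<Sum>j\<in>{1..<p}. G j)"
proof -
  have p_pos: "p > 0" using p by (simp add: prime_gt_0_int)
  define f where "f = (\<lambda>j. SOME x. x \<in> {1..<p} \<and> p dvd u + j * x)"
  have f: "f j \<in> {1..<p} \<and> p dvd u + j * f j" if j: "j \<in> {1..<p}" for j
    unfolding f_def
  proof (rule someI_ex)
    have "\<not> p dvd j" using j zdvd_not_zless by auto
    hence "coprime j p" using prime_imp_coprime[OF p] coprime_commute by blast
    then obtain y where y: "[j * y = 1] (mod p)" using cong_solve_coprime_int by blast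
    define x where "x = (- u * y) mod p"
    have "[j * x = j * (- u * y)] (mod p)" unfolding x_def by (simp add: cong_def mod_mult_right_eq)
    also have "j * (- u * y) = - u * (j * y)" by simp
    also have "[- u * (j * y) = - u * 1] (mod p)" using y by (rule cong_mult[OF cong_refl])
    finally have d: "p dvd u + j * x" by (simp add: cong_iff_dvd_diff add.commute)
    moreover have "x \<noteq> 0" using d u by auto
    moreover have "0 \<le> x" "x < p" using p_pos by (simp_all add: x_def)
    ultimately show "\<exists>x. x \<in> {1..<p} \<and> p dvd u + j * x" by (intro exI[of _ x]) auto
  qed
  have eta_quot: "f (f j) = j" if j: "j \<in> {1..<p}" for j
  proof -
    have 1: "f j \<in> {1..<p}" "p dvd u + j * f j" using f[OF j] by auto
    have 2: "f (f j) \<in> {1..<p}" "p dvd u + f j * f (f j)" using f[OF 1(1)] by auto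
    have "p dvd (u + f j * f (f j)) - (u + j * f j)" by (rule dvd_diff[OF 2(2) 1(2)])
    hence "p dvd f j * (f (f j) - j)" by (simp add: algebra_simps)
    moreover have "\<not> p dvd f j" using 1(1) zdvd_not_zless by auto
    ultimately have "p dvd f (f j) - j" using p by (simp add: prime_dvd_mult_iff)
    hence "[f (f j) = j] (mod p)" by (simp add: cong_iff_dvd_diff)
    thus ?thesis using 2(1) j by (simp add: cong_def)
  qed
  show ?thesis
  proof (rule sum.reindex_bij_witness[of _ f f])
    fix j assume j: "j \<in> {1..<p}"
    show "f (f j) = j" by (rule eta_quot[OF j])
    thus "f (f j) = j" .
    show "f j \<in> {1..<p}" using f[OF j] by blast
    thus "f j \<in> {1..<p}" .
    show "G (f j) = F j" using FG[OF j conjunct1[OF f[OF j]] conjunct2[OF f[OF j]]] ..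
  qed
qed

section \<open>The trace from level p to level one\<close>

locale weil_p = weil +
  fixes p :: int
  assumes prime_p: "prime p" and p_neq: "p \<noteq> l"
begin

lemma p_pos: "p > 0" using prime_p by (simp add: prime_gt_0_int)

lemma l_not_dvd_p: "\<not> l dvd p" using prime_l prime_p p_neq primes_dvd_imp_eq by blast

lemma R_T_nat: "R c d (z + of_nat n) = R c (of_nat n * c + d) z"
proof (induction n arbitrary: d)
  case (Suc n)
  have "R c d (z + of_nat (Suc n)) = R c d ((z + of_nat n) + 1)" by (simp add: add_ac)
  also have "\<dots> = R c (c + d) (z + of_nat n)" by (rule R_T)
  also have "\<dots> = R c (of_nat n * c + (c + d)) z" by (rule Suc.IH)
  finally show ?case by (simp add: algebra_simps)
qed simp

lemma R_T_p: "R c d (z + of_int p) = R c (p * c + d) z"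
  using R_T_nat[of c d z "nat p"] p_pos by simp

text \<open>Pairs instead of points of a projective line: no representatives have to be chosen, and
  the matrices act by linear substitution.\<close>

definition V :: "(int \<times> int) set" where
  "V = {(c, d). c \<in> {0..<L} \<and> d \<in> {0..<L} \<and> \<not> (l dvd c \<and> l dvd d)}"

lemma finite_V: "finite V"
  by (rule finite_subset[of _ "{0..<L} \<times> {0..<L}"]) (auto simp: V_def)

lemma V_D: "(c, d) \<in> V \<Longrightarrow> \<not> (l dvd c \<and> l dvd d)" by (simp add: V_def)

lemma V_reindex:
  fixes f :: "int \<Rightarrow> int \<Rightarrow> complex"
  assumes f: "\<And>c d c' d'. [c = c'] (mod L) \<Longrightarrow> [d = d'] (mod L) \<Longrightarrow> f c d = f c' d'"
    and det: "\<not> l dvd \<alpha> * \<delta> - \<beta> * \<gamma>"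
  shows "(\<Sum>(c,d)\<in>V. f (\<alpha> * c + \<beta> * d) (\<gamma> * c + \<delta> * d)) = (\<Sum>(c,d)\<in>V. f c d)"
proof -
  define h where "h = (\<lambda>(c,d). ((\<alpha> * c + \<beta> * d) mod L, (\<gamma> * c + \<delta> * d) mod L))"
  define D where "D = \<alpha> * \<delta> - \<beta> * \<gamma>"
  have lL: "l dvd L" by simp
  have dmod: "l dvd x mod L \<longleftrightarrow> l dvd x" for x using lL by (simp add: dvd_mod_iff)
  have "h v \<in> V" if "v \<in> V" for v
  proof -
    obtain c d where v: "v = (c, d)" by (cases v)
    have cd: "(c, d) \<in> V" using that v by simp
    have "\<not> (l dvd \<alpha> * c + \<beta> * d \<and> l dvd \<gamma> * c + \<delta> * d)"
    proof
      assume *: "l dvd \<alpha> * c + \<beta> * d \<and> l dvd \<gamma> * c + \<delta> * d"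
      hence "l dvd \<delta> * (\<alpha> * c + \<beta> * d) - \<beta> * (\<gamma> * c + \<delta> * d)" by (intro dvd_diff dvd_mult) auto
      also have "\<delta> * (\<alpha> * c + \<beta> * d) - \<beta> * (\<gamma> * c + \<delta> * d) = D * c" by (simp add: D_def algebra_simps)
      finally have "l dvd c" using det prime_l by (simp add: prime_dvd_mult_iff D_def)
      moreover have "l dvd \<alpha> * (\<gamma> * c + \<delta> * d) - \<gamma> * (\<alpha> * c + \<beta> * d)" using * by (intro dvd_diff dvd_mult) auto
      hence "l dvd D * d" by (simp add: D_def algebra_simps)
      hence "l dvd d" using det prime_l by (simp add: prime_dvd_mult_iff D_def)
      ultimately show False using V_D[OF cd] by blast
    qed
    thus ?thesis using L_pos by (simp add: v h_def V_def dmod)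
  qed
  hence "h ` V \<subseteq> V" by blast
  moreover have inj: "inj_on h V"
  proof (rule inj_onI, clarify)
    fix c d c' d' assume cd: "(c, d) \<in> V" "(c', d') \<in> V" "h (c, d) = h (c', d')"
    have 1: "L dvd (\<alpha> * c + \<beta> * d) - (\<alpha> * c' + \<beta> * d')" "L dvd (\<gamma> * c + \<delta> * d) - (\<gamma> * c' + \<delta> * d')"
      using cd(3) by (simp_all add: h_def mod_eq_dvd_iff)
    have "L dvd \<delta> * ((\<alpha> * c + \<beta> * d) - (\<alpha> * c' + \<beta> * d')) - \<beta> * ((\<gamma> * c + \<delta> * d) - (\<gamma> * c' + \<delta> * d'))"
      by (rule dvd_diff[OF dvd_mult[OF 1(1)] dvd_mult[OF 1(2)]])
    also have "\<delta> * ((\<alpha> * c + \<beta> * d) - (\<alpha> * c' + \<beta> * d')) - \<beta> * ((\<gamma> * c + \<delta> * d) - (\<gamma> * c' + \<delta> * d')) = D * (c - c')"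
      by (simp add: D_def algebra_simps)
    finally have a: "L dvd D * (c - c')" .
    have "L dvd \<alpha> * ((\<gamma> * c + \<delta> * d) - (\<gamma> * c' + \<delta> * d')) - \<gamma> * ((\<alpha> * c + \<beta> * d) - (\<alpha> * c' + \<beta> * d'))"
      by (rule dvd_diff[OF dvd_mult[OF 1(2)] dvd_mult[OF 1(1)]])
    also have "\<alpha> * ((\<gamma> * c + \<delta> * d) - (\<gamma> * c' + \<delta> * d')) - \<gamma> * ((\<alpha> * c + \<beta> * d) - (\<alpha> * c' + \<beta> * d')) = D * (d - d')"
      by (simp add: D_def algebra_simps)
    finally have b: "L dvd D * (d - d')" .
    have "coprime D L" using det unfolding coprime_l(2) D_def .
    hence "coprime L D" by (simp only: coprime_commute)
    hence "L dvd c - c'" "L dvd d - d'" using a b coprime_dvd_mult_right_iff by blast+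
    hence "[c = c'] (mod L)" "[d = d'] (mod L)" by (simp_all add: cong_iff_dvd_diff)
    thus "c = c' \<and> d = d'" using cd by (simp add: V_def cong_def)
  qed
  ultimately have img: "h ` V = V" using finite_V by (intro endo_inj_surj)
  have "(\<Sum>(c,d)\<in>V. f c d) = (\<Sum>v\<in>V. case_prod f (h v))"
    using sum.reindex[OF inj, of "case_prod f"] unfolding img by simp
  also have "\<dots> = (\<Sum>(c,d)\<in>V. f (\<alpha> * c + \<beta> * d) (\<gamma> * c + \<delta> * d))"
    by (intro sum.cong refl) (auto simp: h_def cong_def intro!: f)
  finally show ?thesis ..
qed

lemma V_reindex_S:
  fixes f :: "int \<Rightarrow> int \<Rightarrow> complex"
  assumes f: "\<And>c d c' d'. [c = c'] (mod L) \<Longrightarrow> [d = d'] (mod L) \<Longrightarrow> f c d = f c' d'"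
  shows "(\<Sum>(c,d)\<in>V. f d (- c)) = (\<Sum>(c,d)\<in>V. f c d)"
  using V_reindex[of f 0 0 1 "- 1", OF f] l_gt by simp

lemma V_reindex_T:
  fixes f :: "int \<Rightarrow> int \<Rightarrow> complex"
  assumes f: "\<And>c d c' d'. [c = c'] (mod L) \<Longrightarrow> [d = d'] (mod L) \<Longrightarrow> f c d = f c' d'"
  shows "(\<Sum>(c,d)\<in>V. f c (c + d)) = (\<Sum>(c,d)\<in>V. f c d)"
  using V_reindex[of f 1 1 0 1, OF f] l_gt by simp

context
  fixes r s :: int
begin

text \<open>The logarithmic derivative of eta is a multiple of $E_2$. The index of \<open>trace_fin\<close> runs
  through the cosets of $\Gamma_0(p)$ over the cusp $0$.\<close>

definition trace_inf :: "int \<Rightarrow> int \<Rightarrow> complex \<Rightarrow> complex" where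
  "trace_inf c d z = (of_int p * eta_logderiv (of_int p * z) - eta_logderiv z) * (R c d z powi r * R c (p * d) (of_int p * z) powi s)"

definition trace_fin :: "int \<Rightarrow> int \<Rightarrow> int \<Rightarrow> complex \<Rightarrow> complex" where
  "trace_fin j c d z = (eta_logderiv ((z + of_int j) / of_int p) / of_int p - eta_logderiv z) *
     (R c d z powi r * R (p * c) (d - j * c) ((z + of_int j) / of_int p) powi s)"

lemma upper_mult: "z \<in> upper \<Longrightarrow> of_int p * z \<in> upper" using p_pos by (simp add: upper_def)

lemma upper_div: "z \<in> upper \<Longrightarrow> (z + of_int j) / of_int p \<in> upper"
  using divide_upper_int[of "z + of_int j" p] p_pos by (simp add: upper_def)

lemma trace_inf_cong: "[c = c'] (mod L) \<Longrightarrow> [d = d'] (mod L) \<Longrightarrow> trace_inf c d z = trace_inf c' d' z"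
  unfolding trace_inf_def by (simp only: R_cong[of c c' d d'] R_cong[of c c' "p * d" "p * d'"] cong_mult[OF cong_refl])

lemma trace_fin_cong:
  assumes "[c = c'] (mod L)" "[d = d'] (mod L)"
  shows "trace_fin j c d z = trace_fin j c' d' z"
proof -
  have "[p * c = p * c'] (mod L)" "[d - j * c = d' - j * c'] (mod L)"
    using assms by (auto intro!: cong_diff cong_mult)
  thus ?thesis unfolding trace_fin_def using assms by (simp only: R_cong[of c c' d d'] R_cong[of "p * c" "p * c'" "d - j * c" "d' - j * c'"])
qed

lemma trace_inf_T: "z \<in> upper \<Longrightarrow> trace_inf c d (z + 1) = trace_inf c (c + d) z"
proof -
  assume z: "z \<in> upper"
  have e: "of_int p * (z + 1) = of_int p * z + of_int p" by (simp add: algebra_simps)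
  have d: "p * (c + d) = p * c + p * d" by (simp add: algebra_simps)
  show ?thesis unfolding trace_inf_def e d R_T_p eta_logderiv_T_int[OF upper_mult[OF z]] R_T eta_logderiv_T[OF z] ..
qed

lemma trace_fin_T: "z \<in> upper \<Longrightarrow> trace_fin j c d (z + 1) = trace_fin (j + 1) c (c + d) z"
proof -
  assume z: "z \<in> upper"
  have e: "z + 1 + of_int j = z + of_int (j + 1)" by simp
  have d: "c + d - (j + 1) * c = d - j * c" by (simp add: algebra_simps)
  show ?thesis unfolding trace_fin_def e d R_T eta_logderiv_T[OF z] ..
qed

lemma trace_fin_p: "z \<in> upper \<Longrightarrow> trace_fin (j + p) c d z = trace_fin j c d z"
proof -
  assume z: "z \<in> upper"
  have e: "(z + of_int (j + p)) / of_int p = (z + of_int j) / of_int p + 1" using p_pos by (simp add: field_simps)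
  have d: "p * c + (d - (j + p) * c) = d - j * c" by (simp add: algebra_simps)
  show ?thesis unfolding trace_fin_def e R_T d eta_logderiv_T[OF upper_div[OF z]] ..
qed

text \<open>As p(-1/z) = -1/(z/p), the coset of the cusp infinity goes to the one with
  \<open>j = 0\<close>. The corrections \<open>z / 2\<close> of the two logarithmic derivatives
  cancel, which leaves exact weight two.\<close>

lemma trace_inf_S:
  assumes z: "z \<in> upper" and cd: "\<not> (l dvd c \<and> l dvd d)"
  shows "trace_inf c d (- 1 / z) = z^2 * trace_fin 0 d (- c) z"
proof -
  have nz: "z \<noteq> 0" using z by (rule upper_nonzero)
  have e: "of_int p * (- 1 / z) = - 1 / (z / of_int p)" using nz p_pos by (simp add: field_simps)
  have zp: "z / of_int p \<in> upper" using upper_div[OF z, of 0] by simp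
  have "\<not> (l dvd c \<and> l dvd p * d)" using cd prime_l l_not_dvd_p by (simp add: prime_dvd_mult_iff)
  hence "R c (p * d) (- 1 / (z / of_int p)) = R (p * d) (- c) (z / of_int p)" using zp by (rule R_S)
  moreover have "of_int p * eta_logderiv (- 1 / (z / of_int p)) - eta_logderiv (- 1 / z) = z^2 * (eta_logderiv (z / of_int p) / of_int p - eta_logderiv z)"
    unfolding eta_logderiv_S[OF z] eta_logderiv_S[OF zp] using p_pos by (simp add: field_simps power2_eq_square)
  ultimately show ?thesis unfolding trace_inf_def trace_fin_def e R_S[OF cd z] by simp
qed

lemma trace_zero_S:
  assumes z: "z \<in> upper" and cd: "\<not> (l dvd c \<and> l dvd d)"
  shows "trace_fin 0 c d (- 1 / z) = z^2 * trace_inf d (- c) z"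
proof -
  have nz: "z \<noteq> 0" using z by (rule upper_nonzero)
  have e: "(- 1 / z + of_int 0) / of_int p = - 1 / (of_int p * z)" using nz p_pos by (simp add: field_simps)
  have "\<not> (l dvd p * c \<and> l dvd d)" using cd prime_l l_not_dvd_p by (simp add: prime_dvd_mult_iff)
  hence "R (p * c) d (- 1 / (of_int p * z)) = R d (- (p * c)) (of_int p * z)" using upper_mult[OF z] by (rule R_S)
  moreover have "eta_logderiv (- 1 / (of_int p * z)) / of_int p - eta_logderiv (- 1 / z) = z^2 * (of_int p * eta_logderiv (of_int p * z) - eta_logderiv z)"
    unfolding eta_logderiv_S[OF z] eta_logderiv_S[OF upper_mult[OF z]] using p_pos by (simp add: field_simps power2_eq_square)
  ultimately show ?thesis unfolding trace_inf_def trace_fin_def e R_S[OF cd z] by simp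
qed

text \<open>If \<open>1 + j * j' = p * e\<close>, the matrix with rows \<open>(j, - e)\<close> and
  \<open>(p, - j')\<close> has determinant 1 and carries (z + j')/p to (-1/z + j)/p. The laws under
  the modular group do the rest.\<close>

lemma trace_fin_S:
  assumes z: "z \<in> upper" and cd: "\<not> (l dvd c \<and> l dvd d)" and jj: "p dvd 1 + j * j'"
  shows "trace_fin j c d (- 1 / z) = z^2 * trace_fin j' d (- c) z"
proof -
  have nz: "z \<noteq> 0" using z by (rule upper_nonzero)
  obtain e where e: "1 + j * j' = p * e" using jj by blast
  define w where "w = (z + of_int j') / of_int p"
  have w: "w \<in> upper" unfolding w_def by (rule upper_div[OF z])
  have det: "j * (- j') - (- e) * p = 1" using e by (simp add: algebra_simps)
  have den: "of_int p * w + of_int (- j') = z" using p_pos by (simp add: w_def)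
  have pe: "of_int p * of_int e = (1 + of_int j * of_int j' :: complex)"
    using e by (metis of_int_1 of_int_add of_int_mult)
  have mob: "mob j (- e) p (- j') w = (- 1 / z + of_int j) / of_int p"
  proof -
    have "of_int p * (of_int j * w + of_int (- e)) = of_int j * z - 1"
    proof -
      have "of_int p * (of_int j * w + of_int (- e)) = of_int j * (of_int p * w + of_int (- j')) + of_int j * of_int j' - of_int p * of_int e"
        by (simp add: algebra_simps)
      thus ?thesis unfolding den pe by simp
    qed
    hence e': "of_int j * w + of_int (- e) = (of_int j * z - 1) / of_int p"
      using p_pos nonzero_eq_divide_eq[of "of_int p" "of_int j * w + of_int (- e)"] by (simp add: mult.commute)
    show ?thesis unfolding mob_def den e' using nz p_pos by (simp add: field_simps)
  qed
  have nd: "\<not> (l dvd p * c \<and> l dvd d - j * c)"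
  proof
    assume *: "l dvd p * c \<and> l dvd d - j * c"
    hence "l dvd c" using prime_l l_not_dvd_p by (simp add: prime_dvd_mult_iff)
    moreover from this have "l dvd d" using * by (metis dvd_diff_left_iff dvd_mult)
    ultimately show False using cd by blast
  qed
  have "R (p * c) (d - j * c) ((- 1 / z + of_int j) / of_int p)
     = R (p * c * j + (d - j * c) * p) (p * c * (- e) + (d - j * c) * (- j')) w"
    unfolding mob[symmetric] by (rule R_mob[OF det w nd])
  also have "p * c * j + (d - j * c) * p = p * d" by (simp add: algebra_simps)
  also have "p * c * (- e) + (d - j * c) * (- j') = - c * (p * e - j * j') - j' * d" by (simp add: algebra_simps)
  also have "\<dots> = - c - j' * d" 
  proof -
    have "p * e - j * j' = 1" using e by simp
    thus ?thesis by (simp only: mult_1_right)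
  qed
  finally have 1: "R (p * c) (d - j * c) ((- 1 / z + of_int j) / of_int p) = R (p * d) (- c - j' * d) w" .
  have 2: "eta_logderiv ((- 1 / z + of_int j) / of_int p) / of_int p - eta_logderiv (- 1 / z) = z^2 * (eta_logderiv w / of_int p - eta_logderiv z)"
    unfolding mob[symmetric] eta_logderiv_mob[OF det w] den eta_logderiv_S[OF z] using p_pos by (simp add: field_simps)
  show ?thesis unfolding trace_fin_def R_S[OF cd z] 1 2 w_def by simp
qed

text \<open>A simultaneous sum over the conjugates of u and over the \<open>1 + p\<close> cosets of
  level \<open>p\<close>.\<close>

definition trace_form :: "complex \<Rightarrow> complex" where
  "trace_form z = (\<Sum>(c,d)\<in>V. trace_inf c d z) + (\<Sum>j\<in>{0..<p}. \<Sum>(c,d)\<in>V. trace_fin j c d z)"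

lemma trace_form_T: assumes z: "z \<in> upper" shows "trace_form (z + 1) = trace_form z"
proof -
  have 1: "(\<Sum>(c,d)\<in>V. trace_inf c d (z + 1)) = (\<Sum>(c,d)\<in>V. trace_inf c d z)"
    unfolding trace_inf_T[OF z] by (rule V_reindex_T) (rule trace_inf_cong)
  have "(\<Sum>(c,d)\<in>V. trace_fin j c d (z + 1)) = (\<Sum>(c,d)\<in>V. trace_fin (j + 1) c d z)" for j
    unfolding trace_fin_T[OF z] by (rule V_reindex_T) (rule trace_fin_cong)
  hence "(\<Sum>j\<in>{0..<p}. \<Sum>(c,d)\<in>V. trace_fin j c d (z + 1)) = (\<Sum>j\<in>{0..<p}. \<Sum>(c,d)\<in>V. trace_fin (1 * j + 1) c d z)" by simp
  also have "\<dots> = (\<Sum>j\<in>{0..<p}. \<Sum>(c,d)\<in>V. trace_fin j c d z)"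
    by (rule sum_residues_affine[of p 1 "\<lambda>j. \<Sum>(c,d)\<in>V. trace_fin j c d z"]) (use p_pos in \<open>auto simp: trace_fin_p[OF z]\<close>)
  finally show ?thesis unfolding trace_form_def 1 by simp
qed

text \<open>S exchanges the cusp infinity with \<open>j = 0\<close> and pairs the nonzero
  \<open>j\<close> with the solution \<open>j'\<close> of \<open>j * j' = - 1\<close> modulo
  \<open>p\<close>, while \<open>(c, d)\<close> goes to \<open>(d, - c)\<close>.\<close>

lemma trace_form_S: assumes z: "z \<in> upper" shows "trace_form (- 1 / z) = z^2 * trace_form z"
proof -
  have dist: "(\<Sum>(c,d)\<in>V. z^2 * f c d) = z^2 * (\<Sum>(c,d)\<in>V. f c d)" for f
    unfolding sum_distrib_left by (intro sum.cong refl) auto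
  have "(\<Sum>(c,d)\<in>V. trace_inf c d (- 1 / z)) = (\<Sum>(c,d)\<in>V. z^2 * trace_fin 0 d (- c) z)"
    by (rule sum.cong[OF refl], clarify, rule trace_inf_S[OF z V_D])
  also have "\<dots> = z^2 * (\<Sum>(c,d)\<in>V. trace_fin 0 c d z)"
    unfolding dist by (subst V_reindex_S[of "\<lambda>c d. trace_fin 0 c d z"], erule (1) trace_fin_cong, rule refl)
  finally have 1: "(\<Sum>(c,d)\<in>V. trace_inf c d (- 1 / z)) = z^2 * (\<Sum>(c,d)\<in>V. trace_fin 0 c d z)" .
  have "(\<Sum>(c,d)\<in>V. trace_fin 0 c d (- 1 / z)) = (\<Sum>(c,d)\<in>V. z^2 * trace_inf d (- c) z)"
    by (rule sum.cong[OF refl], clarify, rule trace_zero_S[OF z V_D])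
  also have "\<dots> = z^2 * (\<Sum>(c,d)\<in>V. trace_inf c d z)"
    unfolding dist by (subst V_reindex_S[of "\<lambda>c d. trace_inf c d z"], erule (1) trace_inf_cong, rule refl)
  finally have 2: "(\<Sum>(c,d)\<in>V. trace_fin 0 c d (- 1 / z)) = z^2 * (\<Sum>(c,d)\<in>V. trace_inf c d z)" .
  have 3: "(\<Sum>(c,d)\<in>V. trace_fin j c d (- 1 / z)) = z^2 * (\<Sum>(c,d)\<in>V. trace_fin j' c d z)" if jj: "p dvd 1 + j * j'" for j j'
  proof -
    have "(\<Sum>(c,d)\<in>V. trace_fin j c d (- 1 / z)) = (\<Sum>(c,d)\<in>V. z^2 * trace_fin j' d (- c) z)"
      by (rule sum.cong[OF refl], clarify, rule trace_fin_S[OF z V_D jj])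
    also have "\<dots> = z^2 * (\<Sum>(c,d)\<in>V. trace_fin j' c d z)"
      unfolding dist by (subst V_reindex_S[of "\<lambda>c d. trace_fin j' c d z"], erule (1) trace_fin_cong, rule refl)
    finally show ?thesis .
  qed
  have 4: "(\<Sum>j\<in>{1..<p}. \<Sum>(c,d)\<in>V. trace_fin j c d (- 1 / z)) = (\<Sum>j\<in>{1..<p}. z^2 * (\<Sum>(c,d)\<in>V. trace_fin j c d z))"
    by (rule sum_residue_involution[OF prime_p, of 1]) (use prime_p 3 in auto)
  have split: "{0..<p} = insert 0 {1..<p}" using p_pos by auto
  show ?thesis unfolding trace_form_def split using 1 2 4 by (simp add: sum_distrib_left algebra_simps)
qed

end

end

section \<open>The sum over the conjugates as a Hecke operator\<close>

lemma eta_T_24: "eta (z + 24 * of_nat n) = eta z"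
proof -
  have T: "eta (z + of_nat m) = ee (of_nat m / 24) * eta z" for m
  proof (induction m)
    case (Suc m)
    have "eta (z + of_nat (Suc m)) = eta ((z + of_nat m) + 1)" by (simp add: add_ac)
    thus ?case unfolding eta_T Suc.IH by (simp add: ee_add[symmetric] add_divide_distrib mult.assoc[symmetric])
  qed simp
  have "ee (of_nat (24 * n) / 24) = 1" by simp
  thus ?thesis using T[of "24 * n"] by simp
qed

context weil
begin

lemma chi12_l_nonzero: "chi12 l \<noteq> 0" and chi12_l_square: "chi12 l * chi12 l = 1"
  using chi12_L chi12_mult[of l l] by (auto simp: power2_eq_square)

lemma upper_affine: "z \<in> upper \<Longrightarrow> N > 0 \<Longrightarrow> (z + 24 * of_int j) / of_int N \<in> upper"
  using divide_upper_int[of "z + 24 * of_int j" N] by (simp add: upper_def)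

lemma upper_middle: "z \<in> upper \<Longrightarrow> z + 24 * of_int j / of_int N \<in> upper"
proof -
  have "Im (24 * of_int j / of_int N) = 0" using Im_divide_of_real[of "24 * of_int j" "of_int N"] by simp
  thus "z \<in> upper \<Longrightarrow> z + 24 * of_int j / of_int N \<in> upper" by (simp add: upper_def)
qed

text \<open>One of the exponents in the trace is negative, so holomorphy requires that no conjugate
  vanishes. The three evaluations reduce this to eta and the Gauss sums being nonzero.\<close>

lemma R_nonzero:
  assumes z: "z \<in> upper" and cd: "\<not> (l dvd c \<and> l dvd d)"
  shows "R c d z \<noteq> 0"
proof (cases "l dvd c")
  case False
  obtain c' where "[c * c' = 1] (mod L)" using obtain_inverse[OF False] .
  hence "[c * c' * (- k * d) = 1 * (- k * d)] (mod L)" by (rule cong_mult[OF _ cong_refl])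
  hence "[c * (c' * (- k * d)) = - k * d] (mod L)" by (simp only: mult.assoc mult_1_left)
  from R_eval_unit[OF False this z] show ?thesis
    using eta_nonzero[OF upper_affine[OF z L_pos]] eta_nonzero[OF z] by (simp only: divide_eq_0_iff de_Morgan_disj simp_thms)
next
  case True
  hence d: "\<not> l dvd d" using cd by blast
  obtain b where b: "c = l * b" using True by blast
  show ?thesis
  proof (cases "l dvd b")
    case True
    hence "L dvd c" unfolding b by (simp add: power2_eq_square)
    moreover have "of_int L * z \<in> upper" using z L_pos by (simp add: upper_def)
    ultimately show ?thesis using R_eval_infinity[OF _ d z, of c] eta_nonzero z l_pos by simp
  next
    case False
    obtain b' where b': "[b * b' = 1] (mod L)" using obtain_inverse[OF False] .
    hence "[b * b' * (- k * d) = 1 * (- k * d)] (mod L)" by (rule cong_mult[OF _ cong_refl])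
    hence "[b * (b' * (- k * d)) = - k * d] (mod L)" by (simp only: mult.assoc mult_1_left)
    moreover define j where "j = b' * (- k * d)"
    ultimately have "[b * j = - k * d] (mod L)" by simp
    hence j: "[b * j = - k * d] (mod l)" by (rule cong_dvd_modulus) simp
    have "\<not> l dvd - k * d" using L_not_dvd_k d prime_l by (simp add: prime_dvd_mult_iff)
    hence "\<not> l dvd b * j" using cong_dvd_iff[OF j] by simp
    hence nj: "\<not> l dvd j" by (meson dvd_mult)
    show ?thesis unfolding b R_eval_middle[OF False d j z]
      using eta_nonzero[OF upper_middle[OF z]] eta_nonzero[OF z] chi12_l_nonzero l_pos gauss_sum_nonzero[OF prime_l l_gt2 nj] by simp
  qed
qed

lemma sum_multiples_l:
  fixes h :: "int \<Rightarrow> complex"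
  shows "(\<Sum>c\<in>{0..<L}. if l dvd c then h c else 0) = (\<Sum>b\<in>{0..<l}. h (l * b))"
proof -
  have "(\<Sum>c\<in>{0..<L}. if l dvd c then h c else 0) = (\<Sum>a\<in>{0..<l}. \<Sum>b\<in>{0..<l}. if l dvd a + l * b then h (a + l * b) else 0)"
    using sum_residues_split[OF l_pos l_pos, of "\<lambda>c. if l dvd c then h c else 0"] by (simp only: power2_eq_square)
  also have "\<dots> = (\<Sum>a\<in>{0..<l}. if a = 0 then (\<Sum>b\<in>{0..<l}. h (l * b)) else 0)"
  proof (rule sum.cong[OF refl])
    fix a assume a: "a \<in> {0..<l}"
    have "l dvd a + l * b \<longleftrightarrow> a = 0" for b using a dvd_residue_zero[of l a] by (auto simp: dvd_add_left_iff)
    thus "(\<Sum>b\<in>{0..<l}. if l dvd a + l * b then h (a + l * b) else 0) = (if a = 0 then (\<Sum>b\<in>{0..<l}. h (l * b)) else 0)"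
      by simp
  qed
  also have "\<dots> = (\<Sum>b\<in>{0..<l}. h (l * b))" using l_pos by simp
  finally show ?thesis .
qed

lemma sum_units: "(\<Sum>d\<in>{0..<L}. if l dvd d then 0 else (x :: complex)) = of_int (l * (l - 1)) * x"
proof -
  have "(\<Sum>d\<in>{0..<L}. x) = (\<Sum>d\<in>{0..<L}. if l dvd d then 0 else x) + (\<Sum>d\<in>{0..<L}. if l dvd d then x else 0)"
    unfolding sum.distrib[symmetric] by (intro sum.cong) auto
  moreover have "(\<Sum>d\<in>{0..<L}. if l dvd d then x else 0) = of_int l * x"
    using sum_multiples_l[of "\<lambda>_. x"] l_pos by simp
  moreover have "(\<Sum>d\<in>{0..<L}. x) = of_int (l * l) * x" using L_pos by (simp add: power2_eq_square)
  ultimately show ?thesis by (simp add: algebra_simps)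
qed

end

context weil_p
begin

lemma not_dvd_p_mult: "\<not> (l dvd c \<and> l dvd d) \<Longrightarrow> \<not> (l dvd c \<and> l dvd p * d)"
  "\<not> (l dvd c \<and> l dvd d) \<Longrightarrow> \<not> (l dvd p * c \<and> l dvd d)"
  using prime_l l_not_dvd_p by (auto simp: prime_dvd_mult_iff)

lemma holomorphic_comp_mult: "f holomorphic_on upper \<Longrightarrow> (\<lambda>z. f (of_int p * z)) holomorphic_on upper"
  using holomorphic_on_compose_gen[of "\<lambda>z. of_int p * z" upper f upper] upper_mult
  by (auto simp: o_def intro!: holomorphic_intros)

lemma holomorphic_comp_div: "f holomorphic_on upper \<Longrightarrow> (\<lambda>z. f ((z + of_int j) / of_int p)) holomorphic_on upper"
proof -
  assume f: "f holomorphic_on upper"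
  have "(f \<circ> (\<lambda>z. (z + of_int j) / of_int p)) holomorphic_on upper"
  proof (rule holomorphic_on_compose_gen[OF _ f])
    show "(\<lambda>z. (z + of_int j) / of_int p) holomorphic_on upper" using p_pos by (intro holomorphic_intros) auto
    show "(\<lambda>z. (z + of_int j) / of_int p) ` upper \<subseteq> upper" using upper_div by blast
  qed
  thus ?thesis by (simp only: o_def)
qed

lemma trace_form_holomorphic: "trace_form r s holomorphic_on upper"
proof -
  have "trace_inf r s c d holomorphic_on upper" if "(c, d) \<in> V" for c d
    unfolding trace_inf_def
    by (intro holomorphic_intros eta_logderiv_holomorphic R_holomorphic holomorphic_comp_mult disjI2 ballI
          R_nonzero upper_mult not_dvd_p_mult V_D[OF that])
  moreover have "trace_fin r s j c d holomorphic_on upper" if cd: "(c, d) \<in> V" for j c d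
  proof -
    have "\<not> (l dvd p * c \<and> l dvd d - j * c)"
    proof
      assume *: "l dvd p * c \<and> l dvd d - j * c"
      hence "l dvd c" using prime_l l_not_dvd_p by (simp add: prime_dvd_mult_iff)
      moreover from this have "l dvd d" using * by (metis dvd_diff_left_iff dvd_mult)
      ultimately show False using V_D[OF cd] by blast
    qed
    thus ?thesis unfolding trace_fin_def
      by (intro holomorphic_intros eta_logderiv_holomorphic R_holomorphic holomorphic_comp_div disjI2 ballI
            R_nonzero upper_div V_D[OF cd]) (use p_pos in auto)
  qed
  ultimately show ?thesis unfolding trace_form_def[abs_def] case_prod_unfold
    by (intro holomorphic_intros) (auto simp: prod_eq_iff)
qed

definition eta_quot :: "int \<Rightarrow> int \<Rightarrow> complex \<Rightarrow> complex" where
  "eta_quot r s z = eta z powi r * eta (of_int p * z) powi s"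

definition conj_sum :: "int \<Rightarrow> int \<Rightarrow> complex \<Rightarrow> complex" where
  "conj_sum r s z = (\<Sum>(c,d)\<in>V. R c d z powi r * R c (p * d) (of_int p * z) powi s)"

text \<open>Collects the constants of \<open>R_eval_middle\<close>. The second Gauss sum is taken at
  \<open>p * j\<close> because the second factor of the trace uses the pair
  \<open>(c, p * d)\<close>.\<close>

definition mid_factor :: "int \<Rightarrow> int \<Rightarrow> int \<Rightarrow> complex" where
  "mid_factor r s j = (chi12 l * of_int l) powi (r + s) * (gauss_sum l j powi (- r) * gauss_sum l (p * j) powi (- s))"

text \<open>The three parts come from the upper triangular matrices of determinant l^2 with
  diagonals (l^2, 1), (l, l) and (1, l^2). Translations are by multiples of 24, a period of
  eta.\<close>

definition hecke_sum :: "int \<Rightarrow> int \<Rightarrow> complex \<Rightarrow> complex" where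
  "hecke_sum r s z = of_int l powi (r + s) * eta_quot r s (of_int L * z)
     + (\<Sum>j\<in>{1..<l}. mid_factor r s j * eta_quot r s (z + 24 * of_int j / of_int l))
     + (\<Sum>j\<in>{0..<L}. eta_quot r s ((z + 24 * of_int j) / of_int L))"

lemma eta_quot_T_24: "eta_quot r s (z + 24) = eta_quot r s z"
proof -
  have "of_int p * (z + 24) = of_int p * z + 24 * of_nat (nat p)" using p_pos by (simp add: algebra_simps)
  thus ?thesis unfolding eta_quot_def using eta_T_24[of z 1] eta_T_24[of "of_int p * z" "nat p"] by simp
qed

lemma eta_quot_nonzero: "z \<in> upper \<Longrightarrow> eta_quot r s z \<noteq> 0"
  unfolding eta_quot_def using eta_nonzero upper_mult by simp

text \<open>If \<open>c\<close> is a unit, the sum over \<open>d\<close> is the third part of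
  \<open>hecke_sum\<close>; if \<open>l\<close> divides \<open>c\<close>, then \<open>d\<close> is a
  unit and the sum over \<open>c\<close> gives the first two parts. Each happens once for every unit
  modulo \<open>L\<close>.\<close>

lemma conj_sum_eval:
  assumes z: "z \<in> upper"
  shows "conj_sum r s z * eta_quot r s z = of_int (l * (l - 1)) * hecke_sum r s z"
proof -
  have pz: "of_int p * z \<in> upper" by (rule upper_mult[OF z])
  have e0: "eta z \<noteq> 0" "eta (of_int p * z) \<noteq> 0" using eta_nonzero z pz by auto
  define T where "T = (\<lambda>c d. R c d z powi r * R c (p * d) (of_int p * z) powi s * eta_quot r s z)"
  have T_eq: "T c d = (R c d z * eta z) powi r * (R c (p * d) (of_int p * z) * eta (of_int p * z)) powi s" for c d
    unfolding T_def eta_quot_def power_int_mult_distrib by (simp only: mult_ac)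
  have T1: "T c d = eta_quot r s ((z + 24 * of_int j) / of_int L)" if c: "\<not> l dvd c" and j: "[c * j = - k * d] (mod L)" for c d j
  proof -
    have "[p * (c * j) = p * (- k * d)] (mod L)" using j by (rule cong_mult[OF cong_refl])
    hence j': "[c * (p * j) = - k * (p * d)] (mod L)" by (simp add: mult_ac)
    have e: "of_int p * ((z + 24 * of_int j) / of_int L) = (of_int p * z + 24 * of_int (p * j)) / of_int L"
      by (simp add: algebra_simps)
    have 1: "R c d z * eta z = eta ((z + 24 * of_int j) / of_int L)"
      unfolding R_eval_unit[OF c j z] using e0 by simp
    have 2: "R c (p * d) (of_int p * z) * eta (of_int p * z) = eta ((of_int p * z + 24 * of_int (p * j)) / of_int L)"
      unfolding R_eval_unit[OF c j' pz] using e0 by simp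
    show ?thesis unfolding T_eq eta_quot_def 1 2 e ..
  qed
  have T2: "T (l * 0) d = of_int l powi (r + s) * eta_quot r s (of_int L * z)" if d: "\<not> l dvd d" for d
  proof -
    have d': "\<not> l dvd p * d" using d prime_l l_not_dvd_p by (simp add: prime_dvd_mult_iff)
    have 1: "R 0 d z * eta z = of_int l * eta (of_int L * z)" using R_eval_infinity[OF _ d z, of 0] e0 by simp
    have 2: "R 0 (p * d) (of_int p * z) * eta (of_int p * z) = of_int l * eta (of_int L * (of_int p * z))"
      using R_eval_infinity[OF _ d' pz, of 0] e0 by simp
    have 3: "of_int L * (of_int p * z) = of_int p * (of_int L * z)" by (simp only: mult_ac)
    have "T (l * 0) d = (of_int l * eta (of_int L * z)) powi r * (of_int l * eta (of_int p * (of_int L * z))) powi s"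
      unfolding T_eq mult_zero_right 1 2 3 ..
    also have "\<dots> = of_int l powi (r + s) * eta_quot r s (of_int L * z)"
      unfolding eta_quot_def power_int_mult_distrib using l_pos by (simp add: power_int_add)
    finally show ?thesis .
  qed
  have T3: "T (l * b) d = mid_factor r s j * eta_quot r s (z + 24 * of_int j / of_int l)"
    if b: "\<not> l dvd b" and d: "\<not> l dvd d" and j: "[b * j = - k * d] (mod l)" for b d j
  proof -
    have d': "\<not> l dvd p * d" using d prime_l l_not_dvd_p by (simp add: prime_dvd_mult_iff)
    have "[p * (b * j) = p * (- k * d)] (mod l)" using j by (rule cong_mult[OF cong_refl])
    hence j': "[b * (p * j) = - k * (p * d)] (mod l)" by (simp add: mult_ac)
    have e: "of_int p * (z + 24 * of_int j / of_int l) = of_int p * z + 24 * of_int (p * j) / of_int l"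
      by (simp add: algebra_simps)
    have 1: "R (l * b) d z * eta z = (chi12 l * of_int l) * inverse (gauss_sum l j) * eta (z + 24 * of_int j / of_int l)"
      unfolding R_eval_middle[OF b d j z] using e0 by (simp add: divide_inverse)
    have 2: "R (l * b) (p * d) (of_int p * z) * eta (of_int p * z)
       = (chi12 l * of_int l) * inverse (gauss_sum l (p * j)) * eta (of_int p * (z + 24 * of_int j / of_int l))"
      unfolding R_eval_middle[OF b d' j' pz] e using e0 by (simp add: divide_inverse)
    have "(chi12 l * of_int l) powi (r + s) = (chi12 l * of_int l) powi r * (chi12 l * of_int l) powi s"
      using l_pos chi12_l_nonzero by (intro power_int_add) auto
    thus ?thesis unfolding T_eq 1 2 eta_quot_def mid_factor_def power_int_mult_distrib power_int_inverse power_int_minus by (simp only: mult_ac)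
  qed
  let ?S1 = "\<Sum>j\<in>{0..<L}. eta_quot r s ((z + 24 * of_int j) / of_int L)"
  let ?S2 = "of_int l powi (r + s) * eta_quot r s (of_int L * z) + (\<Sum>j\<in>{1..<l}. mid_factor r s j * eta_quot r s (z + 24 * of_int j / of_int l))"
  have S1: "(\<Sum>d\<in>{0..<L}. T c d) = ?S1" if c: "\<not> l dvd c" for c
  proof -
    obtain c' where c': "[c * c' = 1] (mod L)" using obtain_inverse[OF c] .
    let ?f = "\<lambda>j. eta_quot r s ((z + 24 * of_int j) / of_int L)"
    have j: "[c * (- k * c' * d + 0) = - k * d] (mod L)" for d
    proof -
      have "[c * c' * (- k * d) = 1 * (- k * d)] (mod L)" using c' by (rule cong_mult[OF _ cong_refl])
      thus ?thesis by (simp add: mult_ac)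
    qed
    have "\<not> l dvd c'"
    proof
      assume "l dvd c'"
      moreover have "[c * c' = 1] (mod l)" using c' by (rule cong_dvd_modulus) simp
      ultimately have "l dvd 1" using cong_dvd_iff by (metis dvd_mult)
      thus False using l_gt by simp
    qed
    hence cop: "coprime (- k * c') L" unfolding coprime_l(2) using L_not_dvd_k prime_l by (simp add: prime_dvd_mult_iff)
    have "(\<Sum>d\<in>{0..<L}. T c d) = (\<Sum>d\<in>{0..<L}. ?f (- k * c' * d + 0))" by (intro sum.cong refl T1[OF c j])
    also have "\<dots> = ?S1"
    proof (rule sum_residues_affine[OF L_pos cop])
      fix n
      have "(z + 24 * of_int (n + L)) / of_int L = (z + 24 * of_int n) / of_int L + 24" using L_pos by (simp add: field_simps)
      thus "?f (n + L) = ?f n" by (simp only: eta_quot_T_24)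
    qed
    finally show ?thesis .
  qed
  have S2: "(\<Sum>b\<in>{0..<l}. T (l * b) d) = ?S2" if d: "\<not> l dvd d" for d
  proof -
    have "{0..<l} = insert 0 {1..<l}" using l_pos by auto
    hence "(\<Sum>b\<in>{0..<l}. T (l * b) d) = T (l * 0) d + (\<Sum>b\<in>{1..<l}. T (l * b) d)" by simp
    also have "(\<Sum>b\<in>{1..<l}. T (l * b) d) = (\<Sum>j\<in>{1..<l}. mid_factor r s j * eta_quot r s (z + 24 * of_int j / of_int l))"
    proof (rule sum_residue_involution[OF prime_l, of "k * d"])
      show "\<not> l dvd k * d" using L_not_dvd_k d prime_l by (simp add: prime_dvd_mult_iff)
      fix b j assume bj: "b \<in> {1..<l}" "j \<in> {1..<l}" "l dvd k * d + b * j"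
      have "\<not> l dvd b" using bj(1) zdvd_not_zless by auto
      moreover have "[b * j = - k * d] (mod l)" using bj(3) by (simp add: cong_iff_dvd_diff add.commute)
      ultimately show "T (l * b) d = mid_factor r s j * eta_quot r s (z + 24 * of_int j / of_int l)" using d by (intro T3)
    qed
    finally show ?thesis unfolding T2[OF d] .
  qed
  have "conj_sum r s z * eta_quot r s z = (\<Sum>(c,d)\<in>V. T c d)"
    unfolding conj_sum_def T_def sum_distrib_right by (intro sum.cong refl) auto
  also have "\<dots> = (\<Sum>(c,d)\<in>{0..<L} \<times> {0..<L}. if l dvd c \<and> l dvd d then 0 else T c d)"
    by (rule sum.mono_neutral_cong_left) (auto simp: V_def)
  also have "\<dots> = (\<Sum>c\<in>{0..<L}. \<Sum>d\<in>{0..<L}. if l dvd c \<and> l dvd d then 0 else T c d)"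
    by (simp add: sum.cartesian_product)
  \<comment> \<open>The two kinds of pairs need opposite orders of summation: the inner sum has to
    be the one that does not depend on the outer unit.\<close>
  also have "\<dots> = (\<Sum>c\<in>{0..<L}. (if l dvd c then 0 else ?S1) + (\<Sum>d\<in>{0..<L}. if l dvd d then 0 else if l dvd c then T c d else 0))"
  proof (rule sum.cong[OF refl])
    fix c
    show "(\<Sum>d\<in>{0..<L}. if l dvd c \<and> l dvd d then 0 else T c d) = (if l dvd c then 0 else ?S1) + (\<Sum>d\<in>{0..<L}. if l dvd d then 0 else if l dvd c then T c d else 0)"
    proof (cases "l dvd c")
      case True thus ?thesis by (auto intro!: sum.cong)
    next
      case False
      have "(\<Sum>d\<in>{0..<L}. if l dvd d then 0 else if l dvd c then T c d else 0) = 0"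
        using False by (intro sum.neutral) auto
      thus ?thesis using False S1[OF False] by simp
    qed
  qed
  also have "\<dots> = (\<Sum>c\<in>{0..<L}. if l dvd c then 0 else ?S1) + (\<Sum>d\<in>{0..<L}. \<Sum>c\<in>{0..<L}. if l dvd d then 0 else if l dvd c then T c d else 0)"
    unfolding sum.distrib by (subst sum.swap[of _ "{0..<L}" "{0..<L}"]) (rule refl)
  also have "(\<Sum>d\<in>{0..<L}. \<Sum>c\<in>{0..<L}. if l dvd d then 0 else if l dvd c then T c d else 0) = (\<Sum>d\<in>{0..<L}. if l dvd d then 0 else ?S2)"
  proof (rule sum.cong[OF refl])
    fix d
    show "(\<Sum>c\<in>{0..<L}. if l dvd d then 0 else if l dvd c then T c d else 0) = (if l dvd d then 0 else ?S2)"
      using sum_multiples_l[of "\<lambda>c. T c d"] S2[of d] by (cases "l dvd d") auto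
  qed
  finally show ?thesis unfolding sum_units hecke_sum_def by (simp only: distrib_left add_ac)
qed

text \<open>At the cusp 0 everything is expressed in \<open>w = (z + j) / p\<close>. Scaling one
  pair by \<open>p\<close> and a linear substitution of determinant \<open>p\<close> in
  \<open>V\<close> turn the summand into that of \<open>conj_sum\<close> with \<open>r\<close> and
  \<open>s\<close> exchanged, and the weight-two factor into \<open>- 1 / p\<close> times the one at
  infinity.\<close>

lemma trace_form_eq:
  assumes z: "z \<in> upper"
  shows "trace_form r s z = (of_int p * eta_logderiv (of_int p * z) - eta_logderiv z) * conj_sum r s z
     - (\<Sum>j\<in>{0..<p}. (of_int p * eta_logderiv (of_int p * ((z + of_int j) / of_int p)) - eta_logderiv ((z + of_int j) / of_int p)) * conj_sum s r ((z + of_int j) / of_int p)) / of_int p"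
proof -
  have 1: "(\<Sum>(c,d)\<in>V. trace_inf r s c d z) = (of_int p * eta_logderiv (of_int p * z) - eta_logderiv z) * conj_sum r s z"
    unfolding trace_inf_def conj_sum_def sum_distrib_left by (intro sum.cong refl) auto
  have 2: "(\<Sum>(c,d)\<in>V. trace_fin r s j c d z) = - ((of_int p * eta_logderiv (of_int p * ((z + of_int j) / of_int p)) - eta_logderiv ((z + of_int j) / of_int p)) * conj_sum s r ((z + of_int j) / of_int p) / of_int p)" for j
  proof -
    define w where "w = (z + of_int j) / of_int p"
    have pw: "of_int p * w = z + of_int j" using p_pos by (simp add: w_def)
    have lz: "eta_logderiv (of_int p * w) = eta_logderiv z" unfolding pw by (rule eta_logderiv_T_int[OF z])
    have Rz: "R c d z = R c (d - j * c) (of_int p * w)" if "\<not> (l dvd c \<and> l dvd d)" for c d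
    proof -
      have nd: "\<not> (l dvd c \<and> l dvd d - j * c)" using that by (metis dvd_diff_left_iff dvd_mult)
      have "R c (d - j * c) (mob 1 j 0 1 z) = R (c * 1 + (d - j * c) * 0) (c * j + (d - j * c) * 1) z"
        by (rule R_mob[OF _ z nd]) simp
      moreover have "mob 1 j 0 1 z = of_int p * w" unfolding pw by (simp add: mob_def)
      ultimately show ?thesis by (simp add: algebra_simps)
    qed
    define f where "f = (\<lambda>c d. R c (p * d) (of_int p * w) powi r * R c d w powi s)"
    have fcong: "f c d = f c' d'" if "[c = c'] (mod L)" "[d = d'] (mod L)" for c d c' d'
      unfolding f_def using R_cong[OF that] R_cong[OF that(1) cong_mult[OF cong_refl that(2), of p]] by simp
    have "(\<Sum>(c,d)\<in>V. R c d z powi r * R (p * c) (d - j * c) w powi s) = (\<Sum>(c,d)\<in>V. f (p * c + 0 * d) (- j * c + 1 * d))"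
    proof (rule sum.cong[OF refl], clarify)
      fix c d assume cd: "(c, d) \<in> V"
      have "R c (d - j * c) = R (p * c) (p * (d - j * c))" by (rule R_scale[OF l_not_dvd_p, symmetric])
      thus "R c d z powi r * R (p * c) (d - j * c) w powi s = f (p * c + 0 * d) (- j * c + 1 * d)"
        unfolding f_def Rz[OF V_D[OF cd]] by (simp add: algebra_simps)
    qed
    also have "\<dots> = (\<Sum>(c,d)\<in>V. f c d)" by (rule V_reindex) (use fcong l_not_dvd_p in auto)
    also have "\<dots> = conj_sum s r w" unfolding conj_sum_def f_def by (intro sum.cong refl) (auto simp: mult.commute)
    finally have N: "(\<Sum>(c,d)\<in>V. R c d z powi r * R (p * c) (d - j * c) w powi s) = conj_sum s r w" .
    have "(\<Sum>(c,d)\<in>V. trace_fin r s j c d z) = (eta_logderiv w / of_int p - eta_logderiv z) * (\<Sum>(c,d)\<in>V. R c d z powi r * R (p * c) (d - j * c) w powi s)"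
      unfolding trace_fin_def w_def[symmetric] sum_distrib_left by (intro sum.cong refl) auto
    also have "eta_logderiv w / of_int p - eta_logderiv z = - ((of_int p * eta_logderiv (of_int p * w) - eta_logderiv w) / of_int p)"
      unfolding lz using p_pos by (simp add: field_simps)
    finally show ?thesis unfolding N w_def[symmetric] by simp
  qed
  show ?thesis unfolding trace_form_def 1 2 by (simp add: sum_negf sum_divide_distrib)
qed

end

section \<open>Expansions at the cusps\<close>

definition complex_fps :: "rat fps \<Rightarrow> complex fps" where "complex_fps f = Abs_fps (\<lambda>n. of_rat (fps_nth f n))"

lemma complex_fps_nth [simp]: "fps_nth (complex_fps f) n = of_rat (fps_nth f n)" by (simp add: complex_fps_def)
lemma complex_fps_1 [simp]: "complex_fps 1 = 1" by (simp add: fps_eq_iff)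
lemma complex_fps_add: "complex_fps (f + g) = complex_fps f + complex_fps g" by (simp add: fps_eq_iff of_rat_add)
lemma complex_fps_diff: "complex_fps (f - g) = complex_fps f - complex_fps g" by (simp add: fps_eq_iff of_rat_diff)
lemma complex_fps_mult: "complex_fps (f * g) = complex_fps f * complex_fps g"
  by (simp add: fps_eq_iff fps_mult_nth of_rat_sum of_rat_mult)
lemma complex_fps_power: "complex_fps (f ^ n) = complex_fps f ^ n" by (induction n) (simp_all add: complex_fps_mult)
lemma complex_fps_X: "complex_fps fps_X = fps_X" by (simp add: fps_eq_iff fps_X_nth)
lemma complex_fps_const: "complex_fps (fps_const c) = fps_const (of_rat c)" by (simp add: fps_eq_iff)
lemma complex_fps_deriv: "complex_fps (fps_deriv f) = fps_deriv (complex_fps f)"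
  by (simp add: fps_eq_iff of_rat_mult of_rat_add)
lemma complex_fps_prod: "complex_fps (\<Prod>x\<in>A. f x) = (\<Prod>x\<in>A. complex_fps (f x))"
  by (induction A rule: infinite_finite_induct) (simp_all add: complex_fps_mult)

lemma complex_fps_inverse:
  assumes "fps_nth f 0 \<noteq> 0"
  shows "complex_fps (inverse f) = inverse (complex_fps f)"
proof -
  have "complex_fps f * complex_fps (inverse f) = 1"
    by (simp only: complex_fps_mult[symmetric] inverse_mult_eq_1'[OF assms] complex_fps_1)
  thus ?thesis using assms by (intro fps_inverse_unique[symmetric])
qed

lemma complex_fps_powi: "fps_nth f 0 \<noteq> 0 \<Longrightarrow> complex_fps (f powi n) = complex_fps f powi n"
  by (simp add: power_int_def complex_fps_power complex_fps_inverse)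

lemma complex_fps_compose_X_power:
  assumes "n > 0"
  shows "complex_fps (f oo fps_X ^ n) = complex_fps f oo fps_X ^ n"
  using assms by (simp add: fps_eq_iff fps_nth_compose_X_power)

lemma tendsto_fps_mult':
  fixes f g :: "'x \<Rightarrow> 'a :: comm_ring_1 fps"
  assumes "(f \<longlongrightarrow> F) A" "(g \<longlongrightarrow> G) A"
  shows "((\<lambda>x. f x * g x) \<longlongrightarrow> F * G) A"
proof (rule tendsto_fpsI)
  fix n
  have "eventually (\<lambda>x. \<forall>i\<in>{..n}. fps_nth (f x) i = fps_nth F i) A" "eventually (\<lambda>x. \<forall>i\<in>{..n}. fps_nth (g x) i = fps_nth G i) A"
    using assms by (simp_all add: eventually_ball_finite tendsto_fps_iff)
  thus "eventually (\<lambda>x. fps_nth (f x * g x) n = fps_nth (F * G) n) A"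
    by eventually_elim (auto simp: fps_mult_nth intro!: sum.cong)
qed

lemma tendsto_fps_inverse':
  fixes f :: "'x \<Rightarrow> rat fps"
  assumes "(f \<longlongrightarrow> F) A" "\<And>x. fps_nth (f x) 0 = 1"
  shows "((\<lambda>x. inverse (f x)) \<longlongrightarrow> inverse F) A"
proof (cases "A = bot")
  case False
  have "eventually (\<lambda>x. fps_nth (f x) 0 = fps_nth F 0) A" using assms(1) by (simp add: tendsto_fps_iff)
  then obtain x where "fps_nth (f x) 0 = fps_nth F 0" using eventually_happens'[OF False] by blast
  hence F0: "fps_nth F 0 = 1" using assms(2)[of x] by simp
  show ?thesis
  proof (rule tendsto_fpsI)
    fix n
    have "eventually (\<lambda>x. \<forall>i\<in>{..n}. fps_nth (f x) i = fps_nth F i) A"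
      using assms by (simp add: eventually_ball_finite tendsto_fps_iff)
    thus "eventually (\<lambda>x. fps_nth (inverse (f x)) n = fps_nth (inverse F) n) A"
    proof eventually_elim
      case (elim x)
      have "inverse (f x) - inverse F = inverse (f x) * inverse F * (F - f x)"
      proof -
        have "inverse (f x) * f x = 1" "inverse F * F = 1" using assms(2) F0 by (simp_all add: inverse_mult_eq_1)
        moreover have "inverse (f x) * inverse F * (F - f x) = inverse (f x) * (inverse F * F) - inverse (f x) * f x * inverse F"
          by (simp add: algebra_simps)
        ultimately show ?thesis by (simp only: mult_1_left mult_1_right)
      qed
      moreover have "fps_nth (inverse (f x) * inverse F * (F - f x)) n = 0"
        unfolding fps_mult_nth[of "inverse (f x) * inverse F"] using elim by (intro sum.neutral) auto
      ultimately have "fps_nth (inverse (f x) - inverse F) n = 0" by simp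
      thus ?case by simp
    qed
  qed
qed simp

lemma tendsto_fps_power':
  fixes f :: "'x \<Rightarrow> 'a :: comm_ring_1 fps"
  assumes "(f \<longlongrightarrow> F) A"
  shows "((\<lambda>x. f x ^ n) \<longlongrightarrow> F ^ n) A"
  by (induction n) (simp_all add: tendsto_fps_mult' assms)

lemma tendsto_fps_powi:
  fixes f :: "'x \<Rightarrow> rat fps"
  assumes "(f \<longlongrightarrow> F) A" "\<And>x. fps_nth (f x) 0 = 1"
  shows "((\<lambda>x. f x powi n) \<longlongrightarrow> F powi n) A"
  unfolding power_int_def
  using tendsto_fps_power'[OF assms(1)] tendsto_fps_power'[OF tendsto_fps_inverse'[of f, OF assms]] by auto

lemma fps_powi_prod:
  fixes f :: "'x \<Rightarrow> rat fps"
  shows "(\<Prod>x\<in>A. f x) powi n = (\<Prod>x\<in>A. f x powi n)"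
proof -
  have "inverse (\<Prod>x\<in>A. f x) = (\<Prod>x\<in>A. inverse (f x))"
    by (induction A rule: infinite_finite_induct) (simp_all add: fps_inverse_mult)
  thus ?thesis unfolding power_int_def by (simp add: prod_power_distrib)
qed

section \<open>The Euler product and E_2 as expansions at q = 0\<close>

definition euler_fps :: "rat fps" where "euler_fps = eta_prod 1 1 0"

abbreviation euler_part :: "nat \<Rightarrow> rat fps" where "euler_part n \<equiv> \<Prod>k\<le>n. 1 - fps_X ^ Suc k"

lemma euler_part_0: "fps_nth (euler_part n) 0 = 1" by (induction n) auto

lemma euler_part_tendsto: "euler_part \<longlonglongrightarrow> euler_fps"
  using has_prod_imp_tendsto[OF eta_prod_has_prod(1)[of 1 1 0]] by (simp add: euler_fps_def)

lemma euler_fps_0: "fps_nth euler_fps 0 = 1"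
  unfolding euler_fps_def by (rule eta_prod_has_prod(2)) simp

text \<open>The splitting is clear for partial products, and it survives in the limit because
  products and integer powers of series with constant term 1 are continuous in the X-adic
  topology.\<close>

lemma eta_prod_eq_euler:
  assumes p: "p > 0"
  shows "eta_prod p a b = euler_fps powi a * (euler_fps oo fps_X ^ p) powi b"
proof (rule LIMSEQ_unique)
  show "(\<lambda>n. \<Prod>k\<le>n. (1 - fps_X ^ Suc k) powi a * (1 - fps_X ^ (p * Suc k)) powi b) \<longlonglongrightarrow> eta_prod p a b"
    by (rule has_prod_imp_tendsto[OF eta_prod_has_prod(1)[OF p]])
  have 0: "fps_nth (fps_X ^ p :: rat fps) 0 = 0" using p by simp
  have comp: "(\<Prod>k\<le>n. 1 - fps_X ^ (p * Suc k)) = euler_part n oo fps_X ^ p" for n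
    unfolding fps_compose_prod_distrib[OF 0]
    by (intro prod.cong refl)
       (simp only: fps_compose_sub_distrib fps_compose_1 fps_compose_power[OF 0, symmetric] fps_X_fps_compose_startby0[OF 0] power_mult)
  have "(\<lambda>n. euler_part n oo fps_X ^ p) \<longlonglongrightarrow> (euler_fps oo fps_X ^ p)"
    using euler_part_tendsto p unfolding tendsto_fps_iff by (auto simp: fps_nth_compose_X_power)
  moreover have "fps_nth (euler_part n oo fps_X ^ p) 0 = 1" for n by (simp add: euler_part_0 del: power_Suc)
  ultimately have "(\<lambda>n. euler_part n powi a * (euler_part n oo fps_X ^ p) powi b) \<longlonglongrightarrow> euler_fps powi a * (euler_fps oo fps_X ^ p) powi b"
    by (intro tendsto_fps_mult' tendsto_fps_powi euler_part_tendsto euler_part_0)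
  moreover have "(\<Prod>k\<le>n. (1 - fps_X ^ Suc k) powi a * (1 - fps_X ^ (p * Suc k)) powi b) = euler_part n powi a * (euler_part n oo fps_X ^ p) powi b" for n
    unfolding prod.distrib comp[symmetric] fps_powi_prod ..
  ultimately show "(\<lambda>n. \<Prod>k\<le>n. (1 - fps_X ^ Suc k) powi a * (1 - fps_X ^ (p * Suc k)) powi b) \<longlonglongrightarrow> euler_fps powi a * (euler_fps oo fps_X ^ p) powi b"
    by simp
qed

text \<open>The partial products converge uniformly on a disc as functions and coefficientwise as
  power series, so the two limits correspond.\<close>

lemma phi_expansion: "phi has_fps_expansion complex_fps euler_fps"
proof -
  have hol: "phi holomorphic_on ball 0 1" by (rule phi_holomorphic)
  have exp: "phi has_fps_expansion fps_expansion phi 0"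
    by (rule has_fps_expansion_fps_expansion[OF _ _ hol]) auto
  have "fps_expansion phi 0 = complex_fps euler_fps"
  proof (rule uniform_limit_imp_fps_expansion_eq[where F = sequentially and A = "ball 0 (1/2)"
        and f = "\<lambda>n. complex_fps (euler_part n)" and f' = "\<lambda>n q. \<Prod>k\<le>n. 1 - q ^ Suc k"])
    show "(\<lambda>n. complex_fps (euler_part n)) \<longlonglongrightarrow> complex_fps euler_fps"
      using euler_part_tendsto unfolding tendsto_fps_iff by (auto elim!: eventually_mono)
    have "uniform_limit (cball 0 (1/2)) (\<lambda>N q. \<Prod>n<N. 1 - q ^ Suc n) phi sequentially"
      by (rule phi_uniformly_convergent) simp
    hence "uniform_limit (cball 0 (1/2)) (\<lambda>N q. \<Prod>n<Suc N. 1 - q ^ Suc n) phi sequentially"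
      using filterlim_compose[OF _ filterlim_Suc] by blast
    hence "uniform_limit (cball 0 (1/2)) (\<lambda>N q. \<Prod>n\<le>N. 1 - q ^ Suc n) phi sequentially"
      by (simp only: lessThan_Suc_atMost)
    thus "uniform_limit (ball 0 (1/2)) (\<lambda>N q. \<Prod>n\<le>N. 1 - q ^ Suc n) phi sequentially"
      by (rule uniform_limit_on_subset) auto
    have "(\<lambda>q. \<Prod>k\<le>n. 1 - q ^ Suc k) has_fps_expansion complex_fps (euler_part n)" for n
      unfolding complex_fps_prod complex_fps_diff complex_fps_1 complex_fps_power complex_fps_X by (intro fps_expansion_intros)
    thus "\<forall>\<^sub>F n in sequentially. (\<lambda>q. \<Prod>k\<le>n. 1 - q ^ Suc k) has_fps_expansion complex_fps (euler_part n)" by simp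
  qed (use exp in \<open>auto intro!: holomorphic_intros always_eventually\<close>)
  thus ?thesis using exp by simp
qed

lemma has_fps_expansion_powi:
  fixes F :: "complex fps"
  assumes "f has_fps_expansion F" "fps_nth F 0 \<noteq> 0"
  shows "(\<lambda>q. f q powi n) has_fps_expansion F powi n"
  unfolding power_int_def using assms by (auto intro!: fps_expansion_intros)

lemma has_fps_expansion_compose_power:
  fixes F :: "complex fps"
  assumes "f has_fps_expansion F" "p > 0"
  shows "(\<lambda>q. f (q ^ p)) has_fps_expansion (F oo fps_X ^ p)"
  using has_fps_expansion_compose[OF assms(1) has_fps_expansion_fps_X_power[of p]] assms(2) by (simp add: o_def)

lemma Phi_expansion:
  assumes "p > 0"
  shows "(\<lambda>q. phi q powi a * phi (q ^ p) powi b) has_fps_expansion complex_fps (eta_prod p a b)"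
proof -
  have "complex_fps (eta_prod p a b) = complex_fps euler_fps powi a * (complex_fps euler_fps oo fps_X ^ p) powi b"
    using assms by (simp add: eta_prod_eq_euler complex_fps_mult complex_fps_powi euler_fps_0 complex_fps_compose_X_power)
  thus ?thesis using assms euler_fps_0
    by (auto intro!: fps_expansion_intros has_fps_expansion_powi has_fps_expansion_compose_power phi_expansion)
qed

lemma fps_geometric_nth:
  "fps_nth (fps_X ^ Suc k * inverse (1 - fps_X ^ Suc k) :: rat fps) m = (if m > 0 \<and> Suc k dvd m then 1 else 0)"
proof -
  let ?g = "Abs_fps (\<lambda>m. if m > 0 \<and> Suc k dvd m then 1 else 0) :: rat fps"
  have "?g * (1 - fps_X ^ Suc k) = fps_X ^ Suc k"
  proof (rule fps_ext)
    fix n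
    have "fps_nth (?g * (1 - fps_X ^ Suc k)) n = fps_nth ?g n - (if n < Suc k then 0 else fps_nth ?g (n - Suc k))"
      by (simp only: right_diff_distrib mult_1_right fps_sub_nth fps_X_power_mult_right_nth)
    also have "\<dots> = (if n = Suc k then 1 else 0)"
      by (auto simp: dvd_minus_self dest: dvd_imp_le)
    finally show "fps_nth (?g * (1 - fps_X ^ Suc k)) n = fps_nth (fps_X ^ Suc k) n" by (simp only: fps_X_power_nth)
  qed
  moreover have "fps_nth (1 - fps_X ^ Suc k :: rat fps) 0 \<noteq> 0" by simp
  ultimately have "fps_X ^ Suc k * inverse (1 - fps_X ^ Suc k) = ?g"
    by (metis (no_types, lifting) inverse_mult_eq_1' mult.assoc mult.right_neutral)
  thus ?thesis by (simp del: power_Suc)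
qed

text \<open>Logarithmic differentiation of the factor 1 - X^m contributes - m X^m / (1 - X^m). In
  the resulting Lambert series the coefficient of X^n collects the divisors \<open>m\<close> of
  \<open>n\<close>.\<close>

lemma euler_logderiv:
  "fps_X * fps_deriv euler_fps = - (euler_fps * Abs_fps (\<lambda>n. if n \<ge> 1 then of_nat (divisor_sigma n) else 0))"
proof (rule LIMSEQ_unique)
  define S where "S = (\<lambda>n. \<Sum>k\<le>n. fps_const (of_nat (Suc k)) * (fps_X ^ Suc k * inverse (1 - fps_X ^ Suc k)) :: rat fps)"
  have step: "fps_X * fps_deriv (euler_part n) = - (euler_part n * S n)" for n
  proof (induction n)
    case (Suc n)
    define u where "u = (1 - fps_X ^ Suc (Suc n) :: rat fps)"
    have u: "u * inverse u = 1" by (rule inverse_mult_eq_1') (simp add: u_def)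
    have du: "fps_X * fps_deriv u = - (fps_const (of_nat (Suc (Suc n))) * fps_X ^ Suc (Suc n))"
    proof (rule fps_ext)
      fix m
      show "fps_nth (fps_X * fps_deriv u) m = fps_nth (- (fps_const (of_nat (Suc (Suc n))) * fps_X ^ Suc (Suc n))) m"
        by (cases m) (auto simp: u_def fps_X_power_nth simp del: power_Suc)
    qed
    have Sn: "S (Suc n) = S n + fps_const (of_nat (Suc (Suc n))) * (fps_X ^ Suc (Suc n) * inverse u)"
      by (simp add: S_def u_def del: power_Suc)
    have E: "euler_part (Suc n) = euler_part n * u" by (simp add: u_def del: power_Suc)
    have "fps_X * fps_deriv (euler_part n * u) = fps_X * fps_deriv (euler_part n) * u + euler_part n * (fps_X * fps_deriv u)"
      by (simp add: algebra_simps)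
    also have "\<dots> = - (euler_part n * u * S n) - euler_part n * (fps_const (of_nat (Suc (Suc n))) * fps_X ^ Suc (Suc n)) * (u * inverse u)"
      unfolding Suc.IH du u by (simp add: algebra_simps del: power_Suc)
    also have "\<dots> = - (euler_part n * u * S (Suc n))" unfolding Sn by (simp add: algebra_simps del: power_Suc)
    finally show ?case unfolding E .
  next
    case 0
    define u where "u = (1 - fps_X :: rat fps)"
    have u: "u * inverse u = 1" by (rule inverse_mult_eq_1') (simp add: u_def)
    have "u * (fps_X * inverse u) = fps_X" using u by (metis mult.left_commute mult.right_neutral)
    thus ?case by (simp add: S_def u_def)
  qed
  have "(\<lambda>n. fps_X * fps_deriv (euler_part n)) \<longlonglongrightarrow> fps_X * fps_deriv euler_fps"
    using euler_part_tendsto unfolding tendsto_fps_iff by (auto elim!: eventually_mono)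
  thus "(\<lambda>n. - (euler_part n * S n)) \<longlonglongrightarrow> fps_X * fps_deriv euler_fps" by (simp only: step)
  have "S \<longlonglongrightarrow> Abs_fps (\<lambda>n. if n \<ge> 1 then of_nat (divisor_sigma n) else 0)"
  proof (rule tendsto_fpsI)
    fix m
    show "\<forall>\<^sub>F n in sequentially. fps_nth (S n) m = fps_nth (Abs_fps (\<lambda>n. if n \<ge> 1 then of_nat (divisor_sigma n) else 0)) m"
      using eventually_ge_at_top[of m]
    proof eventually_elim
      case (elim n)
      have "fps_nth (S n) m = (\<Sum>k\<le>n. if m > 0 \<and> Suc k dvd m then of_nat (Suc k) else 0)"
        unfolding S_def fps_sum_nth fps_mult_left_const_nth fps_geometric_nth by (intro sum.cong) auto
      also have "\<dots> = (if m \<ge> 1 then of_nat (divisor_sigma m) else 0)"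
      proof (cases "m = 0")
        case False
        have "(\<Sum>k\<le>n. if m > 0 \<and> Suc k dvd m then of_nat (Suc k) else 0) = (\<Sum>k\<in>{k\<in>{..n}. m > 0 \<and> Suc k dvd m}. of_nat (Suc k) :: rat)"
          by (rule sum.inter_filter[symmetric]) simp
        also have "\<dots> = (\<Sum>d\<in>{d. d dvd m}. of_nat d)"
        proof (rule sum.reindex_bij_witness[of _ "\<lambda>d. d - 1" Suc])
          fix d assume d: "d \<in> {d. d dvd m}"
          hence "d > 0" "d \<le> m" using False dvd_imp_le by (auto intro: Nat.gr0I)
          thus "Suc (d - 1) = d" "d - 1 \<in> {k\<in>{..n}. m > 0 \<and> Suc k dvd m}" using d False elim by auto
        qed auto
        finally have "(\<Sum>k\<le>n. if m > 0 \<and> Suc k dvd m then of_nat (Suc k) else 0) = (\<Sum>d\<in>{d. d dvd m}. of_nat d :: rat)" .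
        thus ?thesis using False by (simp add: divisor_sigma_def)
      qed simp
      finally show ?case by simp
    qed
  qed
  from tendsto_fps_mult'[OF euler_part_tendsto this]
  show "(\<lambda>n. - (euler_part n * S n)) \<longlonglongrightarrow> - (euler_fps * Abs_fps (\<lambda>n. if n \<ge> 1 then of_nat (divisor_sigma n) else 0))"
    unfolding tendsto_fps_iff by (auto elim!: eventually_mono)
qed

lemma E2_euler: "E2 = 1 + 24 * (fps_X * fps_deriv euler_fps * inverse euler_fps)"
proof -
  have "euler_fps * inverse euler_fps = 1" by (rule inverse_mult_eq_1') (simp add: euler_fps_0)
  thus ?thesis unfolding euler_logderiv E2_def by (simp add: algebra_simps)
qed

text \<open>The analytic form of \<open>E2\<close>, modelled on \<open>E2_euler\<close>, so that its
  expansion follows from that of \<open>phi\<close>.\<close>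

definition e2 :: "complex \<Rightarrow> complex" where
  "e2 q = 1 + 24 * (q * deriv phi q * inverse (phi q))"

lemma e2_expansion: "e2 has_fps_expansion complex_fps E2"
proof -
  have 24: "complex_fps 24 = 24" using complex_fps_const[of 24] by (simp add: numeral_fps_const)
  have "complex_fps E2 = 1 + 24 * (fps_X * fps_deriv (complex_fps euler_fps) * inverse (complex_fps euler_fps))"
    unfolding E2_euler by (simp add: complex_fps_add complex_fps_mult 24 complex_fps_X complex_fps_deriv complex_fps_inverse euler_fps_0)
  thus ?thesis unfolding e2_def[abs_def] by (auto intro!: fps_expansion_intros phi_expansion simp: euler_fps_0)
qed

lemma eta_logderiv_eq_e2:
  assumes z: "z \<in> upper"
  shows "eta_logderiv z = 2 * of_real pi * \<i> / 24 * e2 (ee z)"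
proof -
  have q: "ee z \<in> ball 0 1" using ee_upper[OF z] by simp
  have nz: "phi (ee z) \<noteq> 0" using phi_nonzero ee_upper[OF z] by blast
  have dphi: "(phi has_field_derivative deriv phi (ee z)) (at (ee z))"
    by (rule holomorphic_derivI[OF phi_holomorphic open_ball q])
  have dee: "(ee has_field_derivative 2 * of_real pi * \<i> * ee z) (at z)"
    using ee_has_field_derivative[of "\<lambda>z. z" 1 z UNIV] by simp
  have "((\<lambda>z. ee (z / 24) * phi (ee z)) has_field_derivative
      ee (z / 24) * (deriv phi (ee z) * (2 * of_real pi * \<i> * ee z)) + 2 * of_real pi * \<i> * (1 / 24) * ee (z / 24) * phi (ee z)) (at z)"
  proof (rule DERIV_mult')
    show "((\<lambda>z. ee (z / 24)) has_field_derivative 2 * of_real pi * \<i> * (1 / 24) * ee (z / 24)) (at z)"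
      by (auto intro!: derivative_eq_intros)
    show "((\<lambda>z. phi (ee z)) has_field_derivative deriv phi (ee z) * (2 * of_real pi * \<i> * ee z)) (at z)"
      by (rule DERIV_chain2[OF dphi dee])
  qed
  hence "(eta has_field_derivative
      ee (z / 24) * (deriv phi (ee z) * (2 * of_real pi * \<i> * ee z)) + 2 * of_real pi * \<i> * (1 / 24) * ee (z / 24) * phi (ee z)) (at z)"
    by (rule has_field_derivative_transform_within_open[OF _ open_upper z]) (rule eta_eq_phi[symmetric])
  hence "deriv eta z = ee (z / 24) * (deriv phi (ee z) * (2 * of_real pi * \<i> * ee z)) + 2 * of_real pi * \<i> * (1 / 24) * ee (z / 24) * phi (ee z)"
    by (rule DERIV_imp_deriv)
  thus ?thesis unfolding eta_logderiv_def eta_eq_phi[OF z] e2_def using nz by (simp add: field_simps)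
qed

lemma Ep_star_0:
  assumes "p \<ge> 2"
  shows "fps_nth (Ep_star p) 0 = 1"
proof -
  have c: "(of_nat p - 1 :: rat fps) = fps_const (of_nat p - 1)" by (simp add: fps_of_nat flip: fps_const_sub)
  have "(of_nat p - 1 :: rat) \<noteq> 0" using assms by auto
  thus ?thesis unfolding Ep_star_def c using assms
    by (simp add: fps_divide_unit fps_const_inverse E2_def fps_of_nat[symmetric])
qed

lemma Ep_star_expansion:
  assumes p: "p \<ge> 2"
  shows "(\<lambda>q. (of_nat p * e2 (q ^ p) - e2 q) / (of_nat p - 1)) has_fps_expansion complex_fps (Ep_star p)"
proof -
  have c: "(of_nat p - 1 :: rat fps) = fps_const (of_nat p - 1)" by (simp add: fps_of_nat flip: fps_const_sub)
  have c0: "(of_nat p - 1 :: rat) \<noteq> 0" using p by auto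
  have "Ep_star p = (fps_const (of_nat p) * (E2 oo fps_X ^ p) - E2) * fps_const (inverse (of_nat p - 1))"
    unfolding Ep_star_def c using c0 by (simp add: fps_divide_unit fps_const_inverse fps_of_nat)
  hence "complex_fps (Ep_star p) = (fps_const (of_nat p) * (complex_fps E2 oo fps_X ^ p) - complex_fps E2) * fps_const (inverse (of_nat p - 1))"
    using p by (simp add: complex_fps_mult complex_fps_diff complex_fps_const complex_fps_compose_X_power of_rat_inverse of_rat_diff)
  moreover have "(\<lambda>q. (of_nat p * e2 (q ^ p) - e2 q) * inverse (of_nat p - 1)) has_fps_expansion
      (fps_const (of_nat p) * (complex_fps E2 oo fps_X ^ p) - complex_fps E2) * fps_const (inverse (of_nat p - 1))"
    using p by (intro fps_expansion_intros has_fps_expansion_compose_power e2_expansion) auto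
  ultimately show ?thesis by (simp add: divide_inverse)
qed

section \<open>Fourier coefficients of the Hecke sum\<close>

lemma sign_powi_odd:
  fixes x :: complex
  assumes "x = 1 \<or> x = - 1" "odd n"
  shows "x powi n = x"
  using assms by (auto simp: power_int_minus_left_odd)

lemma sign_powi_minus:
  fixes x :: complex
  assumes "x = 1 \<or> x = - 1"
  shows "x powi (- n) = x powi n"
  using assms by (cases "even n") (auto simp: power_int_minus_left_odd power_int_minus_left_even)

lemma Legendre_sign: "\<not> l dvd a \<Longrightarrow> Legendre a l = 1 \<or> Legendre a l = - 1"
  by (simp add: Legendre_def cong_0_iff)

context weil_p
begin

text \<open>Indexed by all integers, with 0 at negative ones, so that the substitutions in the Hecke
  operator need no case distinction.\<close>

definition quot_coeff :: "int \<Rightarrow> int \<Rightarrow> int \<Rightarrow> complex" where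
  "quot_coeff r s n = (if n \<ge> 0 then of_rat (fps_nth (eta_prod (nat p) r s) (nat n)) else 0)"

definition quot_order :: "int \<Rightarrow> int \<Rightarrow> complex" where "quot_order r s = of_int (r + p * s) / 24"

text \<open>This is the Delta of the theorem, or Delta* when \<open>r\<close> and \<open>s\<close>
  are exchanged. Multiplying the exponent \<open>n + quot_order r s\<close> by \<open>L\<close>
  gives \<open>(L * n + hecke_shift r s) + quot_order r s\<close>.\<close>

definition hecke_shift :: "int \<Rightarrow> int \<Rightarrow> int" where "hecke_shift r s = k * (r + p * s)"

text \<open>The Gauss sum has exponent \<open>- (r + s)\<close> from the conjugates and one more
  from the summation over the cosets.\<close>

definition mid_const :: "int \<Rightarrow> int \<Rightarrow> complex" where
  "mid_const r s = (chi12 l * of_int l) powi (r + s) * gauss_sum l 1 powi (1 - (r + s)) * of_int (Legendre p l) powi s"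

text \<open>The coefficients of $\eta(z)^r\eta(pz)^s$ under the Hecke operator $T(\ell^2)$ of half-integral
  weight, up to normalization.\<close>

definition hecke_coeff :: "int \<Rightarrow> int \<Rightarrow> int \<Rightarrow> complex" where
  "hecke_coeff r s m = of_int l powi (r + s) * (if L dvd m - hecke_shift r s then quot_coeff r s ((m - hecke_shift r s) div L) else 0)
     + mid_const r s * of_int (Legendre (24 * m + (r + p * s)) l) * quot_coeff r s m
     + of_int L * quot_coeff r s (L * m + hecke_shift r s)"

lemma quot_order_hecke_shift: "of_int (hecke_shift r s) + quot_order r s = of_int L * quot_order r s"
proof -
  have "(of_int L :: complex) = 1 + 24 * of_int k" using lk by (metis of_int_1 of_int_add of_int_mult of_int_numeral)
  thus ?thesis unfolding hecke_shift_def quot_order_def by (simp add: algebra_simps add_divide_distrib)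
qed

definition Phi :: "int \<Rightarrow> int \<Rightarrow> complex \<Rightarrow> complex" where
  "Phi r s q = phi q powi r * phi (q ^ nat p) powi s"

lemma norm_power_p: "norm (q :: complex) < 1 \<Longrightarrow> norm (q ^ nat p) < 1"
  using p_pos power_less_one_iff[of "norm q" "nat p"] by (simp add: norm_power)

lemma Phi_holomorphic: "Phi r s holomorphic_on ball 0 1"
proof -
  have "(phi \<circ> (\<lambda>q. q ^ nat p)) holomorphic_on ball 0 1"
    by (rule holomorphic_on_compose_gen[OF _ phi_holomorphic]) (auto intro!: holomorphic_intros norm_power_p)
  thus ?thesis unfolding Phi_def[abs_def] o_def
    by (intro holomorphic_intros phi_holomorphic) (auto intro!: phi_nonzero norm_power_p)
qed

lemma Phi_nonzero: "norm q < 1 \<Longrightarrow> Phi r s q \<noteq> 0"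
  unfolding Phi_def using phi_nonzero norm_power_p by simp

lemma Phi_eta_prod_expansion: "Phi r s has_fps_expansion complex_fps (eta_prod (nat p) r s)"
  unfolding Phi_def[abs_def] using p_pos by (intro Phi_expansion) simp

lemma ee_p: "ee (of_int p * z) = ee z ^ nat p"
  using ee_of_nat_mult[of "nat p" z] p_pos by simp

lemma eta_quot_eq:
  assumes z: "z \<in> upper"
  shows "eta_quot r s z = ee (quot_order r s * z) * Phi r s (ee z)"
proof -
  have "eta_quot r s z = ee (z / 24) powi r * ee (of_int p * z / 24) powi s * Phi r s (ee z)"
    unfolding eta_quot_def eta_eq_phi[OF z] eta_eq_phi[OF upper_mult[OF z]] ee_p Phi_def power_int_mult_distrib by (simp only: mult_ac)
  also have "ee (z / 24) powi r * ee (of_int p * z / 24) powi s = ee (quot_order r s * z)"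
    unfolding ee_of_int_mult[symmetric] ee_add[symmetric] quot_order_def
    by (intro arg_cong[of _ _ ee]) (simp add: field_simps)
  finally show ?thesis .
qed

lemma eta_quot_has_sum:
  assumes z: "z \<in> upper"
  shows "((\<lambda>n. quot_coeff r s n * ee ((of_int n + quot_order r s) * z)) has_sum eta_quot r s z) UNIV"
proof -
  let ?F = "complex_fps (eta_prod (nat p) r s)"
  have q: "norm (ee z) < 1" by (rule ee_upper[OF z])
  have hol: "Phi r s holomorphic_on eball 0 (ereal 1)" using Phi_holomorphic by simp
  have "(\<lambda>n. fps_nth ?F n * ee z ^ n) sums Phi r s (ee z)"
    by (rule has_fps_expansion_imp_sums_complex[OF Phi_eta_prod_expansion hol]) (use q in simp)
  moreover have "summable (\<lambda>n. norm (fps_nth ?F n * ee z ^ n))"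
  proof (rule abs_summable_in_conv_radius)
    have "ereal 1 \<le> fps_conv_radius ?F" by (rule holomorphic_on_imp_fps_conv_radius_ge[OF Phi_eta_prod_expansion hol])
    moreover have "ereal (norm (ee z)) < ereal 1" using q by simp
    ultimately show "ereal (norm (ee z)) < conv_radius (fps_nth ?F)" unfolding fps_conv_radius_def by order
  qed
  ultimately have "((\<lambda>n. fps_nth ?F n * ee z ^ n) has_sum Phi r s (ee z)) UNIV"
    by (intro norm_summable_imp_has_sum)
  hence "((\<lambda>n. ee (quot_order r s * z) * (fps_nth ?F n * ee z ^ n)) has_sum (ee (quot_order r s * z) * Phi r s (ee z))) UNIV"
    by (rule has_sum_cmult_right)
  moreover have "ee (quot_order r s * z) * (fps_nth ?F n * ee z ^ n) = quot_coeff r s (int n) * ee ((of_int (int n) + quot_order r s) * z)" for n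
  proof -
    have "ee ((of_int (int n) + quot_order r s) * z) = ee z ^ n * ee (quot_order r s * z)"
      unfolding ee_of_nat_mult[symmetric] ee_add[symmetric] by (simp add: distrib_right)
    thus ?thesis by (simp add: quot_coeff_def)
  qed
  ultimately have "(((\<lambda>n. quot_coeff r s n * ee ((of_int n + quot_order r s) * z)) \<circ> int) has_sum eta_quot r s z) UNIV"
    unfolding eta_quot_eq[OF z] o_def by simp
  hence "((\<lambda>n. quot_coeff r s n * ee ((of_int n + quot_order r s) * z)) has_sum eta_quot r s z) (range int)"
    by (subst has_sum_reindex) auto
  also have "?this \<longleftrightarrow> ?thesis"
  proof (rule has_sum_cong_neutral)
    fix n :: int assume "n \<in> UNIV - range int"
    hence "n < 0" by (metis DiffD2 not_less nonneg_int_cases rangeI)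
    thus "quot_coeff r s n * ee ((of_int n + quot_order r s) * z) = 0" by (simp add: quot_coeff_def)
  qed auto
  finally show ?thesis .
qed

text \<open>Each Gauss sum is a Legendre symbol times \<open>gauss_sum l 1\<close>. As
  \<open>r + s\<close> is odd, the symbols of \<open>j\<close> combine to a single one, and the sum
  over \<open>j\<close> is again a Gauss sum, now twisted by \<open>x\<close>.\<close>

lemma sum_mid_factor:
  assumes odd: "odd (r + s)"
  shows "(\<Sum>j\<in>{1..<l}. mid_factor r s j * ee (of_int (x * j) / of_int l)) = mid_const r s * of_int (Legendre x l)"
proof -
  define G where "G = gauss_sum l 1"
  have G0: "G \<noteq> 0" unfolding G_def using gauss_sum_nonzero[OF prime_l l_gt2, of 1] l_gt by simp
  define a where "a = (chi12 l * of_int l) powi (r + s) * G powi (- (r + s)) * of_int (Legendre p l) powi s"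
  have mid_factor: "mid_factor r s j = a * of_int (Legendre j l)" if j: "j \<in> {1..<l}" for j
  proof -
    have nj: "\<not> l dvd j" using j zdvd_not_zless by auto
    have npj: "\<not> l dvd p * j" using nj l_not_dvd_p prime_l by (simp add: prime_dvd_mult_iff)
    define x y where "x = (of_int (Legendre j l) :: complex)" and "y = (of_int (Legendre p l) :: complex)"
    have x: "x = 1 \<or> x = - 1" using Legendre_sign[OF nj] by (auto simp: x_def)
    have y: "y = 1 \<or> y = - 1" using Legendre_sign[OF l_not_dvd_p] by (auto simp: y_def)
    have g1: "gauss_sum l j = x * G" unfolding x_def G_def by (rule gauss_sum_Legendre[OF prime_l l_gt2 nj])
    have g2: "gauss_sum l (p * j) = y * (x * G)"
      unfolding gauss_sum_Legendre[OF prime_l l_gt2 npj] Legendre_mult[OF prime_l l_gt2] x_def y_def G_def by simp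
    have "gauss_sum l j powi (- r) * gauss_sum l (p * j) powi (- s)
       = (x powi (- r) * x powi (- s)) * (G powi (- r) * G powi (- s)) * y powi (- s)"
      unfolding g1 g2 power_int_mult_distrib by (simp only: mult_ac)
    also have "x powi (- r) * x powi (- s) = x powi (- (r + s))" using x by (subst power_int_add[symmetric]) auto
    also have "\<dots> = x" using odd by (intro sign_powi_odd[OF x]) simp
    also have "G powi (- r) * G powi (- s) = G powi (- (r + s))" using G0 by (subst power_int_add[symmetric]) auto
    also have "y powi (- s) = y powi s" by (rule sign_powi_minus[OF y])
    finally show ?thesis unfolding mid_factor_def a_def x_def y_def by (simp only: mult_ac)
  qed
  have "(\<Sum>j\<in>{1..<l}. mid_factor r s j * ee (of_int (x * j) / of_int l)) = a * (\<Sum>j\<in>{1..<l}. of_int (Legendre j l) * ee (of_int (x * j) / of_int l))"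
    unfolding sum_distrib_left by (intro sum.cong refl) (simp add: mid_factor mult.assoc)
  also have "(\<Sum>j\<in>{1..<l}. of_int (Legendre j l) * ee (of_int (x * j) / of_int l)) = (\<Sum>j\<in>{0..<l}. of_int (Legendre j l) * ee (of_int (x * j) / of_int l))"
  proof (rule sum.mono_neutral_left)
    show "\<forall>i\<in>{0..<l} - {1..<l}. of_int (Legendre i l) * ee (of_int (x * i) / of_int l) = 0"
    proof
      fix i assume "i \<in> {0..<l} - {1..<l}"
      hence "i = 0" by auto
      thus "of_int (Legendre i l) * ee (of_int (x * i) / of_int l) = 0" by (simp add: Legendre_def)
    qed
  qed auto
  also have "\<dots> = of_int (Legendre x l) * G" unfolding G_def by (rule sum_Legendre_ee[OF prime_l l_gt2])
  also have "a * (of_int (Legendre x l) * G) = mid_const r s * of_int (Legendre x l)"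
  proof -
    have "G powi (1 - (r + s)) = G powi (1 + - (r + s))" by (simp only: diff_conv_add_uminus)
    also have "\<dots> = G powi 1 * G powi (- (r + s))" by (rule power_int_add) (use G0 in simp)
    finally have "G powi (1 - (r + s)) = G * G powi (- (r + s))" by (simp only: power_int_1_right)
    thus ?thesis unfolding a_def mid_const_def G_def[symmetric] by (simp only: mult_ac)
  qed
  finally show ?thesis .
qed

lemma has_sum_sum':
  fixes f :: "'a \<Rightarrow> int \<Rightarrow> complex"
  assumes "\<And>a. a \<in> A \<Longrightarrow> (f a has_sum S a) UNIV"
  shows "((\<lambda>n. \<Sum>a\<in>A. f a n) has_sum (\<Sum>a\<in>A. S a)) UNIV"
  using assms by (induction A rule: infinite_finite_induct) (auto intro!: has_sum_add)

text \<open>The first part moves the exponents by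
  \<open>n \<mapsto> L * n + hecke_shift r s\<close>, the second multiplies coefficients by Legendre
  symbols. In the third, summing over \<open>j\<close> keeps only the \<open>n\<close> with
  \<open>L dvd 24 * n + t\<close>, which are those of the form
  \<open>L * m + hecke_shift r s\<close>.\<close>

lemma hecke_sum_has_sum:
  assumes z: "z \<in> upper" and odd: "odd (r + s)"
  shows "((\<lambda>m. hecke_coeff r s m * ee ((of_int m + quot_order r s) * z)) has_sum hecke_sum r s z) UNIV"
proof -
  define t where "t = r + p * s"
  define D where "D = hecke_shift r s"
  let ?e = "\<lambda>m::int. ee ((of_int m + quot_order r s) * z)"
  have LC: "(of_int L :: complex) \<noteq> 0" using L_pos by simp
  have Lz: "of_int L * z \<in> upper" using z L_pos by (simp add: upper_def)
  have exL: "(of_int n + quot_order r s) * (of_int L * z) = (of_int (L * n + D) + quot_order r s) * z" for n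
    using quot_order_hecke_shift[of r s] unfolding D_def by (simp add: algebra_simps) (metis distrib_left mult.assoc)
  have inj: "inj (\<lambda>n. L * n + D)" using L_pos by (auto simp: inj_def)
  have range: "range (\<lambda>n. L * n + D) = {m. L dvd m - D}"
  proof (intro Set.set_eqI iffI)
    fix m assume "m \<in> {m. L dvd m - D}"
    then obtain n where "m - D = L * n" by blast
    thus "m \<in> range (\<lambda>n. L * n + D)" by (intro image_eqI[of _ _ n]) auto
  qed auto
  have 1: "((\<lambda>m. (if L dvd m - D then quot_coeff r s ((m - D) div L) else 0) * ?e m) has_sum eta_quot r s (of_int L * z)) UNIV"
  proof -
    have "(((\<lambda>m. quot_coeff r s ((m - D) div L) * ?e m) \<circ> (\<lambda>n. L * n + D)) has_sum eta_quot r s (of_int L * z)) UNIV"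
      using eta_quot_has_sum[OF Lz, of r s] L_pos unfolding exL by (simp add: o_def)
    hence "((\<lambda>m. quot_coeff r s ((m - D) div L) * ?e m) has_sum eta_quot r s (of_int L * z)) {m. L dvd m - D}"
      unfolding range[symmetric] has_sum_reindex[OF inj] .
    also have "?this \<longleftrightarrow> ?thesis" by (rule has_sum_cong_neutral) auto
    finally show ?thesis .
  qed
  have 2: "((\<lambda>m. mid_const r s * of_int (Legendre (24 * m + t) l) * quot_coeff r s m * ?e m) has_sum (\<Sum>j\<in>{1..<l}. mid_factor r s j * eta_quot r s (z + 24 * of_int j / of_int l))) UNIV"
  proof -
    have "((\<lambda>m. \<Sum>j\<in>{1..<l}. mid_factor r s j * (quot_coeff r s m * ee ((of_int m + quot_order r s) * (z + 24 * of_int j / of_int l)))) has_sum (\<Sum>j\<in>{1..<l}. mid_factor r s j * eta_quot r s (z + 24 * of_int j / of_int l))) UNIV"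
      by (intro has_sum_sum' has_sum_cmult_right eta_quot_has_sum upper_middle z)
    moreover have "(\<Sum>j\<in>{1..<l}. mid_factor r s j * (quot_coeff r s m * ee ((of_int m + quot_order r s) * (z + 24 * of_int j / of_int l)))) = mid_const r s * of_int (Legendre (24 * m + t) l) * quot_coeff r s m * ?e m" for m
    proof -
      have "ee ((of_int m + quot_order r s) * (z + 24 * of_int j / of_int l)) = ?e m * ee (of_int ((24 * m + t) * j) / of_int l)" for j
      proof -
        have "(of_int m + quot_order r s) * (24 * of_int j / of_int l) = of_int ((24 * m + t) * j) / of_int l"
          unfolding quot_order_def t_def using l_pos by (simp add: field_simps)
        thus ?thesis by (simp only: distrib_left ee_add)
      qed
      hence "(\<Sum>j\<in>{1..<l}. mid_factor r s j * (quot_coeff r s m * ee ((of_int m + quot_order r s) * (z + 24 * of_int j / of_int l))))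
        = quot_coeff r s m * ?e m * (\<Sum>j\<in>{1..<l}. mid_factor r s j * ee (of_int ((24 * m + t) * j) / of_int l))"
        unfolding sum_distrib_left by (intro sum.cong refl) (simp only: mult_ac)
      thus ?thesis unfolding sum_mid_factor[OF odd] by (simp only: mult_ac)
    qed
    ultimately show ?thesis by simp
  qed
  have 3: "((\<lambda>m. of_int L * quot_coeff r s (L * m + D) * ?e m) has_sum (\<Sum>j\<in>{0..<L}. eta_quot r s ((z + 24 * of_int j) / of_int L))) UNIV"
  proof -
    let ?g = "\<lambda>n. if L dvd n - D then of_int L * (quot_coeff r s n * ee ((of_int n + quot_order r s) * (z / of_int L))) else 0"
    have "((\<lambda>n. \<Sum>j\<in>{0..<L}. quot_coeff r s n * ee ((of_int n + quot_order r s) * ((z + 24 * of_int j) / of_int L))) has_sum (\<Sum>j\<in>{0..<L}. eta_quot r s ((z + 24 * of_int j) / of_int L))) UNIV"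
      by (intro has_sum_sum' eta_quot_has_sum upper_affine z L_pos)
    moreover have "(\<Sum>j\<in>{0..<L}. quot_coeff r s n * ee ((of_int n + quot_order r s) * ((z + 24 * of_int j) / of_int L))) = ?g n" for n
    proof -
      have "ee ((of_int n + quot_order r s) * ((z + 24 * of_int j) / of_int L)) = ee ((of_int n + quot_order r s) * (z / of_int L)) * ee (of_int ((24 * n + t) * j) / of_int L)" for j
      proof -
        have "(of_int n + quot_order r s) * ((z + 24 * of_int j) / of_int L) = (of_int n + quot_order r s) * (z / of_int L) + of_int ((24 * n + t) * j) / of_int L"
          unfolding quot_order_def t_def using LC by (simp add: field_simps)
        thus ?thesis by (simp only: ee_add)
      qed
      hence "(\<Sum>j\<in>{0..<L}. quot_coeff r s n * ee ((of_int n + quot_order r s) * ((z + 24 * of_int j) / of_int L)))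
        = quot_coeff r s n * ee ((of_int n + quot_order r s) * (z / of_int L)) * (\<Sum>j\<in>{0..<L}. ee (of_int ((24 * n + t) * j) / of_int L))"
        unfolding sum_distrib_left by (intro sum.cong refl) (simp only: mult_ac)
      also have "\<dots> = quot_coeff r s n * ee ((of_int n + quot_order r s) * (z / of_int L)) * (if L dvd 24 * n + t then of_int L else 0)"
        unfolding sum_ee_frac[OF L_pos] ..
      also have "L dvd 24 * n + t \<longleftrightarrow> L dvd n - D"
      proof -
        have "24 * n + t = 24 * (n - D) + L * t" unfolding D_def hecke_shift_def t_def lk by (simp add: algebra_simps)
        hence "L dvd 24 * n + t \<longleftrightarrow> L dvd 24 * (n - D)" by (simp only: dvd_add_left_iff dvd_triv_left)
        also have "coprime L 24"
        proof (rule coprimeI)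
          fix c :: int assume "c dvd L" "c dvd 24"
          hence "c dvd L - 24 * k" by (intro dvd_diff dvd_mult2)
          thus "is_unit c" using lk by simp
        qed
        hence "L dvd 24 * (n - D) \<longleftrightarrow> L dvd n - D" by (rule coprime_dvd_mult_right_iff)
        finally show ?thesis .
      qed
      finally show ?thesis by (simp add: mult_ac)
    qed
    ultimately have "(?g has_sum (\<Sum>j\<in>{0..<L}. eta_quot r s ((z + 24 * of_int j) / of_int L))) UNIV" by simp
    also have "?this \<longleftrightarrow> ((\<lambda>n. of_int L * (quot_coeff r s n * ee ((of_int n + quot_order r s) * (z / of_int L)))) has_sum (\<Sum>j\<in>{0..<L}. eta_quot r s ((z + 24 * of_int j) / of_int L))) (range (\<lambda>n. L * n + D))"
      unfolding range by (rule has_sum_cong_neutral) auto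
    also have "\<dots> \<longleftrightarrow> ((\<lambda>m. of_int L * (quot_coeff r s (L * m + D) * ee ((of_int (L * m + D) + quot_order r s) * (z / of_int L)))) has_sum (\<Sum>j\<in>{0..<L}. eta_quot r s ((z + 24 * of_int j) / of_int L))) UNIV"
      unfolding has_sum_reindex[OF inj] o_def ..
    also have "(\<lambda>m. of_int L * (quot_coeff r s (L * m + D) * ee ((of_int (L * m + D) + quot_order r s) * (z / of_int L)))) = (\<lambda>m. of_int L * quot_coeff r s (L * m + D) * ?e m)"
    proof
      fix m
      have "(of_int (L * m + D) + quot_order r s) * (z / of_int L) = (of_int m + quot_order r s) * (of_int L * (z / of_int L))"
        using exL[of m] LC by (simp add: field_simps)
      also have "of_int L * (z / of_int L) = z" using LC by simp
      finally show "of_int L * (quot_coeff r s (L * m + D) * ee ((of_int (L * m + D) + quot_order r s) * (z / of_int L))) = of_int L * quot_coeff r s (L * m + D) * ?e m" by simp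
    qed
    finally show ?thesis .
  qed
  have "hecke_coeff r s m * ?e m = of_int l powi (r + s) * ((if L dvd m - D then quot_coeff r s ((m - D) div L) else 0) * ?e m)
      + mid_const r s * of_int (Legendre (24 * m + t) l) * quot_coeff r s m * ?e m + of_int L * quot_coeff r s (L * m + D) * ?e m" for m
    unfolding hecke_coeff_def D_def t_def by (simp only: distrib_right mult.assoc)
  thus ?thesis unfolding hecke_sum_def
    using has_sum_add[OF has_sum_add[OF has_sum_cmult_right[OF 1, of "of_int l powi (r + s)"] 2] 3] by simp
qed

end

section \<open>The constant term of the trace\<close>

lemma fps_taylor_remainder:
  fixes T :: "complex fps"
  assumes h: "h has_fps_expansion T"
  obtains \<rho> where "\<And>q. q \<noteq> 0 \<Longrightarrow> h q = (\<Sum>n\<le>M. fps_nth T n * q ^ n) + q ^ M * \<rho> q" "(\<rho> \<longlongrightarrow> 0) (at 0)"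
proof
  \<comment> \<open>Normalized by \<open>q ^ M\<close> so that the remainder still tends to 0 after
    a pole of order \<open>M\<close> has been restored.\<close>
  define \<rho> where "\<rho> = (\<lambda>q. (h q - (\<Sum>n\<le>M. fps_nth T n * q ^ n)) / q ^ M)"
  show "h q = (\<Sum>n\<le>M. fps_nth T n * q ^ n) + q ^ M * \<rho> q" if "q \<noteq> 0" for q
    using that by (simp add: \<rho>_def)
  define T' where "T' = T - (\<Sum>n\<le>M. fps_const (fps_nth T n) * fps_X ^ n)"
  define g where "g = eval_fps (fps_shift (Suc M) T')"
  have T'_0: "fps_nth T' i = 0" if "i < Suc M" for i
    using that by (simp add: T'_def fps_sum_nth fps_X_power_nth if_distrib[of "\<lambda>x. _ * x"] cong: if_cong)
  have e1: "(\<lambda>q. h q - (\<Sum>n\<le>M. fps_nth T n * q ^ n)) has_fps_expansion T'"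
    unfolding T'_def by (intro fps_expansion_intros h)
  have "fps_conv_radius (fps_shift (Suc M) T') > 0"
    using e1 by (simp add: has_fps_expansion_def)
  hence g: "g has_fps_expansion fps_shift (Suc M) T'" unfolding g_def by (rule eval_fps_has_fps_expansion)
  have "T' = fps_X ^ Suc M * fps_shift (Suc M) T'"
    by (rule fps_ext) (use T'_0 in \<open>auto simp: fps_X_power_mult_nth simp del: power_Suc\<close>)
  moreover have "(\<lambda>q. q ^ Suc M * g q) has_fps_expansion fps_X ^ Suc M * fps_shift (Suc M) T'"
    by (intro fps_expansion_intros g)
  ultimately have e2: "(\<lambda>q. q ^ Suc M * g q) has_fps_expansion T'" by simp
  have "\<forall>\<^sub>F q in nhds 0. h q - (\<Sum>n\<le>M. fps_nth T n * q ^ n) = q ^ Suc M * g q"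
    using e1 e2 unfolding has_fps_expansion_def by (auto elim: eventually_elim2)
  hence "\<forall>\<^sub>F q in at 0. h q - (\<Sum>n\<le>M. fps_nth T n * q ^ n) = q ^ Suc M * g q"
    by (simp add: eventually_nhds_conv_at)
  hence ev: "\<forall>\<^sub>F q in at 0. q * g q = \<rho> q"
    using eventually_neq_at_within[of 0] by eventually_elim (simp add: \<rho>_def)
  have "isCont g 0" using has_fps_expansion_imp_continuous[OF g, of UNIV] by simp
  hence "((\<lambda>q. q * g q) \<longlongrightarrow> 0 * g 0) (at 0)" by (intro tendsto_intros) (simp add: isCont_def)
  hence "((\<lambda>q. q * g q) \<longlongrightarrow> 0) (at 0)" by simp
  thus "(\<rho> \<longlongrightarrow> 0) (at 0)" by (rule Lim_transform_eventually[OF _ ev])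
qed

lemma tendsto_0_ee:
  assumes "(\<rho> \<longlongrightarrow> 0) (at 0)" "e > 0"
  shows "\<exists>Y. \<forall>z. Im z \<ge> Y \<longrightarrow> norm (\<rho> (ee z)) \<le> (e :: real)"
proof -
  obtain d where d: "d > 0" "\<And>q. q \<noteq> 0 \<Longrightarrow> norm q < d \<Longrightarrow> norm (\<rho> q) < e"
    using assms unfolding tendsto_iff eventually_at dist_norm by (metis UNIV_I diff_zero)
  have "norm (\<rho> (ee z)) \<le> e" if z: "Im z \<ge> (1 - ln d) / (2 * pi)" for z
  proof -
    have "2 * pi * Im z \<ge> 1 - ln d" using z by (simp add: field_simps)
    hence "- (2 * pi * Im z) < ln d" by linarith
    hence "norm (ee z) < exp (ln d)" unfolding norm_ee by (simp only: exp_less_cancel_iff)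
    thus ?thesis using d by (intro less_imp_le) auto
  qed
  thus ?thesis by blast
qed

text \<open>A form in which the exponents are given through an index; terms with the same exponent
  are collected.\<close>

lemma weight2_constant_term_family:
  assumes "G holomorphic_on upper" "\<And>z. z \<in> upper \<Longrightarrow> G (z + 1) = G z" "\<And>z. z \<in> upper \<Longrightarrow> G (- 1 / z) = z^2 * G z"
    and N: "finite N" "\<And>n. n \<in> N \<Longrightarrow> \<nu> n \<noteq> (0::int)"
    and exp: "\<And>z. z \<in> upper \<Longrightarrow> G z = a + (\<Sum>n\<in>N. b n * ee (of_int (\<nu> n) * z)) + rem z"
    and rem: "\<And>e. e > 0 \<Longrightarrow> \<exists>Y. \<forall>z. Im z \<ge> Y \<longrightarrow> norm (rem z) \<le> e"
  shows "a = (0 :: complex)"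
proof (rule weight2_constant_term[OF assms(1-3), of "\<nu> ` N"])
  show "finite (\<nu> ` N)" "0 \<notin> \<nu> ` N" using N by auto
  fix z assume z: "z \<in> upper"
  have "(\<Sum>n\<in>N. b n * ee (of_int (\<nu> n) * z)) = (\<Sum>m\<in>\<nu> ` N. \<Sum>n\<in>{n. n \<in> N \<and> \<nu> n = m}. b n * ee (of_int (\<nu> n) * z))"
    by (rule sum.image_gen[OF N(1)])
  also have "\<dots> = (\<Sum>m\<in>\<nu> ` N. (\<Sum>n\<in>{n. n \<in> N \<and> \<nu> n = m}. b n) * ee (of_int m * z))"
    unfolding sum_distrib_right by (intro sum.cong refl) auto
  finally show "G z = a + (\<Sum>m\<in>\<nu> ` N. (\<Sum>n\<in>{n. n \<in> N \<and> \<nu> n = m}. b n) * ee (of_int m * z)) + rem z"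
    using exp[OF z] by simp
qed (use rem in auto)

context weil_p
begin

text \<open>Shifted by \<open>M\<close>, a bound for the pole order, to obtain a power series in
  q.\<close>

definition hecke_fps :: "int \<Rightarrow> int \<Rightarrow> nat \<Rightarrow> complex fps" where
  "hecke_fps r s M = Abs_fps (\<lambda>n. hecke_coeff r s (int n - int M))"

lemma hecke_sum_power_series:
  assumes odd: "odd (r + s)" and supp: "\<And>m. m < - int M \<Longrightarrow> hecke_coeff r s m = 0" and z: "z \<in> upper"
  shows "(\<lambda>n. fps_nth (hecke_fps r s M) n * ee z ^ n) sums (hecke_sum r s z / (ee (quot_order r s * z) * ee (- (of_nat M * z))))"
proof -
  let ?f = "\<lambda>m. hecke_coeff r s m * ee ((of_int m + quot_order r s) * z)"
  let ?c = "ee (quot_order r s * z) * ee (- (of_nat M * z))"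
  have "(?f has_sum hecke_sum r s z) UNIV" by (rule hecke_sum_has_sum[OF z odd])
  also have "?this \<longleftrightarrow> (?f has_sum hecke_sum r s z) (range (\<lambda>n. int n - int M))"
  proof (rule has_sum_cong_neutral)
    fix m assume "m \<in> UNIV - range (\<lambda>n. int n - int M)"
    moreover have "m \<in> range (\<lambda>n. int n - int M)" if "m \<ge> - int M"
      using that by (intro image_eqI[of _ _ "nat (m + int M)"]) auto
    ultimately have "m < - int M" by force
    thus "?f m = 0" using supp by simp
  qed auto
  also have "\<dots> \<longleftrightarrow> ((?f \<circ> (\<lambda>n. int n - int M)) has_sum hecke_sum r s z) UNIV"
    by (rule has_sum_reindex) (auto simp: inj_on_def)
  finally have "(?f \<circ> (\<lambda>n. int n - int M)) sums hecke_sum r s z" by (rule has_sum_imp_sums)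
  moreover have "?f \<circ> (\<lambda>n. int n - int M) = (\<lambda>n. ?c * (fps_nth (hecke_fps r s M) n * ee z ^ n))"
  proof
    fix n
    have "(of_int (int n - int M) + quot_order r s) * z = of_nat n * z + quot_order r s * z + - (of_nat M * z)"
      by (simp add: algebra_simps)
    hence "ee ((of_int (int n - int M) + quot_order r s) * z) = ee z ^ n * ee (quot_order r s * z) * ee (- (of_nat M * z))"
      by (simp only: ee_add ee_of_nat_mult)
    thus "(?f \<circ> (\<lambda>n. int n - int M)) n = ?c * (fps_nth (hecke_fps r s M) n * ee z ^ n)" by (simp add: hecke_fps_def)
  qed
  ultimately have "(\<lambda>n. ?c * (fps_nth (hecke_fps r s M) n * ee z ^ n)) sums hecke_sum r s z" by (simp only:)
  hence "(\<lambda>n. ?c * (fps_nth (hecke_fps r s M) n * ee z ^ n) / ?c) sums (hecke_sum r s z / ?c)" by (rule sums_divide)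
  thus ?thesis by simp
qed

definition Ep_star_fun :: "complex \<Rightarrow> complex" where
  "Ep_star_fun q = (of_nat (nat p) * e2 (q ^ nat p) - e2 q) / (of_nat (nat p) - 1)"

text \<open>In terms of q this is q^M E_p^* T(l^2)f / f, up to normalization of the Hecke operator:
  the prefactors e(\<open>quot_order\<close> z) of numerator and denominator have cancelled.\<close>

definition cusp_fun :: "int \<Rightarrow> int \<Rightarrow> nat \<Rightarrow> complex \<Rightarrow> complex" where
  "cusp_fun r s M q = eval_fps (hecke_fps r s M) q * Ep_star_fun q * inverse (Phi r s q)"

definition cusp_fps :: "int \<Rightarrow> int \<Rightarrow> nat \<Rightarrow> complex fps" where
  "cusp_fps r s M = hecke_fps r s M * complex_fps (Ep_star (nat p)) * inverse (complex_fps (eta_prod (nat p) r s))"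

text \<open>Combines the factor pi i / 12 between the logarithmic derivative and E_2, the
  denominator \<open>p - 1\<close> of E_p^*, and the multiplicity \<open>l * (l - 1)\<close> of each
  coset.\<close>

definition trace_const :: complex where
  "trace_const = 2 * of_real pi * \<i> / 24 * (of_int p - 1) * of_int (l * (l - 1))"

lemma p_ge_2: "p \<ge> 2" using prime_p by (rule prime_ge_2_int)

lemma trace_const_nonzero: "trace_const \<noteq> 0"
proof -
  have "(of_int p :: complex) \<noteq> 1" using p_ge_2 by auto
  moreover have "(of_int (l - 1) :: complex) \<noteq> 0" using l_gt by (simp only: of_int_eq_0_iff)
  ultimately show ?thesis using l_pos by (simp add: trace_const_def)
qed

lemma cusp_fun_expansion:
  assumes odd: "odd (r + s)" and supp: "\<And>m. m < - int M \<Longrightarrow> hecke_coeff r s m = 0"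
  shows "cusp_fun r s M has_fps_expansion cusp_fps r s M"
proof -
  have "\<i> \<in> upper" by (simp add: upper_def)
  \<comment> \<open>Convergence at the single nonzero point \<open>ee \<i>\<close> already gives a
    positive radius of convergence.\<close>
  from sums_summable[OF hecke_sum_power_series[OF odd supp this]]
  have "summable (\<lambda>n. fps_nth (hecke_fps r s M) n * ee \<i> ^ n)" by simp
  hence "ereal (norm (ee \<i>)) \<le> fps_conv_radius (hecke_fps r s M)" unfolding fps_conv_radius_def by (rule conv_radius_geI)
  moreover have "0 < ereal (norm (ee \<i>))" by simp
  ultimately have "fps_conv_radius (hecke_fps r s M) > 0" by order
  moreover have "fps_nth (eta_prod (nat p) r s) 0 = 1" using p_pos by (intro eta_prod_has_prod(2)) simp
  moreover have "Ep_star_fun has_fps_expansion complex_fps (Ep_star (nat p))"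
    unfolding Ep_star_fun_def[abs_def] using p_ge_2 by (intro Ep_star_expansion) simp
  ultimately show ?thesis unfolding cusp_fun_def[abs_def] cusp_fps_def
    by (intro fps_expansion_intros eval_fps_has_fps_expansion Phi_eta_prod_expansion) auto
qed

lemma logderiv_conj_sum_eq:
  assumes odd: "odd (r + s)" and supp: "\<And>m. m < - int M \<Longrightarrow> hecke_coeff r s m = 0" and z: "z \<in> upper"
  shows "(of_int p * eta_logderiv (of_int p * z) - eta_logderiv z) * conj_sum r s z = trace_const * (ee (- (of_nat M * z)) * cusp_fun r s M (ee z))"
proof -
  let ?c = "ee (quot_order r s * z) * ee (- (of_nat M * z))"
  have q: "norm (ee z) < 1" by (rule ee_upper[OF z])
  have "eval_fps (hecke_fps r s M) (ee z) = hecke_sum r s z / ?c"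
    unfolding eval_fps_def using hecke_sum_power_series[OF odd supp z] by (simp add: sums_iff)
  hence A: "hecke_sum r s z = ?c * eval_fps (hecke_fps r s M) (ee z)" by simp
  have N0: "conj_sum r s z = of_int (l * (l - 1)) * hecke_sum r s z / eta_quot r s z"
    using conj_sum_eval[OF z, of r s] eta_quot_nonzero[OF z, of r s] by (simp add: field_simps)
  have N: "conj_sum r s z = of_int (l * (l - 1)) * (ee (- (of_nat M * z)) * eval_fps (hecke_fps r s M) (ee z)) * inverse (Phi r s (ee z))"
    unfolding N0 A eta_quot_eq[OF z] using Phi_nonzero[OF q, of r s] by (simp add: divide_simps mult_ac)
  have p1: "(of_int p - 1 :: complex) \<noteq> 0" using p_ge_2 by auto
  have np: "(of_nat (nat p) :: complex) = of_int p" using p_pos by simp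
  have "of_int p * eta_logderiv (of_int p * z) - eta_logderiv z = 2 * of_real pi * \<i> / 24 * (of_int p * e2 (ee z ^ nat p) - e2 (ee z))"
    unfolding eta_logderiv_eq_e2[OF z] eta_logderiv_eq_e2[OF upper_mult[OF z]] ee_p by (simp add: algebra_simps)
  also have "of_int p * e2 (ee z ^ nat p) - e2 (ee z) = (of_int p - 1) * Ep_star_fun (ee z)"
    unfolding Ep_star_fun_def np using p1 by simp
  finally show ?thesis unfolding N trace_const_def cusp_fun_def by (simp only: mult_ac)
qed

text \<open>Averaging over \<open>j\<close> at the cusp 0 removes the exponents not divisible by
  \<open>p\<close> and leaves the constant term unchanged. Since this cusp enters
  \<open>trace_form_eq\<close> with a minus sign, the vanishing of the constant term of the trace is
  an equality of two constant terms.\<close>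

theorem constant_term_identity:
  assumes odd: "odd (r + s)" and supp1: "\<And>m. m < 0 \<Longrightarrow> hecke_coeff r s m = 0"
    and supp2: "\<And>m. m < - int M \<Longrightarrow> hecke_coeff s r m = 0"
  shows "fps_nth (cusp_fps r s 0) 0 = fps_nth (cusp_fps s r M) M"
proof -
  have odd': "odd (s + r)" using odd by (simp add: add.commute)
  have supp1': "hecke_coeff r s m = 0" if "m < - int 0" for m using supp1 that by simp
  obtain \<rho>1 where \<rho>1: "\<And>q. q \<noteq> 0 \<Longrightarrow> cusp_fun r s 0 q = (\<Sum>n\<le>0. fps_nth (cusp_fps r s 0) n * q ^ n) + q ^ 0 * \<rho>1 q" "(\<rho>1 \<longlongrightarrow> 0) (at 0)"
    using fps_taylor_remainder[OF cusp_fun_expansion[of r s 0, OF odd supp1'], of 0] by blast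
  obtain \<rho>2 where \<rho>2: "\<And>q. q \<noteq> 0 \<Longrightarrow> cusp_fun s r M q = (\<Sum>n\<le>M. fps_nth (cusp_fps s r M) n * q ^ n) + q ^ M * \<rho>2 q" "(\<rho>2 \<longlongrightarrow> 0) (at 0)"
    using fps_taylor_remainder[OF cusp_fun_expansion[of s r M, OF odd' supp2], of M] by blast
  define w where "w = (\<lambda>(z::complex) (j::int). (z + of_int j) / of_int p)"
  define T where "T = fps_nth (cusp_fps s r M)"
  define rem where "rem = (\<lambda>z. trace_const * \<rho>1 (ee z) - trace_const / of_int p * (\<Sum>j\<in>{0..<p}. \<rho>2 (ee (w z j))))"
  define a where "a = trace_const * (fps_nth (cusp_fps r s 0) 0 - T M)"
  \<comment> \<open>The polar exponents \<open>n - M\<close> that survive the average over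
    \<open>j\<close>; as powers of \<open>ee z\<close> they become \<open>\<nu> n\<close>.\<close>
  define N where "N = {n. n < M \<and> p dvd int n - int M}"
  define \<nu> where "\<nu> = (\<lambda>n. (int n - int M) div p)"
  have pC: "(of_int p :: complex) \<noteq> 0" using p_pos by simp
  have "a = 0"
  proof (rule weight2_constant_term_family[OF trace_form_holomorphic trace_form_T trace_form_S])
    show "finite N" by (simp add: N_def)
    show "\<nu> n \<noteq> 0" if "n \<in> N" for n
    proof
      assume "\<nu> n = 0"
      hence "int n - int M = 0" using that p_pos unfolding \<nu>_def N_def by (auto elim!: dvdE)
      thus False using that by (simp add: N_def)
    qed
    fix z assume z: "z \<in> upper"
    have wz: "w z j \<in> upper" for j unfolding w_def by (rule upper_div[OF z])
    have H1: "(of_int p * eta_logderiv (of_int p * z) - eta_logderiv z) * conj_sum r s z = trace_const * (fps_nth (cusp_fps r s 0) 0 + \<rho>1 (ee z))"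
      using logderiv_conj_sum_eq[of r s 0 z, OF odd supp1' z] \<rho>1(1)[of "ee z"] by simp
    have H2: "(of_int p * eta_logderiv (of_int p * w z j) - eta_logderiv (w z j)) * conj_sum s r (w z j)
       = trace_const * ((\<Sum>n\<le>M. T n * ee (of_int (int n - int M) * w z j)) + \<rho>2 (ee (w z j)))" for j
    proof -
      have e: "ee (- (of_nat M * w z j)) * ee (w z j) ^ n = ee (of_int (int n - int M) * w z j)" for n
        unfolding ee_of_nat_mult[symmetric] ee_add[symmetric] by (intro arg_cong[of _ _ ee]) (simp add: algebra_simps)
      have "ee (- (of_nat M * w z j)) * cusp_fun s r M (ee (w z j))
        = (\<Sum>n\<le>M. T n * (ee (- (of_nat M * w z j)) * ee (w z j) ^ n)) + (ee (- (of_nat M * w z j)) * ee (w z j) ^ M) * \<rho>2 (ee (w z j))"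
        unfolding \<rho>2(1)[OF ee_nonzero] T_def by (simp add: distrib_left sum_distrib_left mult_ac)
      thus ?thesis using logderiv_conj_sum_eq[of s r M "w z j", OF odd' supp2 wz] unfolding e by simp
    qed
    have inner: "(\<Sum>j\<in>{0..<p}. ee (of_int (int n - int M) * w z j)) = (if p dvd int n - int M then of_int p * ee (of_int (\<nu> n) * z) else 0)" for n
    proof -
      have "ee (of_int (int n - int M) * w z j) = ee (of_int (int n - int M) * z / of_int p) * ee (of_int ((int n - int M) * j) / of_int p)" for j
        unfolding ee_add[symmetric] w_def by (intro arg_cong[of _ _ ee]) (simp add: add_divide_distrib distrib_left)
      hence "(\<Sum>j\<in>{0..<p}. ee (of_int (int n - int M) * w z j)) = ee (of_int (int n - int M) * z / of_int p) * (if p dvd int n - int M then of_int p else 0)"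
        unfolding sum_ee_frac[OF p_pos, symmetric] sum_distrib_left by simp
      moreover have "of_int (int n - int M) * z / of_int p = of_int (\<nu> n) * z" if "p dvd int n - int M"
      proof -
        have "int n - int M = p * \<nu> n" unfolding \<nu>_def using that by simp
        hence "(of_int (int n - int M) :: complex) = of_int p * of_int (\<nu> n)" by (metis of_int_mult)
        thus ?thesis using pC by simp
      qed
      ultimately show ?thesis by auto
    qed
    have "(\<Sum>j\<in>{0..<p}. \<Sum>n\<le>M. T n * ee (of_int (int n - int M) * w z j)) = (\<Sum>n\<le>M. T n * (\<Sum>j\<in>{0..<p}. ee (of_int (int n - int M) * w z j)))"
      unfolding sum_distrib_left by (rule sum.swap)
    also have "\<dots> = (\<Sum>n\<le>M. if p dvd int n - int M then of_int p * (T n * ee (of_int (\<nu> n) * z)) else 0)"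
      unfolding inner by (intro sum.cong refl) auto
    also have "\<dots> = (\<Sum>n\<in>{n\<in>{..M}. p dvd int n - int M}. of_int p * (T n * ee (of_int (\<nu> n) * z)))"
      by (rule sum.inter_filter[symmetric]) simp
    also have "{n\<in>{..M}. p dvd int n - int M} = insert M N" by (auto simp: N_def)
    also have "(\<Sum>n\<in>insert M N. of_int p * (T n * ee (of_int (\<nu> n) * z))) = of_int p * (T M + (\<Sum>n\<in>N. T n * ee (of_int (\<nu> n) * z)))"
      by (subst sum.insert) (auto simp: N_def \<nu>_def sum_distrib_left distrib_left)
    finally have S: "(\<Sum>j\<in>{0..<p}. \<Sum>n\<le>M. T n * ee (of_int (int n - int M) * w z j)) = of_int p * (T M + (\<Sum>n\<in>N. T n * ee (of_int (\<nu> n) * z)))" .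
    have "trace_form r s z = trace_const * (fps_nth (cusp_fps r s 0) 0 + \<rho>1 (ee z))
      - (\<Sum>j\<in>{0..<p}. trace_const * ((\<Sum>n\<le>M. T n * ee (of_int (int n - int M) * w z j)) + \<rho>2 (ee (w z j)))) / of_int p"
      unfolding trace_form_eq[OF z] H1 H2[unfolded w_def] by (simp only: w_def)
    also have "(\<Sum>j\<in>{0..<p}. trace_const * ((\<Sum>n\<le>M. T n * ee (of_int (int n - int M) * w z j)) + \<rho>2 (ee (w z j))))
       = trace_const * (of_int p * (T M + (\<Sum>n\<in>N. T n * ee (of_int (\<nu> n) * z))) + (\<Sum>j\<in>{0..<p}. \<rho>2 (ee (w z j))))"
      unfolding sum_distrib_left[symmetric] sum.distrib S ..
    also have "trace_const * (fps_nth (cusp_fps r s 0) 0 + \<rho>1 (ee z)) - trace_const * (of_int p * (T M + (\<Sum>n\<in>N. T n * ee (of_int (\<nu> n) * z))) + (\<Sum>j\<in>{0..<p}. \<rho>2 (ee (w z j)))) / of_int p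
       = a + (\<Sum>n\<in>N. (- trace_const * T n) * ee (of_int (\<nu> n) * z)) + rem z"
    proof -
      have "(\<Sum>n\<in>N. (- trace_const * T n) * ee (of_int (\<nu> n) * z)) = - trace_const * (\<Sum>n\<in>N. T n * ee (of_int (\<nu> n) * z))"
        by (simp add: sum_distrib_left mult.assoc)
      thus ?thesis unfolding a_def rem_def using pC by (simp add: field_simps)
    qed
    finally show "trace_form r s z = a + (\<Sum>n\<in>N. (- trace_const * T n) * ee (of_int (\<nu> n) * z)) + rem z" .
  next
    fix e :: real assume e: "e > 0"
    define e' where "e' = e / (2 * norm trace_const)"
    have kp: "norm trace_const > 0" using trace_const_nonzero by simp
    have e': "e' > 0" using e kp by (simp add: e'_def)
    obtain Y1 where Y1: "\<And>z. Im z \<ge> Y1 \<Longrightarrow> norm (\<rho>1 (ee z)) \<le> e'" using tendsto_0_ee[OF \<rho>1(2) e'] by blast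
    obtain Y2 where Y2: "\<And>z. Im z \<ge> Y2 \<Longrightarrow> norm (\<rho>2 (ee z)) \<le> e'" using tendsto_0_ee[OF \<rho>2(2) e'] by blast
    show "\<exists>Y. \<forall>z. Im z \<ge> Y \<longrightarrow> norm (rem z) \<le> e"
    \<comment> \<open>The factor \<open>p\<close> is needed because the points \<open>w z j\<close>
      have imaginary part \<open>Im z / p\<close>.\<close>
    proof (intro exI[of _ "max Y1 (of_int p * Y2)"] allI impI)
      fix z assume z: "Im z \<ge> max Y1 (of_int p * Y2)"
      have "Im (w z j) \<ge> Y2" for j
      proof -
        have "Im (w z j) = Im z / of_int p" unfolding w_def using Im_divide_of_real[of "z + of_int j" "of_int p"] by simp
        moreover have "Y2 * real_of_int p \<le> Im z" using z by (simp add: mult.commute)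
        ultimately show ?thesis using p_pos by (simp add: le_divide_eq)
      qed
      hence "norm (\<Sum>j\<in>{0..<p}. \<rho>2 (ee (w z j))) \<le> (\<Sum>j\<in>{0..<p}. e')" by (intro sum_norm_le Y2)
      hence b2: "norm (\<Sum>j\<in>{0..<p}. \<rho>2 (ee (w z j))) \<le> of_int p * e'" using p_pos by simp
      have b1: "norm (\<rho>1 (ee z)) \<le> e'" using z by (intro Y1) simp
      have "norm (rem z) \<le> norm (trace_const * \<rho>1 (ee z)) + norm (trace_const / of_int p * (\<Sum>j\<in>{0..<p}. \<rho>2 (ee (w z j))))"
        unfolding rem_def by (rule norm_triangle_ineq4)
      also have "\<dots> \<le> norm trace_const * e' + norm trace_const / of_int p * (of_int p * e')"
        unfolding norm_mult norm_divide using b1 b2 p_pos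
        by (intro add_mono mult_mono) auto
      also have "\<dots> = e" using kp p_pos by (simp add: e'_def field_simps)
      finally show "norm (rem z) \<le> e" .
    qed
  qed
  thus ?thesis using trace_const_nonzero by (simp add: a_def T_def)
qed

end

section \<open>Evaluation of the constant terms\<close>

lemma prime_gt_3_mod_12:
  assumes "prime l" "l > (3::nat)"
  shows "int l mod 12 \<in> {1, 5, 7, 11}"
proof -
  have "\<not> 2 dvd l" using assms primes_dvd_imp_eq[of 2 l] by auto
  moreover have "\<not> 3 dvd l" using assms primes_dvd_imp_eq[of 3 l] by auto
  ultimately have "\<not> 2 dvd int l" "\<not> 3 dvd int l" by presburger+
  hence "int l mod 12 = 1 \<or> int l mod 12 = 5 \<or> int l mod 12 = 7 \<or> int l mod 12 = 11" by presburger
  thus ?thesis by simp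
qed

text \<open>Quadratic reciprocity expresses the symbol through \<open>l\<close> modulo 3 and the
  parity of (l - 1)/2, hence through \<open>l\<close> modulo 12.\<close>

lemma Legendre_3_eq_chi12:
  assumes l: "prime l" "l > (3::nat)"
  shows "of_int (Legendre 3 (int l)) = chi12 (int l)"
proof -
  have QR: "Legendre 3 (int l) * Legendre (int l) 3 = (- 1) ^ nat ((3 - 1) div 2 * ((int l - 1) div 2))"
    by (rule Quadratic_Reciprocity_int) (use l in auto)
  have L1: "Legendre 1 3 = 1" unfolding Legendre_def QuadRes_def by (auto simp: cong_def intro!: exI[of _ 1])
  have L2: "Legendre 2 3 = - 1"
  proof -
    have "y^2 mod 3 \<noteq> 2" for y :: int
    proof -
      have "y mod 3 = 0 \<or> y mod 3 = 1 \<or> y mod 3 = 2" by presburger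
      moreover have "y^2 mod 3 = (y mod 3)^2 mod 3" by (simp add: power_mod)
      ultimately show ?thesis by auto
    qed
    thus ?thesis unfolding Legendre_def QuadRes_def by (simp add: cong_def)
  qed
  have sign: "(- 1 :: int) ^ nat n = (if even n then 1 else - 1)" if "n \<ge> 0" for n
    using that by (simp add: even_nat_iff uminus_power_if)
  define h where "h = (int l - 1) div 2"
  have "h \<ge> 0" using l by (simp add: h_def)
  have QR': "Legendre 3 (int l) * Legendre (int l) 3 = (if even h then 1 else - 1)"
    unfolding QR sign[OF \<open>h \<ge> 0\<close>, symmetric] by (simp add: h_def)
  define q i where "q = int l div 12" and "i = int l mod 12"
  have i: "i \<in> {1, 5, 7, 11}" unfolding i_def by (rule prime_gt_3_mod_12[OF l])
  have lq: "int l = 12 * q + i" by (simp add: q_def i_def)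
  have mod3: "[int l = i mod 3] (mod 3)"
  proof -
    have "int l = i + 3 * (4 * q)" by (simp add: lq)
    thus ?thesis unfolding cong_def by (simp only: mod_mult_self2 mod_mod_trivial)
  qed
  have hq: "h = (i - 1) div 2 + 2 * (3 * q)"
  proof -
    have "int l - 1 = (i - 1) + 2 * (6 * q)" by (simp add: lq)
    thus ?thesis unfolding h_def by simp
  qed
  have par: "even h \<longleftrightarrow> even ((i - 1) div 2)" unfolding hq by simp
  have "Legendre (int l) 3 = Legendre (i mod 3) 3" by (rule Legendre_cong[OF mod3])
  with i QR' par L1 L2 show ?thesis unfolding chi12_def i_def[symmetric] by auto
qed

text \<open>\<open>quotient_of\<close> reduces the fraction, but numerator times denominator changes
  only by squares prime to \<open>l\<close>.\<close>

lemma Legendre_rat_frac: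
  assumes l: "prime (int l)" and b: "\<not> int l dvd b"
  shows "Legendre_rat (of_int a / of_int b) l = of_int (Legendre (a * b) (int l))"
proof -
  have b0: "b \<noteq> 0" using b by auto
  obtain a' b' where q: "quotient_of (of_int a / of_int b) = (a', b')" by (cases "quotient_of (of_int a / of_int b)")
  have b'0: "b' > 0" using quotient_of_denom_pos[OF q] .
  have "of_int a / of_int b = (of_int a' / of_int b' :: rat)" by (rule quotient_of_div[OF q])
  hence "of_int (a * b') = (of_int (a' * b) :: rat)" using b0 b'0 by (simp add: field_simps)
  hence eq: "a * b' = a' * b" by (simp only: of_int_eq_iff)
  have "coprime a' b'" by (rule quotient_of_coprime[OF q])
  hence "b' dvd b" using eq by (metis coprime_commute coprime_dvd_mult_right_iff dvd_triv_right)
  hence b': "\<not> int l dvd b'" using b dvd_trans by blast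
  have "Legendre (a' * b') (int l) = Legendre (a' * b' * b^2) (int l)" by (rule Legendre_square_mult[OF l b, symmetric])
  also have "a' * b' * b^2 = (a * b) * b'^2" 
  proof -
    have "a' * b' * b^2 = (a' * b) * (b * b')" by (simp add: power2_eq_square)
    also have "\<dots> = (a * b) * b'^2" unfolding eq[symmetric] by (simp add: power2_eq_square)
    finally show ?thesis .
  qed
  also have "Legendre ((a * b) * b'^2) (int l) = Legendre (a * b) (int l)" by (rule Legendre_square_mult[OF l b'])
  finally show ?thesis unfolding Legendre_rat_def q by simp
qed

lemma Legendre_1: "p > 1 \<Longrightarrow> Legendre 1 p = 1"
  unfolding Legendre_def QuadRes_def by (auto simp: cong_def intro!: exI[of _ 1])

lemma Legendre_power: "prime (p::int) \<Longrightarrow> p > 2 \<Longrightarrow> Legendre (a ^ n) p = Legendre a p ^ n"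
  by (induction n) (simp_all add: Legendre_1 Legendre_mult)

text \<open>For negative \<open>s\<close> the power of \<open>p\<close> sits in the denominator. The
  symbol of \<open>p\<close> is a sign, so it equals its inverse and one formula covers both
  cases.\<close>

lemma Legendre_rat_theta:
  fixes e s :: int
  assumes l: "prime (int l)" "int l > 2" and p: "\<not> int l dvd int p"
  shows "Legendre_rat ((- 1) powi e * 2 * of_nat p powi s) l
    = of_int (Legendre (- 1) (int l)) powi e * of_int (Legendre 2 (int l)) * of_int (Legendre (int p) (int l)) powi s"
proof -
  define \<sigma> :: int where "\<sigma> = (if even e then 1 else - 1)"
  have n1: "\<not> int l dvd - 1" using l(2) by simp
  have sp: "(- 1 :: rat) powi e = of_int \<sigma>" by (simp add: \<sigma>_def power_int_minus_left)
  have L\<sigma>: "of_int (Legendre \<sigma> (int l)) = (of_int (Legendre (- 1) (int l)) powi e :: rat)"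
    using Legendre_sign[OF n1] l(2) by (auto simp: \<sigma>_def Legendre_1 power_int_minus_left)
  have Lmul: "Legendre (\<sigma> * 2 * int p ^ n) (int l) = Legendre \<sigma> (int l) * Legendre 2 (int l) * Legendre (int p) (int l) ^ n" for n
    by (simp add: Legendre_mult[OF l] Legendre_power[OF l])
  show ?thesis
  proof (cases "s \<ge> 0")
    case True
    have "(- 1) powi e * 2 * of_nat p powi s = (of_int (\<sigma> * 2 * int p ^ nat s) / of_int 1 :: rat)"
      unfolding sp using True by (simp add: power_int_def)
    hence "Legendre_rat ((- 1) powi e * 2 * of_nat p powi s) l = of_int (Legendre (\<sigma> * 2 * int p ^ nat s * 1) (int l))"
      using Legendre_rat_frac[OF l(1), of 1 "\<sigma> * 2 * int p ^ nat s"] l(2) by (simp only:) simp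
    also have "\<dots> = of_int (Legendre \<sigma> (int l)) * of_int (Legendre 2 (int l)) * of_int (Legendre (int p) (int l)) ^ nat s"
      by (simp add: Lmul)
    finally show ?thesis using True unfolding L\<sigma> by (simp add: power_int_def)
  next
    case False
    have "\<not> int l dvd int p ^ nat (- s)" using p l(1) prime_dvd_power by blast
    moreover have "(- 1) powi e * 2 * of_nat p powi s = (of_int (\<sigma> * 2) / of_int (int p ^ nat (- s)) :: rat)"
      unfolding sp using False by (simp add: power_int_def divide_inverse power_inverse)
    ultimately have "Legendre_rat ((- 1) powi e * 2 * of_nat p powi s) l = of_int (Legendre (\<sigma> * 2 * int p ^ nat (- s)) (int l))"
      using Legendre_rat_frac[OF l(1)] by (simp only:)
    also have "\<dots> = of_int (Legendre \<sigma> (int l)) * of_int (Legendre 2 (int l)) * of_int (Legendre (int p) (int l)) ^ nat (- s)"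
      by (simp add: Lmul)
    also have "of_int (Legendre (int p) (int l)) ^ nat (- s) = (of_int (Legendre (int p) (int l)) powi s :: rat)"
      using False Legendre_sign[OF p] by (auto simp: power_int_def)
    finally show ?thesis unfolding L\<sigma> .
  qed
qed

lemma of_rat_power_int: "of_rat (x powi n) = (of_rat x powi n :: 'a :: field_char_0)"
  by (simp add: power_int_def of_rat_power of_rat_inverse)

context weil_p
begin

text \<open>The even power of the Gauss sum gives the symbol of -1 and the power
  \<open>l powi e\<close>. Modulo \<open>l\<close> the number \<open>r + p * s\<close> is -24 Delta,
  and 24 is 6 up to a square; the symbol of 2 goes into theta, while that of 3 cancels the odd power
  of \<open>chi12 l\<close>.\<close>

lemma mid_const_Legendre:
  assumes e: "2 * e = 1 - (r + s)" and chi: "of_int (Legendre 3 l) = chi12 l"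
  shows "mid_const r s * of_int (Legendre (r + p * s) l)
    = of_int l powi (r + s) * (of_int (Legendre (- 1) l) powi e * of_int (Legendre 2 l) * of_int (Legendre p l) powi s
        * of_int l powi e * of_int (Legendre (- hecke_shift r s) l))"
proof -
  define G where "G = gauss_sum l 1"
  have odd: "odd (r + s)" using e by presburger
  have "G powi (1 - (r + s)) = (G powi 2) powi e" unfolding e[symmetric] power_int_mult ..
  also have "G powi 2 = G^2" by (simp add: power_int_def)
  also have "G^2 = of_int (Legendre (- 1) l) * of_int l" unfolding G_def by (rule gauss_sum_square[OF prime_l l_gt2])
  finally have G: "G powi (1 - (r + s)) = of_int (Legendre (- 1) l) powi e * of_int l powi e" by (simp only: power_int_mult_distrib)
  have c: "chi12 l = 1 \<or> chi12 l = - 1" using chi12_l_square by (simp add: square_eq_1_iff)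
  have x: "(chi12 l * of_int l) powi (r + s) = chi12 l * of_int l powi (r + s)"
    unfolding power_int_mult_distrib sign_powi_odd[OF c odd] ..
  \<comment> \<open>Because \<open>24 * k = L - 1\<close>, the two sides differ by a multiple of
    \<open>l\<close>.\<close>
  have "r + p * s = 24 * (- hecke_shift r s) + L * (r + p * s)" unfolding hecke_shift_def lk by (simp add: algebra_simps)
  hence "(r + p * s) - 24 * (- hecke_shift r s) = l * (l * (r + p * s))" by (simp add: power2_eq_square)
  hence "[r + p * s = 24 * (- hecke_shift r s)] (mod l)" unfolding cong_iff_dvd_diff by (rule dvdI)
  hence "Legendre (r + p * s) l = Legendre (24 * (- hecke_shift r s)) l" by (rule Legendre_cong)
  also have "24 * (- hecke_shift r s) = (2 * 3 * (- hecke_shift r s)) * 2^2" by simp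
  also have "Legendre ((2 * 3 * (- hecke_shift r s)) * 2^2) l = Legendre (2 * 3 * (- hecke_shift r s)) l"
    by (rule Legendre_square_mult[OF prime_l]) (use l_gt zdvd_imp_le[of l 2] in auto)
  also have "\<dots> = Legendre 2 l * Legendre 3 l * Legendre (- hecke_shift r s) l" unfolding Legendre_mult[OF prime_l l_gt2] ..
  finally have t: "of_int (Legendre (r + p * s) l) = of_int (Legendre 2 l) * chi12 l * of_int (Legendre (- hecke_shift r s) l)"
    unfolding chi[symmetric] by simp
  have "mid_const r s * of_int (Legendre (r + p * s) l) = (chi12 l * chi12 l) * (of_int l powi (r + s) * (of_int (Legendre (- 1) l) powi e * of_int (Legendre 2 l) * of_int (Legendre p l) powi s
        * of_int l powi e * of_int (Legendre (- hecke_shift r s) l)))"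
    unfolding mid_const_def G_def[symmetric] G x t by (simp only: mult_ac)
  thus ?thesis unfolding chi12_l_square by simp
qed

lemma quot_coeff_neg: "n < 0 \<Longrightarrow> quot_coeff r s n = 0" by (simp add: quot_coeff_def)

lemma quot_coeff_0: "quot_coeff r s 0 = 1"
  using eta_prod_has_prod(2)[of "nat p" r s] p_pos by (simp add: quot_coeff_def)

lemma k_pos: "k > 0"
proof -
  have "l * l > 3 * 3" using l_gt by (intro mult_strict_mono) auto
  hence "L > 9" by (simp add: power2_eq_square)
  thus ?thesis using lk by simp
qed

theorem hecke_identity:
  assumes e: "2 * e = 1 - (r + s)" and chi: "of_int (Legendre 3 l) = chi12 l"
    and t: "0 < r + p * s" "r + p * s < 24" and t': "- 24 < s + p * r" "s + p * r < 0"
  shows "of_int l powi (2 - (r + s)) * quot_coeff r s (hecke_shift r s)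
      + of_int (Legendre (- 1) l) powi e * of_int (Legendre 2 l) * of_int (Legendre p l) powi s
        * of_int l powi e * of_int (Legendre (- hecke_shift r s) l)
    = of_rat (fps_nth (Ep_star (nat p) / eta_prod (nat p) s r) (nat (- hecke_shift s r)))
      + of_int (Legendre (- 1) l) powi e * of_int (Legendre 2 l) * of_int (Legendre p l) powi r
        * of_int l powi e * of_int (Legendre (- hecke_shift s r) l)"
proof -
  have odd: "odd (r + s)" using e by presburger
  define M where "M = nat (- hecke_shift s r)"
  have D: "hecke_shift r s > 0" unfolding hecke_shift_def using k_pos t by simp
  have D': "hecke_shift s r < 0" unfolding hecke_shift_def using k_pos t' by (simp add: mult_pos_neg)
  have M: "int M = - hecke_shift s r" "M > 0" using D' by (simp_all add: M_def)
  \<comment> \<open>The upper bound 24 enters through \<open>24 * k = L - 1\<close>. It makes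
    \<open>L * m + hecke_shift r s\<close> negative for every \<open>m < 0\<close>, so no pole
    arises.\<close>
  have DL: "hecke_shift r s < L"
  proof -
    have "k * (r + p * s) < k * 24" using k_pos t by simp
    thus ?thesis unfolding hecke_shift_def lk by simp
  qed
  \<comment> \<open>Hence between \<open>- M\<close> and 0 only \<open>- M\<close> itself meets the
    divisibility condition in the first term of \<open>hecke_coeff\<close>.\<close>
  have ltL: "int M < L"
  proof -
    have "k * (- (s + p * r)) < k * 24" using k_pos t' by (intro mult_strict_left_mono) auto
    thus ?thesis unfolding M hecke_shift_def lk mult_minus_right by linarith
  qed
  have supp1: "hecke_coeff r s m = 0" if m: "m < 0" for m
  proof -
    have "(m - hecke_shift r s) div L < 0" using m D L_pos by (simp add: pos_imp_zdiv_neg_iff[OF L_pos])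
    moreover have "L * m + hecke_shift r s < 0"
    proof -
      have "L * m \<le> L * (- 1)" using m L_pos by (intro mult_left_mono) auto
      thus ?thesis using DL by simp
    qed
    ultimately show ?thesis using m by (simp add: hecke_coeff_def quot_coeff_neg)
  qed
  have supp2: "hecke_coeff s r m = 0" if m: "m < - int M" for m
  proof -
    have m0: "m < 0" using m by simp
    have "(m - hecke_shift s r) div L < 0" using m M L_pos by (simp add: pos_imp_zdiv_neg_iff[OF L_pos])
    moreover have "L * m + hecke_shift s r < 0" using m0 D' L_pos by (simp add: add_neg_neg mult_pos_neg)
    ultimately show ?thesis using m0 by (simp add: hecke_coeff_def quot_coeff_neg)
  qed
  have e1: "fps_nth (eta_prod (nat p) x y) 0 = 1" for x y using p_pos by (intro eta_prod_has_prod(2)) simp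
  have P2: "nat p \<ge> 2" using p_ge_2 by simp
  have lhs: "fps_nth (cusp_fps r s 0) 0 = hecke_coeff r s 0"
    unfolding cusp_fps_def by (simp add: hecke_fps_def e1 Ep_star_0[OF P2])
  define \<mu> where "\<mu> = Ep_star (nat p) / eta_prod (nat p) s r"
  have \<mu>0: "fps_nth \<mu> 0 = 1" unfolding \<mu>_def by (simp add: fps_divide_unit e1 Ep_star_0[OF P2])
  have cusp_fps: "cusp_fps s r M = hecke_fps s r M * complex_fps \<mu>"
    unfolding cusp_fps_def \<mu>_def by (simp add: fps_divide_unit e1 complex_fps_mult complex_fps_inverse mult.assoc)
  have hecke_coeff_mid: "hecke_coeff s r m = 0" if m: "- int M < m" "m < 0" for m
  proof -
    have "\<not> L dvd m - hecke_shift s r" using m ltL M zdvd_not_zless[of "m - hecke_shift s r" L] by simp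
    moreover have "L * m + hecke_shift s r < 0" using m D' L_pos by (simp add: add_neg_neg mult_pos_neg)
    ultimately show ?thesis using m by (simp add: hecke_coeff_def quot_coeff_neg)
  qed
  have hecke_coeff_low: "hecke_coeff s r (- int M) = of_int l powi (r + s)"
  proof -
    have "L * (- int M) + hecke_shift s r < 0" using M D' L_pos by (simp add: add_neg_neg mult_pos_neg)
    moreover have "- int M - hecke_shift s r = 0" using M by simp
    ultimately show ?thesis using M by (simp add: hecke_coeff_def quot_coeff_neg quot_coeff_0 add.commute)
  qed
  have hecke_coeff_0: "hecke_coeff s r 0 = mid_const s r * of_int (Legendre (s + p * r) l)"
  proof -
    have "\<not> L dvd 0 - hecke_shift s r" using ltL M zdvd_not_zless[of "int M" L] by simp
    thus ?thesis using D' by (simp add: hecke_coeff_def quot_coeff_neg quot_coeff_0)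
  qed
  have hecke_coeff_0': "hecke_coeff r s 0 = mid_const r s * of_int (Legendre (r + p * s) l) + of_int L * quot_coeff r s (hecke_shift r s)"
  proof -
    have "(0 - hecke_shift r s) div L < 0" using D L_pos by (simp add: pos_imp_zdiv_neg_iff[OF L_pos])
    thus ?thesis by (simp add: hecke_coeff_def quot_coeff_neg quot_coeff_0)
  qed
  have "fps_nth (cusp_fps s r M) M = (\<Sum>i=0..M. hecke_coeff s r (int i - int M) * of_rat (fps_nth \<mu> (M - i)))"
    unfolding cusp_fps fps_mult_nth by (simp add: hecke_fps_def)
  also have "\<dots> = (\<Sum>i\<in>{0, M}. hecke_coeff s r (int i - int M) * of_rat (fps_nth \<mu> (M - i)))"
  proof (rule sum.mono_neutral_right)
    show "\<forall>i\<in>{0..M} - {0, M}. hecke_coeff s r (int i - int M) * of_rat (fps_nth \<mu> (M - i)) = 0"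
      using hecke_coeff_mid by auto
  qed auto
  also have "\<dots> = of_int l powi (r + s) * of_rat (fps_nth \<mu> M) + mid_const s r * of_int (Legendre (s + p * r) l)"
    using M hecke_coeff_low hecke_coeff_0 by (simp add: \<mu>0)
  finally have rhs: "fps_nth (cusp_fps s r M) M = of_int l powi (r + s) * of_rat (fps_nth \<mu> M) + mid_const s r * of_int (Legendre (s + p * r) l)" .
  have e': "2 * e = 1 - (s + r)" using e by simp
  have "hecke_coeff r s 0 = fps_nth (cusp_fps s r M) M"
    using constant_term_identity[of r s M, OF odd supp1 supp2] unfolding lhs .
  hence "of_int l powi (r + s) * (of_int (Legendre (- 1) l) powi e * of_int (Legendre 2 l) * of_int (Legendre p l) powi s
        * of_int l powi e * of_int (Legendre (- hecke_shift r s) l)) + of_int L * quot_coeff r s (hecke_shift r s)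
     = of_int l powi (r + s) * of_rat (fps_nth \<mu> M) + of_int l powi (r + s) * (of_int (Legendre (- 1) l) powi e * of_int (Legendre 2 l) * of_int (Legendre p l) powi r
        * of_int l powi e * of_int (Legendre (- hecke_shift s r) l))"
    unfolding hecke_coeff_0' rhs mid_const_Legendre[OF e chi] mid_const_Legendre[OF e' chi] by (simp only: add.commute[of s r])
  \<comment> \<open>Dividing by \<open>l powi (r + s)\<close> turns the coefficient l^2 of c(Delta)
    into the power \<open>2 - (r + s)\<close> of the theorem.\<close>
  moreover have "of_int L = of_int l powi (r + s) * (of_int l powi (2 - (r + s)) :: complex)"
  proof -
    have "of_int l powi (r + s) * (of_int l powi (2 - (r + s)) :: complex) = of_int l powi ((r + s) + (2 - (r + s)))"
      using l_pos by (intro power_int_add[symmetric]) simp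
    also have "\<dots> = of_int L" by (simp add: power_int_def)
    finally show ?thesis ..
  qed
  ultimately have "of_int l powi (r + s) * (of_int l powi (2 - (r + s)) * quot_coeff r s (hecke_shift r s)
      + of_int (Legendre (- 1) l) powi e * of_int (Legendre 2 l) * of_int (Legendre p l) powi s
        * of_int l powi e * of_int (Legendre (- hecke_shift r s) l))
    = of_int l powi (r + s) * (of_rat (fps_nth \<mu> M) + of_int (Legendre (- 1) l) powi e * of_int (Legendre 2 l) * of_int (Legendre p l) powi r
        * of_int l powi e * of_int (Legendre (- hecke_shift s r) l))"
    by (simp add: algebra_simps)
  moreover have "(of_int l powi (r + s) :: complex) \<noteq> 0" using l_pos by simp
  ultimately show ?thesis unfolding \<mu>_def M_def by (simp only: mult_cancel_left simp_thms)
qed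

end

theorem theorem4p6:
  fixes p l :: nat and r s :: int
    and c \<mu> :: "rat \<Rightarrow> rat" and \<phi>_star :: "rat fps"
    and \<epsilon> \<theta> \<theta>_star \<Delta> \<Delta>_star :: rat
  assumes p: "p \<in> {2, 3, 5, 7, 13}"
    and l: "prime l" "l \<noteq> p" "l > 3"
    and rs: "s > 0" "r < 0" "even r \<longleftrightarrow> odd s"
    and bounds: "0 < r + s * int p" "r + s * int p < 24"
      "-24 < s + r * int p" "s + r * int p < 0"
    and c: "c = coeff_at (eta_prod p r s)"
    and \<phi>_star: "\<phi>_star = eta_prod p s r"
    and \<epsilon>: "\<epsilon> = of_int (r + s) / 2"
    and \<theta>: "\<theta> = (-1) powi \<lfloor>1/2 - (of_int (r + s) :: rat) / 2\<rfloor> * 2 * of_nat p powi s"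
    and \<theta>_star: "\<theta>_star = (-1) powi \<lfloor>1/2 - (of_int (r + s) :: rat) / 2\<rfloor> * 2 * of_nat p powi r"
    and \<Delta>: "\<Delta> = of_int (r + s * int p) * (of_nat l ^ 2 - 1) / 24"
    and \<Delta>_star: "\<Delta>_star = of_int (s + r * int p) * (of_nat l ^ 2 - 1) / 24"
    and \<mu>: "\<mu> = coeff_at (Ep_star p / \<phi>_star)"
  shows "of_nat l powi \<lfloor>2 - 2 * \<epsilon>\<rfloor> * c \<Delta>
           + Legendre_rat \<theta> l * of_nat l powi \<lfloor>1/2 - \<epsilon>\<rfloor> * Legendre_rat (- \<Delta>) l
           + c (- \<Delta> / of_nat l ^ 2)
         = \<mu> (- \<Delta>_star)
           + Legendre_rat \<theta>_star l * of_nat l powi \<lfloor>1/2 - \<epsilon>\<rfloor> * Legendre_rat (- \<Delta>_star) l"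
proof -
  have pl: "prime (int l)" "int l > 3" "int l > 2" using l by auto
  have pp: "prime p" using p by auto
  have "chi12 (int l) \<noteq> 0" using prime_gt_3_mod_12[OF l(1,3)] by (auto simp: chi12_def)
  \<comment> \<open>A prime above 3 is a unit modulo 12, so its square is 1 modulo 24.\<close>
  then obtain k where k: "int l ^ 2 = 1 + 24 * k" using chi12_square_mod by blast
  interpret weil_p "int l" k "int p"
    by unfold_locales (use pl pp l k in auto)
  obtain e where e: "2 * e = 1 - (r + s)"
  proof -
    have "even (1 - (r + s))" using rs(3) by auto
    thus ?thesis using that by (metis dvdE)
  qed
  have re: "(of_int (r + s) :: rat) = 1 - 2 * of_int e" using arg_cong[OF e, of "of_int :: int \<Rightarrow> rat"] by simp
  have f1: "\<lfloor>1/2 - (of_int (r + s) :: rat) / 2\<rfloor> = e"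
  proof -
    have "1/2 - (of_int (r + s) :: rat) / 2 = of_int e" unfolding re by (simp add: diff_divide_distrib)
    thus ?thesis by (simp only: floor_of_int)
  qed
  have f2: "\<lfloor>1/2 - \<epsilon>\<rfloor> = e" unfolding \<epsilon> by (rule f1)
  have f3: "\<lfloor>2 - 2 * \<epsilon>\<rfloor> = 2 - (r + s)"
  proof -
    have "2 - 2 * \<epsilon> = of_int (2 - (r + s))" unfolding \<epsilon> by (simp add: field_simps)
    thus ?thesis by (simp only: floor_of_int)
  qed
  have kq: "(of_nat l ^ 2 - 1 :: rat) = 24 * of_int k"
  proof -
    have "(of_int (int l ^ 2) :: rat) = of_int (1 + 24 * k)" using k by simp
    thus ?thesis by simp
  qed
  have \<Delta>': "\<Delta> = of_int (hecke_shift r s)" unfolding \<Delta> hecke_shift_def kq by (simp add: algebra_simps)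
  have \<Delta>s': "\<Delta>_star = of_int (hecke_shift s r)" unfolding \<Delta>_star hecke_shift_def kq by (simp add: algebra_simps)
  have b: "0 < r + int p * s" "r + int p * s < 24" "- 24 < s + int p * r" "s + int p * r < 0"
    using bounds by (simp_all add: mult.commute)
  have D: "hecke_shift r s > 0" unfolding hecke_shift_def using k_pos b by simp
  have D': "hecke_shift s r < 0" unfolding hecke_shift_def using k_pos b by (simp add: mult_pos_neg)
  have c1: "of_rat (c \<Delta>) = quot_coeff r s (hecke_shift r s)"
  proof -
    have "\<Delta> = of_nat (nat (hecke_shift r s))" unfolding \<Delta>' using D by simp
    hence "c \<Delta> = fps_nth (eta_prod p r s) (nat (hecke_shift r s))" unfolding c by (simp only: coeff_at_of_nat)
    thus ?thesis using D by (simp add: quot_coeff_def)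
  qed
  \<comment> \<open>The argument is negative, where \<open>coeff_at\<close> has the default value
    0.\<close>
  have c2: "c (- \<Delta> / of_nat l ^ 2) = 0"
  proof -
    have "- \<Delta> / of_nat l ^ 2 < 0" unfolding \<Delta>' using D l by (simp add: divide_neg_pos)
    hence "- \<Delta> / of_nat l ^ 2 \<notin> \<nat>" by (metis Nats_cases not_less of_nat_0_le_iff)
    thus ?thesis unfolding c coeff_at_def by simp
  qed
  have m1: "\<mu> (- \<Delta>_star) = fps_nth (Ep_star p / eta_prod p s r) (nat (- hecke_shift s r))"
  proof -
    have "- \<Delta>_star = of_nat (nat (- hecke_shift s r))" unfolding \<Delta>s' using D' by simp
    thus ?thesis unfolding \<mu> \<phi>_star by (simp only: coeff_at_of_nat)
  qed
  have L1: "Legendre_rat (- \<Delta>) l = of_int (Legendre (- hecke_shift r s) (int l))"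
    using Legendre_rat_of_int[of "- hecke_shift r s" l] unfolding \<Delta>' by simp
  have L2: "Legendre_rat (- \<Delta>_star) l = of_int (Legendre (- hecke_shift s r) (int l))"
    using Legendre_rat_of_int[of "- hecke_shift s r" l] unfolding \<Delta>s' by simp
  note th = Legendre_rat_theta[OF pl(1,3) l_not_dvd_p]
  \<comment> \<open>The analytic identity lives in the complex numbers; injectivity of
    \<open>of_rat\<close> brings it back to the rationals.\<close>
  have "(of_rat (of_nat l powi \<lfloor>2 - 2 * \<epsilon>\<rfloor> * c \<Delta>
           + Legendre_rat \<theta> l * of_nat l powi \<lfloor>1/2 - \<epsilon>\<rfloor> * Legendre_rat (- \<Delta>) l
           + c (- \<Delta> / of_nat l ^ 2)) :: complex)
     = of_rat (\<mu> (- \<Delta>_star) + Legendre_rat \<theta>_star l * of_nat l powi \<lfloor>1/2 - \<epsilon>\<rfloor> * Legendre_rat (- \<Delta>_star) l)"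
    using hecke_identity[OF e Legendre_3_eq_chi12[OF l(1,3)] b]
    unfolding \<theta> \<theta>_star f1 f2 f3 th c2 L1 L2 m1 of_rat_add of_rat_mult of_rat_power_int c1
    by simp
  thus ?thesis by (simp only: of_rat_eq_iff)
qed

end
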